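(* Let $S\subset\mathbb{R}^2$ be a deterministic set and let $\eta_S$ be the channel access probability of the typical transmitter resulting from the scheduling policy defined in the context. For $0<\kappa<1$, the complementary cumulative distribution function of $\eta_S$ is $$\mathbb{P}(\eta_S>\kappa)=\frac1{2\pi}\int_{-\infty}^{+\infty}\mathcal L_{\mathcal U(\kappa,S)}(j\omega)\,\frac{e^{j\omega(1-\mathcal V(\kappa,S))}-1}{j\omega}\,d\omega,$$ and for $\kappa=1$, $$\mathbb{P}(\eta_S=1)=\mathbb{P}\big(\mathcal U(1,S)<1-\mathcal V(1,S)\big),$$ where $j=\sqrt{-1}$, $$\mathcal U(\kappa,S)=\sum_{y_i\in\bar\Phi}\frac{\kappa\,\chi_{\{y_i\in S\}}}{\frac{\|y_i\|^\alpha}{Tr^\alpha}+1-\kappa},\qquad \mathcal V(\kappa,S)=\int_{\mathbb{R}^2\setminus S}\frac{\lambda\kappa\,dz}{1+\|z\|^\alpha/(Tr^\alpha)},$$ and $\mathcal L_{\mathcal U(\kappa,S)}(s)$ is the Laplace transform of $\mathcal U(\kappa,S)$, given by $$\mathcal L_{\mathcal U(\kappa,S)}(s)=\exp\left(-\lambda\int_S\left[1-\exp\left(-\frac{s\kappa Tr^\alpha}{\|z\|^\alpha+(1-\kappa)Tr^\alpha}\right)\right]dz\right).$$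
   Context: Poisson bipolar network: transmitters form a homogeneous Poisson point process $\tilde\Phi=\{X_i\}$ on $\mathbb{R}^2$ with density $\lambda$; transmitter $X_i$ has a dedicated receiver $y_i$ at distance $r$ in a random orientation, and $\bar\Phi=\{y_i\}$ is also a homogeneous Poisson point process of density $\lambda$. $\alpha$ is the path-loss exponent and $T$ the decoding threshold. $\chi_E$ is the indicator of the event $E$. $\mathcal D_{0j}=\|X_0-y_j\|^\alpha/(Tr^\alpha)$. Scheduling policy: the typical transmitter $X_0$ is placed at the origin (under the Palm distribution) and observes the receivers in the set $S$. Its channel access probability $\eta_S$ is the unique solution in $(0,1]$ of $$\frac1{\eta_S}-\sum_{j\neq0,\,y_j\in S}\frac{1}{1+\mathcal D_{0j}-\eta_S}-\int_{\mathbb{R}^2\setminus S}\frac{\lambda\,dz}{1+\|z\|^\alpha/(Tr^\alpha)}=0$$ if $\sum_{j\neq0,\,y_j\in S}\frac1{\mathcal D_{0j}}+\int_{\mathbb{R}^2\setminus S}\frac{\lambda\,dz}{1+\|z\|^\alpha/(Tr^\alpha)}>1$, and $\eta_S=1$ otherwise.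
   Formalization: For κ<1 the formula is claimed only if S has infinite area or V(κ,S)=1 (else the integral, read as lim of ∫ over [-R,R], is off by half the atom of U at 0); for κ=1 only if S has infinite area or V(1,S)≠1; α>2 and S Borel are assumed. *)

theory Defs
  imports "HOL-Probability.Probability"
begin

section \<open>Poisson bipolar networks\<close>

text \<open>
  A point process on the plane is given by a measurable enumeration of its points,
  indexed by the naturals.  The process is homogeneous Poisson of density \<open>lam\<close> if it is
  locally finite and the numbers of points in disjoint bounded Borel sets are
  independent Poisson variables with mean \<open>lam\<close> times the area.  The Poisson weights are
  written out since \<^const>\<open>poisson_pmf\<close> is unspecified at rate 0 (null sets).
\<close>

definition point_count :: "(nat \<Rightarrow> 'w \<Rightarrow> real^2) \<Rightarrow> (real^2) set \<Rightarrow> 'w \<Rightarrow> nat" where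
  "point_count X B \<omega> = card {i. X i \<omega> \<in> B}"

definition homogeneous_ppp :: "'w measure \<Rightarrow> real \<Rightarrow> (nat \<Rightarrow> 'w \<Rightarrow> real^2) \<Rightarrow> bool" where
  "homogeneous_ppp M lam X \<longleftrightarrow>
     (\<forall>i. X i \<in> borel_measurable M) \<and>
     (\<forall>\<omega>\<in>space M. \<forall>B. bounded B \<longrightarrow> finite {i. X i \<omega> \<in> B}) \<and>
     (\<forall>B k. B \<in> sets borel \<and> bounded B \<longrightarrow>
        measure M {\<omega>\<in>space M. point_count X B \<omega> = k} =
          (lam * measure lborel B) ^ k / fact k * exp (- (lam * measure lborel B))) \<and>
     (\<forall>(I :: nat set) A. finite I \<and> disjoint_family_on A I \<and>
          (\<forall>n\<in>I. A n \<in> sets borel \<and> bounded (A n)) \<longrightarrow>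
        prob_space.indep_vars M (\<lambda>_. count_space UNIV) (\<lambda>n. point_count X (A n)) I)"

text \<open>
  \<open>X i\<close> is the position of a transmitter and \<open>\<Theta> i\<close> the direction of its receiver.
  That the receivers again form a Poisson process is a consequence and not assumed.
\<close>

definition bipolar_network ::
    "'w measure \<Rightarrow> real \<Rightarrow> (nat \<Rightarrow> 'w \<Rightarrow> real^2) \<Rightarrow> (nat \<Rightarrow> 'w \<Rightarrow> real) \<Rightarrow> bool" where
  "bipolar_network M lam X \<Theta> \<longleftrightarrow>
     prob_space M \<and>
     homogeneous_ppp M lam X \<and>
     prob_space.indep_vars M (\<lambda>_. borel) \<Theta> UNIV \<and>
     (\<forall>i. distr M borel (\<Theta> i) = uniform_measure lborel {0..<2 * pi}) \<and>
     prob_space.indep_set M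
       (sets (vimage_algebra (space M) (\<lambda>\<omega> i. X i \<omega>) (PiM UNIV (\<lambda>_. borel))))
       (sets (vimage_algebra (space M) (\<lambda>\<omega> i. \<Theta> i \<omega>) (PiM UNIV (\<lambda>_. borel))))"

definition receiver ::
    "real \<Rightarrow> (nat \<Rightarrow> 'w \<Rightarrow> real^2) \<Rightarrow> (nat \<Rightarrow> 'w \<Rightarrow> real) \<Rightarrow> nat \<Rightarrow> 'w \<Rightarrow> real^2" where
  "receiver r X \<Theta> i \<omega> = X i \<omega> + r *\<^sub>R vector [cos (\<Theta> i \<omega>), sin (\<Theta> i \<omega>)]"

text \<open>
  Palm probability.  For each point \<open>i\<close> let \<open>E i \<omega>\<close> say that the configuration \<open>\<omega>\<close>, translated
  so that \<open>X i \<omega>\<close> becomes the origin, has some fixed property.  The Palm probability of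
  this property is the expected number of points in a window \<open>B\<close> for which it holds,
  divided by the expected number of points in \<open>B\<close>.  For a stationary process this
  does not depend on \<open>B\<close>.
\<close>

definition palm_prob ::
    "'w measure \<Rightarrow> (nat \<Rightarrow> 'w \<Rightarrow> real^2) \<Rightarrow> (real^2) set \<Rightarrow> (nat \<Rightarrow> 'w \<Rightarrow> bool) \<Rightarrow> real" where
  "palm_prob M X B E =
     (LINT \<omega>|M. real (card {i. X i \<omega> \<in> B \<and> E i \<omega>})) / (LINT \<omega>|M. real (card {i. X i \<omega> \<in> B}))"


section \<open>The scheduling policy\<close>

definition path_ratio :: "real \<Rightarrow> real \<Rightarrow> real \<Rightarrow> real^2 \<Rightarrow> real" where
  "path_ratio \<alpha> T r z = norm z powr \<alpha> / (T * r powr \<alpha>)"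

text \<open>
  The transmitter sits at the origin; the receivers of the other transmitters are the
  points \<open>y j\<close> with \<open>j \<in> J\<close>.
\<close>

definition access_prob ::
    "real \<Rightarrow> real \<Rightarrow> real \<Rightarrow> real \<Rightarrow> (real^2) set \<Rightarrow> nat set \<Rightarrow> (nat \<Rightarrow> real^2) \<Rightarrow> real" where
  "access_prob lam \<alpha> T r S J y =
     (let D = (\<lambda>j. path_ratio \<alpha> T r (0 - y j));
          N = {j\<in>J. y j \<in> S};
          V = (LINT z:(- S)|lborel. lam / (1 + path_ratio \<alpha> T r z))
      in if (\<Sum>\<^sub>\<infinity>j\<in>N. 1 / D j) + V > 1
         then (THE \<eta>. 0 < \<eta> \<and> \<eta> \<le> 1 \<and> 1 / \<eta> - (\<Sum>\<^sub>\<infinity>j\<in>N. 1 / (1 + D j - \<eta>)) - V = 0)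
         else 1)"

text \<open>The access probability of transmitter \<open>i\<close>, computed in coordinates centred at it.\<close>

definition access_prob_at ::
    "real \<Rightarrow> real \<Rightarrow> real \<Rightarrow> real \<Rightarrow> (real^2) set \<Rightarrow>
     (nat \<Rightarrow> 'w \<Rightarrow> real^2) \<Rightarrow> (nat \<Rightarrow> 'w \<Rightarrow> real) \<Rightarrow> nat \<Rightarrow> 'w \<Rightarrow> real" where
  "access_prob_at lam \<alpha> T r S X \<Theta> i \<omega> =
     access_prob lam \<alpha> T r S (- {i}) (\<lambda>j. receiver r X \<Theta> j \<omega> - X i \<omega>)"


section \<open>The variables in the distribution formula\<close>

definition \<U> ::
    "real \<Rightarrow> real \<Rightarrow> real \<Rightarrow> (nat \<Rightarrow> 'w \<Rightarrow> real^2) \<Rightarrow> real \<Rightarrow> (real^2) set \<Rightarrow> 'w \<Rightarrow> real" where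
  "\<U> \<alpha> T r Y \<kappa> S \<omega> =
     (\<Sum>\<^sub>\<infinity>i. \<kappa> * indicator S (Y i \<omega>) / (path_ratio \<alpha> T r (Y i \<omega>) + 1 - \<kappa>))"

definition \<V> :: "real \<Rightarrow> real \<Rightarrow> real \<Rightarrow> real \<Rightarrow> real \<Rightarrow> (real^2) set \<Rightarrow> real" where
  "\<V> lam \<alpha> T r \<kappa> S = (LINT z:(- S)|lborel. lam * \<kappa> / (1 + path_ratio \<alpha> T r z))"

definition laplace_transform :: "'w measure \<Rightarrow> ('w \<Rightarrow> real) \<Rightarrow> complex \<Rightarrow> complex" where
  "laplace_transform M Z s = (LINT \<omega>|M. exp (- s * complex_of_real (Z \<omega>)))"

text \<open>
  \<open>(1/2\<pi>) \<integral> f d\<omega>\<close> over the whole line has the value \<open>v\<close>, the integral being the limit of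
  the integrals over \<open>[-R, R]\<close>, as usual for inversion formulas: the integrand need not be
  absolutely integrable.
\<close>

definition has_inversion_integral :: "(real \<Rightarrow> complex) \<Rightarrow> complex \<Rightarrow> bool" where
  "has_inversion_integral f v \<longleftrightarrow>
     ((\<lambda>R::real. 1 / (2 * pi) * (CLBINT w=-R..R. f w)) \<longlongrightarrow> v) at_top"

text \<open>
  If \<open>S\<close> has finite area, then \<open>\<U> \<kappa> S\<close> vanishes with probability \<open>p = exp (- lam * area S) > 0\<close>.
  The inversion integral then counts this atom at the end point of the interval with
  weight \<open>1/2\<close>, and falls short of the distribution by \<open>p/2\<close> unless \<open>\<V> \<kappa> S = 1\<close>;
  and if \<open>\<V> 1 S = 1\<close>, the events \<open>\<U> 1 S \<le> 1 - \<V> 1 S\<close> and \<open>\<U> 1 S < 1 - \<V> 1 S\<close> differ by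
  the atom.  Hence the side conditions on \<open>S\<close> in the theorem on the distribution of the
  access probability.
\<close>

end

theory Submission
  imports Defs
begin

text \<open>
  Conditionally on the transmitters the receivers are independent, so averaging over their angles
  turns a product over receivers into a product over transmitters, and the Laplace functional of
  the Poisson process gives the Laplace transform of the interference.  The Palm probability is
  handled by the Mecke equation for functionals \<open>\<Prod>\<^bsub>j \<noteq> i\<^esub> w (X i) (X j)\<close>.  If \<open>w\<close> takes
  finitely many values as a function of cells, this equation is a finite computation with independent
  Poisson counts; both of its sides are Lipschitz in \<open>w\<close> for the \<open>L\<^sup>1\<close> distance, because the second
  factorial moment measure is \<open>lam\<^sup>2\<close> times Lebesgue measure, and density of the simple \<open>w\<close> does the
  rest.  Hence the characteristic function of the interference at a typical transmitter, its own
  receiver left out, is that of the interference at the origin, and by Levy's uniqueness theorem so is its law.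

  The access probability exceeds \<open>\<kappa>\<close> exactly when the left side of its defining equation is positive
  at \<open>\<kappa>\<close>, since this function is strictly decreasing; that is an upper bound on the interference.
  The law of the interference has no atom apart from 0, because the level sets of the path gain are
  circles, which the direction of a single receiver avoids almost surely.  So Levy's inversion
  formula applies.
\<close>

section \<open>Inequalities and integrals\<close>

text \<open>Two conventions shape the proof: a divergent \<open>infsum\<close> and a quotient by 0
  are both 0. The interference must therefore be shown to be finite almost surely, both at the
  origin and, under the Campbell measure, at the transmitters of the window; the latter rests on the
  second factorial moment measure. For \<kappa> = 1 the path gain is singular at 0 and its sum may
  have infinite mean. So only the far field is integrated; the near field is a finite sum because a
  bounded set holds finitely many transmitters. Laplace transforms are computed for gains of bounded
  support and pass to the limit by truncation. Product functionals suffice for the Palm side because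
  the Laplace transform of a sum is the expectation of a product. Averaging over the angle of a
  receiver leaves Lebesgue integrals unchanged, since every displacement is a translation. The
  access probability is 1 under a separate inequality, which involves the gain for \<kappa> = 1. Off
  the origin the gain for \<kappa> is at most \<kappa> times that gain, so this inequality implies
  the one that describes access above \<kappa>.\<close>

text \<open>Summability is not assumed: for a divergent series both sides take the value 0, as
  \<open>enn2real\<close> sends infinity to 0. Measurability of the interference thus follows
  without any finiteness condition.\<close>

lemma infsum_eq_enn2real_suminf:
  fixes f :: "nat \<Rightarrow> real"
  assumes "\<And>i. i \<in> A \<Longrightarrow> 0 \<le> f i"
  shows "infsum f A = enn2real (\<Sum>i. ennreal (indicator A i * f i))"
proof -
  let ?h = "\<lambda>i. indicator A i * f i"
  have pos: "0 \<le> ?h i" for i using assms by (auto simp: indicator_def)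
  have eq: "infsum f A = infsum ?h UNIV" by (rule infsum_cong_neutral) auto
  show ?thesis
  proof (cases "summable ?h")
    case True
    then have "?h summable_on UNIV" by (simp add: summable_on_UNIV_nonneg_real_iff pos)
    then have "?h sums infsum ?h UNIV" by (intro has_sum_imp_sums has_sum_infsum)
    then have "infsum ?h UNIV = suminf ?h" by (rule sums_unique)
    then show ?thesis using True pos by (simp add: eq suminf_ennreal2 suminf_nonneg)
  next
    case False
    then have "\<not> ?h summable_on UNIV" by (simp add: summable_on_UNIV_nonneg_real_iff pos)
    moreover have "(\<Sum>i. ennreal (?h i)) = top"
      by (rule ccontr) (use False summable_suminf_not_top[OF pos] in simp)
    ultimately show ?thesis by (simp add: eq infsum_not_exists)
  qed
qed

text \<open>Mean value inequality on the left half-plane, which is convex and on which the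
  derivative \<open>exp\<close> has modulus at most 1.\<close>

lemma norm_exp_diff_le:
  fixes a b :: complex
  assumes "Re a \<le> 0" "Re b \<le> 0"
  shows "norm (exp a - exp b) \<le> norm (a - b)"
proof -
  have "norm (exp a - exp b) \<le> 1 * norm (a - b)"
  proof (rule field_differentiable_bound[where S="{z. Re z \<le> 0}" and f' = exp])
    show "convex {z. Re z \<le> 0}" by (rule convex_halfspace_Re_le)
    show "(exp has_field_derivative exp z) (at z within {z. Re z \<le> 0})" for z :: complex
      by (rule DERIV_exp[THEN DERIV_subset]) auto
  qed (use assms in \<open>auto simp: norm_exp_eq_Re\<close>)
  then show ?thesis by simp
qed

lemma countable_cos_eq: "countable {\<theta>::real. cos (\<theta> - \<phi>) = k}"
proof (cases "\<exists>t. cos t = k")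
  case True
  then obtain t where t: "cos t = k" by blast
  have "{\<theta>. cos (\<theta> - \<phi>) = k} \<subseteq>
      (\<lambda>n. \<phi> + t + 2 * of_int n * pi) ` UNIV \<union> (\<lambda>n. \<phi> - t + 2 * of_int n * pi) ` UNIV"
  proof
    fix \<theta> assume "\<theta> \<in> {\<theta>. cos (\<theta> - \<phi>) = k}"
    then have "cos (\<theta> - \<phi>) = cos t" using t by simp
    then obtain n where n: "n \<in> \<int>" "\<theta> - \<phi> = t + 2 * n * pi \<or> \<theta> - \<phi> = - t + 2 * n * pi"
      unfolding cos_eq by blast
    from n(1) obtain m where "n = of_int m" by (rule Ints_cases)
    with n(2) show "\<theta> \<in> (\<lambda>n. \<phi> + t + 2 * of_int n * pi) ` UNIV \<union> (\<lambda>n. \<phi> - t + 2 * of_int n * pi) ` UNIV"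
      by (auto simp: image_iff algebra_simps)
  qed
  then show ?thesis by (rule countable_subset) auto
next
  case False
  then have "{\<theta>. cos (\<theta> - \<phi>) = k} = {}" by auto
  then show ?thesis by (simp only: countable_empty)
qed

text \<open>In polar coordinates for (a, b) the left side is a positive multiple of a shifted
  cosine.\<close>

lemma countable_cos_sin_eq:
  fixes a b k :: real
  assumes "a \<noteq> 0 \<or> b \<noteq> 0"
  shows "countable {\<theta>. a * cos \<theta> + b * sin \<theta> = k}"
proof -
  define R where "R = sqrt (a\<^sup>2 + b\<^sup>2)"
  have R: "R > 0" "R\<^sup>2 = a\<^sup>2 + b\<^sup>2" using assms by (auto simp: R_def real_sqrt_gt_zero sum_power2_gt_zero_iff)
  have "(a/R)\<^sup>2 + (b/R)\<^sup>2 = (a\<^sup>2 + b\<^sup>2) / R\<^sup>2"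
    by (simp only: power_divide add_divide_distrib)
  also have "\<dots> = 1" unfolding R(2)[symmetric] using R(1) by simp
  finally have "(a/R)\<^sup>2 + (b/R)\<^sup>2 = 1" .
  then obtain \<phi> where \<phi>: "a / R = cos \<phi>" "b / R = sin \<phi>" by (rule sincos_total_2pi) auto
  have "a * cos \<theta> + b * sin \<theta> = R * cos (\<theta> - \<phi>)" for \<theta>
    using \<phi> R by (simp add: cos_diff field_simps)
  then have "{\<theta>. a * cos \<theta> + b * sin \<theta> = k} = {\<theta>. cos (\<theta> - \<phi>) = k / R}"
    using R by (auto simp: field_simps)
  then show ?thesis by (simp only: countable_cos_eq)
qed

text \<open>The integrand is majorised by a sum over dyadic scales: the constant
  \<open>(2 powr - \<alpha>) ^ k\<close> on the ball of radius \<open>2 ^ (k+1)\<close>. The ball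
  has area proportional to 4 to the power k, so the integrals form a geometric series of ratio
  \<open>2 powr (2 - \<alpha>)\<close>, and this is where \<alpha> > 2 enters.\<close>

lemma nn_integral_norm_powr_outside_ball:
  assumes "\<alpha> > 2"
  shows "(\<integral>\<^sup>+z. ennreal (indicator {z. 1 \<le> norm z} z * norm z powr - \<alpha>) \<partial>(lborel :: (real^2) measure)) < \<infinity>"
proof -
  define t :: "nat \<Rightarrow> real^2 \<Rightarrow> ennreal"
    where "t k z = ennreal ((2 powr - \<alpha>) ^ k) * indicator (ball 0 (2 ^ (k+1))) z" for k z
  have [measurable]: "t k \<in> borel_measurable borel" for k 
    unfolding t_def[abs_def]
    by (intro borel_measurable_times_ennreal borel_measurable_indicator borel_measurable_const) (rule borel_open[OF open_ball])
  have le: "ennreal (indicator {z. 1 \<le> norm z} z * norm z powr - \<alpha>) \<le> (\<Sum>k. t k z)" for z :: "real^2"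
  proof (cases "1 \<le> norm z")
    case True
    \<comment> \<open>The dyadic shell of \<open>z\<close>: its norm lies between the k-th and the
      next power of 2.\<close>
    define k where "k = nat \<lfloor>log 2 (norm z)\<rfloor>"
    have l: "0 \<le> log 2 (norm z)" using True by (subst zero_le_log_cancel_iff) auto
    have k: "real k \<le> log 2 (norm z)" "log 2 (norm z) < real k + 1" using l by (simp_all add: k_def)
    have "2 powr real k \<le> norm z" using k(1) True by (subst (asm) le_log_iff) auto
    then have lo: "norm z powr - \<alpha> \<le> (2 powr real k) powr - \<alpha>"
      using True assms by (intro powr_mono2') auto
    also have "(2 powr real k) powr - \<alpha> = (2 powr - \<alpha>) ^ k"
      by (simp add: powr_powr powr_power mult.commute)
    finally have lo: "norm z powr - \<alpha> \<le> (2 powr - \<alpha>) ^ k" .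
    have "norm z < 2 powr (real k + 1)" using k(2) True by (subst (asm) log_less_iff) auto
    also have "2 powr (real k + 1) = (2::real) ^ (k+1)"
      by (simp add: powr_add powr_realpow)
    finally have hi: "z \<in> ball 0 (2 ^ (k+1))" by (simp only: mem_ball dist_0_norm)
    have "ennreal (indicator {z. 1 \<le> norm z} z * norm z powr - \<alpha>) \<le> t k z"
    proof -
      have "t k z = ennreal ((2 powr - \<alpha>) ^ k)"
        using hi by (simp only: t_def indicator_simps mult_1_right)
      moreover have "indicator {z. 1 \<le> norm z} z * norm z powr - \<alpha> = norm z powr - \<alpha>" using True by simp
      ultimately show ?thesis using lo by (simp only: ennreal_leI)
    qed
    also have "\<dots> \<le> (\<Sum>k. t k z)"
      using sum_le_suminf[of "\<lambda>k. t k z" "{k}"] by simp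
    finally show ?thesis .
  qed simp
  define v where "v = unit_ball_vol (real DIM(real^2))"
  have v: "v \<ge> 0" by (simp add: v_def)
  have "(\<integral>\<^sup>+z. ennreal (indicator {z. 1 \<le> norm z} z * norm z powr - \<alpha>) \<partial>(lborel :: (real^2) measure))
      \<le> (\<integral>\<^sup>+z. (\<Sum>k. t k z) \<partial>lborel)"
    by (intro nn_integral_mono le)
  also have "\<dots> = (\<Sum>k. \<integral>\<^sup>+z. t k z \<partial>lborel)" by (intro nn_integral_suminf) auto
  also have "\<dots> = (\<Sum>k. ennreal (4 * v * (2 powr (2 - \<alpha>)) ^ k))"
  proof (intro suminf_cong)
    fix k
    have "(\<integral>\<^sup>+z. t k z \<partial>lborel) = ennreal ((2 powr - \<alpha>) ^ k) * emeasure lborel (ball (0::real^2) (2 ^ (k+1)))"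
      unfolding t_def by (subst nn_integral_cmult_indicator) auto
    also have "\<dots> = ennreal ((2 powr - \<alpha>) ^ k * (v * (2 ^ (k+1)) ^ 2))"
      by (subst emeasure_ball) (auto simp: v_def ennreal_mult)
    also have "(2 powr - \<alpha>) ^ k * (v * (2 ^ (k+1)) ^ 2) = 4 * v * (2 powr (2 - \<alpha>)) ^ k"
    proof -
      have "2 powr (2 - \<alpha>) = 4 * 2 powr - \<alpha>"
        using powr_add[of 2 2 "- \<alpha>"] by simp
      moreover have "((2::real) ^ (k+1))^2 = 4 * 4 ^ k"
      proof -
        have "((2::real) ^ (k+1))^2 = (2^2)^(k+1)" by (simp only: power_mult[symmetric] mult.commute)
        then show ?thesis by simp
      qed
      ultimately show ?thesis by (simp add: power_mult_distrib)
    qed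
    finally show "(\<integral>\<^sup>+z. t k z \<partial>lborel) = ennreal (4 * v * (2 powr (2 - \<alpha>)) ^ k)" .
  qed
  also have "\<dots> < \<infinity>"
  proof -
    have "2 powr (2 - \<alpha>) < 1" using assms powr_less_mono[of "2-\<alpha>" 0 2] by simp
    then have "summable (\<lambda>k. 4 * v * (2 powr (2 - \<alpha>)) ^ k)"
      by (intro summable_mult summable_geometric) (simp only: real_norm_def abs_of_nonneg powr_ge_zero)
    moreover have "0 \<le> 4 * v * (2 powr (2 - \<alpha>)) ^ k" for k
      by (intro mult_nonneg_nonneg zero_le_power powr_ge_zero v zero_le_numeral)
    ultimately have "(\<Sum>k. ennreal (4 * v * (2 powr (2 - \<alpha>)) ^ k)) = ennreal (\<Sum>k. 4 * v * (2 powr (2 - \<alpha>)) ^ k)"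
      by (rule suminf_ennreal2[rotated])
    then show ?thesis by (simp only: ennreal_less_top infinity_ennreal_def)
  qed
  finally show ?thesis .
qed

section \<open>Approximation by functions simple in the first variable\<close>

text \<open>Only the dependence on the first variable is simple; the functions \<open>W k\<close> of
  the second are arbitrary. This is the class for which the Mecke equation splits: on each cell of
  \<open>c\<close> the weight no longer depends on the distinguished point.\<close>

definition fibrewise_simple ::
    "'a measure \<Rightarrow> 'b measure \<Rightarrow> ('a \<times> 'b \<Rightarrow> complex) \<Rightarrow> bool" where
  "fibrewise_simple M N g \<longleftrightarrow> (\<exists>(c :: 'a \<Rightarrow> nat) W.
     c \<in> measurable M (count_space UNIV) \<and> finite (range c) \<and>
     (\<forall>k. W k \<in> borel_measurable N) \<and> g = (\<lambda>(x, y). W (c x) y))"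

lemma fibrewise_simple_add:
  assumes "fibrewise_simple M N g" "fibrewise_simple M N h"
  shows "fibrewise_simple M N (\<lambda>z. g z + h z)"
proof -
  obtain c :: "_ \<Rightarrow> nat" and W where "c \<in> measurable M (count_space UNIV) \<and> finite (range c) \<and>
      (\<forall>k. W k \<in> borel_measurable N) \<and> g = (\<lambda>(x, y). W (c x) y)"
    using assms(1) unfolding fibrewise_simple_def by (elim exE) (rule that)
  then have c: "c \<in> measurable M (count_space UNIV)" "finite (range c)"
      "\<And>k. W k \<in> borel_measurable N" "g = (\<lambda>(x, y). W (c x) y)"
    by auto
  obtain d :: "_ \<Rightarrow> nat" and V where "d \<in> measurable M (count_space UNIV) \<and> finite (range d) \<and>
      (\<forall>k. V k \<in> borel_measurable N) \<and> h = (\<lambda>(x, y). V (d x) y)"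
    using assms(2) unfolding fibrewise_simple_def by (elim exE) (rule that)
  then have d: "d \<in> measurable M (count_space UNIV)" "finite (range d)"
      "\<And>k. V k \<in> borel_measurable N" "h = (\<lambda>(x, y). V (d x) y)"
    by auto
  \<comment> \<open>The label of the common refinement of the two partitions, coded as one natural
    number.\<close>
  define e where "e x = prod_encode (c x, d x)" for x
  define U where "U k y = W (fst (prod_decode k)) y + V (snd (prod_decode k)) y" for k y
  have "e \<in> measurable M (count_space UNIV)"
    unfolding e_def using c(1) d(1) by measurable
  moreover have "finite (range e)"
  proof (rule finite_subset)
    show "range e \<subseteq> prod_encode ` (range c \<times> range d)" by (auto simp: e_def)
    show "finite (prod_encode ` (range c \<times> range d))" using c(2) d(2) by simp
  qed
  moreover have "U k \<in> borel_measurable N" for k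
    unfolding U_def using c(3) d(3) by (intro borel_measurable_add) auto
  moreover have "(\<lambda>z. g z + h z) = (\<lambda>(x, y). U (e x) y)"
    by (auto simp: c(4) d(4) U_def e_def)
  ultimately show ?thesis unfolding fibrewise_simple_def by blast
qed

lemma fibrewise_simple_zero: "fibrewise_simple M N (\<lambda>z. 0)"
  unfolding fibrewise_simple_def
  by (intro exI[of _ "\<lambda>_. 0"] exI[of _ "\<lambda>_ _. 0"]) auto

lemma fibrewise_simple_rectangle:
  assumes "A \<in> sets M" "B \<in> sets N"
  shows "fibrewise_simple M N (\<lambda>z. indicator (A \<times> B) z *\<^sub>R w)"
  unfolding fibrewise_simple_def
proof (intro exI conjI allI)
  let ?c = "\<lambda>x. if x \<in> A then 1 else 0 :: nat"
  show "?c \<in> measurable M (count_space UNIV)" using assms(1) by measurable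
  show "finite (range ?c)" by (rule finite_subset[of _ "{0,1}"]) auto
  show "(\<lambda>y. (if k = (1::nat) then indicator B y *\<^sub>R w else 0)) \<in> borel_measurable N" for k
    using assms(2) by measurable
  show "(\<lambda>z. indicator (A \<times> B) z *\<^sub>R w)
      = (\<lambda>(x, y). (\<lambda>k y. (if k = (1::nat) then indicator B y *\<^sub>R w else 0)) (?c x) y)"
    by (auto simp: indicator_def fun_eq_iff)
qed

text \<open>The weights must stay in the unit disc, because they are multiplied over an unbounded
  number of points. Nearest-point projection onto the disc restores this without leaving the
  class.\<close>

lemma fibrewise_simple_norm_le_one:
  assumes "fibrewise_simple M N g"
  shows "fibrewise_simple M N (\<lambda>z. closest_point (cball 0 1) (g z))"
proof -
  obtain c :: "_ \<Rightarrow> nat" and W where "c \<in> measurable M (count_space UNIV) \<and> finite (range c) \<and>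
      (\<forall>k. W k \<in> borel_measurable N) \<and> g = (\<lambda>(x, y). W (c x) y)"
    using assms(1) unfolding fibrewise_simple_def by (elim exE) (rule that)
  then have c: "c \<in> measurable M (count_space UNIV)" "finite (range c)"
      "\<And>k. W k \<in> borel_measurable N" "g = (\<lambda>(x, y). W (c x) y)"
    by auto
  have "continuous_on UNIV (closest_point (cball 0 1 :: complex set))"
    by (intro continuous_on_closest_point) auto
  then have m: "closest_point (cball 0 1 :: complex set) \<in> borel_measurable borel"
    by (rule borel_measurable_continuous_onI)
  have "(\<lambda>y. closest_point (cball 0 1) (W k y)) \<in> borel_measurable N" for k
    by (rule measurable_compose[OF c(3) m])
  then show ?thesis
    unfolding fibrewise_simple_def
    by (intro exI[of _ c] exI[of _ "\<lambda>k y. closest_point (cball 0 1) (W k y)"]) (auto simp: c)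
qed

lemma fibrewise_simple_measurable:
  assumes "fibrewise_simple M N g"
  shows "g \<in> borel_measurable (M \<Otimes>\<^sub>M N)"
proof -
  obtain c :: "_ \<Rightarrow> nat" and W where "c \<in> measurable M (count_space UNIV) \<and> finite (range c) \<and>
      (\<forall>k. W k \<in> borel_measurable N) \<and> g = (\<lambda>(x, y). W (c x) y)"
    using assms unfolding fibrewise_simple_def by (elim exE) (rule that)
  then have c: "c \<in> measurable M (count_space UNIV)" "finite (range c)"
      "\<And>k. W k \<in> borel_measurable N" "g = (\<lambda>(x, y). W (c x) y)"
    by auto
  have "(\<lambda>z. W (c (fst z)) (snd z)) \<in> borel_measurable (M \<Otimes>\<^sub>M N)"
  proof (rule measurable_compose_countable)
    show "(\<lambda>z. c (fst z)) \<in> measurable (M \<Otimes>\<^sub>M N) (count_space UNIV)" using c(1) by measurable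
    show "(\<lambda>z. W k (snd z)) \<in> borel_measurable (M \<Otimes>\<^sub>M N)" for k
      by (rule measurable_compose[OF measurable_snd c(3)])
  qed
  then show ?thesis by (simp add: c(4) case_prod_beta')
qed

text \<open>Integrability of \<open>g\<close> is part of the definition because the Bochner integral
  of a non-integrable function is 0, so that a small integral alone would say nothing.\<close>

definition L1_limit ::
    "'a measure \<Rightarrow> 'b measure \<Rightarrow> ('a \<times> 'b \<Rightarrow> complex) \<Rightarrow> bool" where
  "L1_limit M N f \<longleftrightarrow> (\<forall>e>0. \<exists>g. fibrewise_simple M N g \<and> integrable (M \<Otimes>\<^sub>M N) g \<and>
     (LINT z|(M \<Otimes>\<^sub>M N). norm (f z - g z)) < e)"

lemma L1_limit_self:
  "fibrewise_simple M N g \<Longrightarrow> integrable (M \<Otimes>\<^sub>M N) g \<Longrightarrow> L1_limit M N g"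
  unfolding L1_limit_def by (intro allI impI exI[of _ g]) simp

lemma L1_limit_add:
  assumes "integrable (M \<Otimes>\<^sub>M N) f" "integrable (M \<Otimes>\<^sub>M N) g" "L1_limit M N f" "L1_limit M N g"
  shows "L1_limit M N (\<lambda>z. f z + g z)"
  unfolding L1_limit_def
proof (intro allI impI)
  let ?P = "M \<Otimes>\<^sub>M N"
  fix e :: real assume "e > 0"
  then have "e / 2 > 0" by simp
  then obtain f' g' where
      f': "fibrewise_simple M N f'" "integrable ?P f'" "(LINT z|?P. norm (f z - f' z)) < e / 2" and
      g': "fibrewise_simple M N g'" "integrable ?P g'" "(LINT z|?P. norm (g z - g' z)) < e / 2"
    using assms(3,4) unfolding L1_limit_def by blast
  have "(LINT z|?P. norm ((f z + g z) - (f' z + g' z)))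
      \<le> (LINT z|?P. norm (f z - f' z) + norm (g z - g' z))"
    using assms f' g' by (intro integral_mono norm_diff_triangle_ineq)
      (auto intro!: Bochner_Integration.integrable_add Bochner_Integration.integrable_diff)
  also have "\<dots> < e"
    using assms f' g' by (subst Bochner_Integration.integral_add) auto
  finally show "\<exists>h. fibrewise_simple M N h \<and> integrable ?P h \<and>
      (LINT z|?P. norm ((f z + g z) - h z)) < e"
    using f' g' by (intro exI[of _ "\<lambda>z. f' z + g' z"]) (auto intro: fibrewise_simple_add)
qed

lemma L1_limit_trans:
  assumes "integrable (M \<Otimes>\<^sub>M N) f"
    and "\<And>e. e > 0 \<Longrightarrow> \<exists>g. L1_limit M N g \<and> integrable (M \<Otimes>\<^sub>M N) g \<and>
      (LINT z|(M \<Otimes>\<^sub>M N). norm (f z - g z)) < e"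
  shows "L1_limit M N f"
  unfolding L1_limit_def
proof (intro allI impI)
  let ?P = "M \<Otimes>\<^sub>M N"
  fix e :: real assume "e > 0"
  then have e: "e / 2 > 0" by simp
  obtain g where g: "L1_limit M N g" "integrable ?P g" "(LINT z|?P. norm (f z - g z)) < e / 2"
    using assms(2)[OF e] by blast
  obtain h where h: "fibrewise_simple M N h" "integrable ?P h" "(LINT z|?P. norm (g z - h z)) < e / 2"
    using g(1) e unfolding L1_limit_def by blast
  have "(LINT z|?P. norm (f z - h z)) \<le> (LINT z|?P. norm (f z - g z) + norm (g z - h z))"
    using assms(1) g h by (intro integral_mono) 
      (auto intro!: Bochner_Integration.integrable_add Bochner_Integration.integrable_diff
        simp: norm_triangle_le_diff norm_triangle_sub order_trans[OF _ norm_triangle_ineq])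
  also have "\<dots> < e" using assms(1) g h by (subst Bochner_Integration.integral_add) auto
  finally show "\<exists>h. fibrewise_simple M N h \<and> integrable ?P h \<and> (LINT z|?P. norm (f z - h z)) < e"
    using h by blast
qed

lemma L1_limit_dominated:
  fixes f :: "'a \<times> 'b \<Rightarrow> complex" and w :: "'a \<times> 'b \<Rightarrow> real"
  assumes f: "integrable (M \<Otimes>\<^sub>M N) f" and s: "\<And>i. integrable (M \<Otimes>\<^sub>M N) (s i)" "\<And>i. L1_limit M N (s i)"
    and lim: "\<And>z. z \<in> space (M \<Otimes>\<^sub>M N) \<Longrightarrow> (\<lambda>i. s i z) \<longlonglongrightarrow> f z"
    and w: "integrable (M \<Otimes>\<^sub>M N) w" "\<And>i z. z \<in> space (M \<Otimes>\<^sub>M N) \<Longrightarrow> norm (s i z) \<le> w z"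
  shows "L1_limit M N f"
proof (rule L1_limit_trans[OF f])
  let ?P = "M \<Otimes>\<^sub>M N"
  fix e :: real assume e: "e > 0"
  have "(\<lambda>i. LINT z|?P. norm (f z - s i z)) \<longlonglongrightarrow> (LINT z|?P. 0)"
  proof (rule integral_dominated_convergence[where w = "\<lambda>z. norm (f z) + w z"])
    show "AE z in ?P. (\<lambda>i. norm (f z - s i z)) \<longlonglongrightarrow> 0"
    proof (rule AE_I2)
      fix z assume "z \<in> space ?P"
      then have "(\<lambda>i. f z - s i z) \<longlonglongrightarrow> f z - f z" by (intro tendsto_intros lim)
      then show "(\<lambda>i. norm (f z - s i z)) \<longlonglongrightarrow> 0" by (simp add: tendsto_norm_zero)
    qed
    show "AE z in ?P. norm (norm (f z - s i z)) \<le> norm (f z) + w z" for i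
    proof (rule AE_I2)
      fix z assume "z \<in> space ?P"
      then show "norm (norm (f z - s i z)) \<le> norm (f z) + w z"
        using w(2)[of z i] norm_triangle_ineq4[of "f z" "s i z"] by simp
    qed
    show "(\<lambda>z. norm (f z - s i z)) \<in> borel_measurable ?P" for i
      using borel_measurable_integrable[OF f] borel_measurable_integrable[OF s(1)] by measurable
  qed (use f w in auto)
  then have "eventually (\<lambda>i. (LINT z|?P. norm (f z - s i z)) < e) sequentially"
    using e by (intro order_tendstoD) auto
  then obtain i where "(LINT z|?P. norm (f z - s i z)) < e"
    by (auto simp: eventually_sequentially)
  then show "\<exists>g. L1_limit M N g \<and> integrable ?P g \<and> (LINT z|?P. norm (f z - g z)) < e"
    using s by blast
qed

text \<open>Dynkin's argument: rectangles generate the product sigma-algebra and are stable under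
  intersection, and the approximable sets are closed under complements and disjoint countable
  unions.\<close>

lemma L1_limit_indicator:
  assumes "finite_measure M" "finite_measure N" and A: "A \<in> sets (M \<Otimes>\<^sub>M N)"
  shows "L1_limit M N (\<lambda>z. indicator A z *\<^sub>R w)"
proof -
  let ?P = "M \<Otimes>\<^sub>M N"
  interpret M: finite_measure M by fact
  interpret N: finite_measure N by fact
  interpret P: finite_measure ?P
    by (rule finite_measure_pair_measure) fact+
  let ?G = "{a \<times> b | a b. a \<in> sets M \<and> b \<in> sets N}"
  let ?S = "sigma_sets (space M \<times> space N) ?G"
  have S: "B \<in> sets ?P" if "B \<in> ?S" for B using that by (simp add: sets_pair_measure)
  have int: "integrable ?P (\<lambda>z. indicator B z *\<^sub>R w)" if "B \<in> sets ?P" for B and w :: complex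
    using that by (intro P.integrable_const_bound[where B="norm w"]) (auto simp: indicator_def)
  have "A \<in> ?S" using A by (simp add: sets_pair_measure)
  \<comment> \<open>The weight is quantified inside the induction, since the complement step applies
    the hypothesis to \<open>- w\<close>.\<close>
  then have "\<forall>w. L1_limit M N (\<lambda>z. indicator A z *\<^sub>R w)"
  proof (induction rule: sigma_sets_induct_disjoint[OF Int_stable_pair_measure_generator pair_measure_closed, consumes 1, case_names basic empty compl union])
    case (basic A)
    then obtain a b where "A = a \<times> b" "a \<in> sets M" "b \<in> sets N" by blast
    then show ?case by (auto intro!: L1_limit_self fibrewise_simple_rectangle int)
  next
    case empty
    then show ?case by (auto intro: L1_limit_self fibrewise_simple_zero)
  next
    case (compl A)
    have sp: "space M \<times> space N \<in> sets ?P" by auto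
    show ?case
    proof
      fix w
      have "L1_limit M N (\<lambda>z. indicator (space M \<times> space N) z *\<^sub>R w + indicator A z *\<^sub>R (- w))"
        using S[OF compl(1)] sp
        by (intro L1_limit_add int L1_limit_self fibrewise_simple_rectangle compl(2)[rule_format]) auto
      moreover have "A \<subseteq> space M \<times> space N"
        using sets.sets_into_space[OF S[OF compl(1)]] by (simp add: space_pair_measure)
      then have "(\<lambda>z. indicator (space M \<times> space N) z *\<^sub>R w + indicator A z *\<^sub>R (- w))
          = (\<lambda>z. indicator (space M \<times> space N - A) z *\<^sub>R w)"
        by (auto simp: indicator_def fun_eq_iff)
      ultimately show "L1_limit M N (\<lambda>z. indicator (space M \<times> space N - A) z *\<^sub>R w)" by simp
    qed
  next
    case (union A)
    have A: "A i \<in> sets ?P" for i using union(2) S by auto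
    show ?case
    proof
      fix w
      \<comment> \<open>Finite unions come by addition; the infinite union is then their dominated
        limit, with the constant \<open>norm w\<close> as bound, integrable on a finite measure
        space.\<close>
      have fin: "L1_limit M N (\<lambda>z. indicator (\<Union>i<n. A i) z *\<^sub>R w)" for n
      proof (induction n)
        case 0
        then show ?case by (auto intro: L1_limit_self fibrewise_simple_zero)
      next
        case (Suc n)
        have "L1_limit M N (\<lambda>z. indicator (\<Union>i<n. A i) z *\<^sub>R w + indicator (A n) z *\<^sub>R w)"
          using Suc union(3) A by (intro L1_limit_add int) auto
        moreover have "A n \<inter> A i = {}" if "i < n" for i
          using union(1) that by (simp add: disjoint_family_on_def)
        then have "A n \<inter> (\<Union>i<n. A i) = {}" by blast
        then have "(\<lambda>z. indicator (\<Union>i<n. A i) z *\<^sub>R w + indicator (A n) z *\<^sub>R w)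
            = (\<lambda>z. indicator (\<Union>i<Suc n. A i) z *\<^sub>R w)"
          by (auto simp: indicator_def fun_eq_iff less_Suc_eq)
        ultimately show ?case by simp
      qed
      show "L1_limit M N (\<lambda>z. indicator (\<Union>i. A i) z *\<^sub>R w)"
      proof (rule L1_limit_dominated[OF _ _ fin])
        show "integrable ?P (\<lambda>z. indicator (\<Union>i. A i) z *\<^sub>R w)"
          "integrable ?P (\<lambda>z. indicator (\<Union>i<n. A i) z *\<^sub>R w)" for n
          using A by (auto intro!: int)
        show "integrable ?P (\<lambda>z. norm w)" by simp
        show "norm (indicator (\<Union>i<n. A i) z *\<^sub>R w) \<le> norm w" for n z by (simp add: indicator_def)
        show "(\<lambda>n. indicator (\<Union>i<n. A i) z *\<^sub>R w) \<longlonglongrightarrow> indicator (\<Union>i. A i) z *\<^sub>R w" for z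
          by (intro tendsto_intros LIMSEQ_indicator_UN)
      qed
    qed
  qed
  then show ?thesis by blast
qed

lemma L1_limit_integrable:
  assumes "finite_measure M" "finite_measure N" and f: "integrable (M \<Otimes>\<^sub>M N) f"
  shows "L1_limit M N f"
  using f
proof (induction rule: integrable_induct)
  case (base A c)
  then show ?case using assms by (intro L1_limit_indicator)
next
  case (add f g)
  then show ?case by (intro L1_limit_add)
next
  case (lim f s)
  show ?case
    by (rule L1_limit_dominated[where s = s and w = "\<lambda>z. 2 * norm (f z)", OF lim(4,1,5,2) _ lim(3)])
      (use lim(4) in simp_all)
qed

text \<open>An approximation in the mean is projected onto the unit disc. The projection is
  nonexpansive and fixes the values of \<open>f\<close>, so the distance does not grow.\<close>

lemma fibrewise_simple_dense:
  assumes "finite_measure M" "finite_measure N" "f \<in> borel_measurable (M \<Otimes>\<^sub>M N)"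
    and "\<And>z. norm (f z) \<le> 1" "e > 0"
  obtains g where "fibrewise_simple M N g" "\<And>z. norm (g z) \<le> 1"
    "(LINT z|(M \<Otimes>\<^sub>M N). norm (f z - g z)) < e"
proof -
  let ?P = "M \<Otimes>\<^sub>M N"
  interpret P: finite_measure ?P
    by (rule finite_measure_pair_measure) fact+
  have f: "integrable ?P f"
    using assms by (intro P.integrable_const_bound[where B=1]) auto
  from L1_limit_integrable[OF assms(1,2) f] obtain g where g: "fibrewise_simple M N g"
      "integrable ?P g" "(LINT z|?P. norm (f z - g z)) < e"
    using assms(5) unfolding L1_limit_def by blast
  let ?p = "closest_point (cball 0 1 :: complex set)"
  have p: "norm (?p z) \<le> 1" for z
    using closest_point_in_set[of "cball 0 1 :: complex set" z] by simp
  have s: "fibrewise_simple M N (\<lambda>z. ?p (g z))" by (rule fibrewise_simple_norm_le_one[OF g(1)])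
  have i: "integrable ?P (\<lambda>z. ?p (g z))"
    using p fibrewise_simple_measurable[OF s] by (intro P.integrable_const_bound[where B=1]) auto
  have "norm (f z - ?p (g z)) \<le> norm (f z - g z)" for z
  proof -
    have "?p (f z) = f z" using assms(4) by (intro closest_point_self) simp
    then show ?thesis
      using closest_point_lipschitz[of "cball 0 1 :: complex set" "f z" "g z"]
      by (simp add: dist_norm)
  qed
  then have "(LINT z|?P. norm (f z - ?p (g z))) \<le> (LINT z|?P. norm (f z - g z))"
    using f g i by (intro integral_mono) auto
  with g(3) have "(LINT z|?P. norm (f z - ?p (g z))) < e" by simp
  then show thesis using s p by (intro that[of "\<lambda>z. ?p (g z)"]) auto
qed

section \<open>Levy inversion with real truncation bounds\<close>

text \<open>Passing from R to its integer part n changes the integration domain by a set of length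
  at most 2, on which the integrand is at most C / n. This carries the limit along integers, as in
  Levy's theorem, over to real R.\<close>

lemma tendsto_symmetric_integral_at_top:
  fixes h :: "real \<Rightarrow> complex"
  assumes meas: "h \<in> borel_measurable borel" and bounded: "\<And>t. norm (h t) \<le> K"
    and decay: "\<And>t. norm (h t) \<le> C / \<bar>t\<bar>"
    and lim: "(\<lambda>n::nat. CLBINT t=-n..n. h t) \<longlonglongrightarrow> L"
  shows "((\<lambda>R::real. CLBINT t=-R..R. h t) \<longlongrightarrow> L) at_top"
proof -
  let ?I = "\<lambda>R::real. CLBINT t=-R..R. h t"
  define n where "n R = nat \<lfloor>R\<rfloor>" for R :: real
  have n: "filterlim n sequentially at_top"
    unfolding n_def by (rule filterlim_compose[OF filterlim_nat_sequentially filterlim_floor_sequentially])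
  have C: "C \<ge> 0" using order_trans[OF norm_ge_zero decay[of 1]] by simp
  have bound: "norm (?I R - ?I (n R)) \<le> 2 * C / n R" if R: "R \<ge> 1" for R
  proof -
    have nR: "1 \<le> n R" "n R \<le> R" "R \<le> n R + 1" using R by (auto simp: n_def le_nat_iff) linarith+
    have set: "?I r = (LINT t:{-r<..<r}|lborel. h t)" if "r \<ge> 0" for r :: real
      using that by (simp add: interval_lebesgue_integral_def)
    have int: "set_integrable lborel {-r<..<r} h" for r :: real
      unfolding set_integrable_def using meas bounded
    proof (intro integrableI_bounded_set_indicator[where B=K])
      show "emeasure lborel {-r<..<r} < \<infinity>" by (rule emeasure_bounded_finite) simp
    qed auto
    let ?D = "{-R<..<R} - {- real (n R)<..<real (n R)}"
    have "?I R - ?I (n R) = (LINT t:?D|lborel. h t)"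
    proof -
      have "{-R<..<R} = ?D \<union> {- real (n R)<..<real (n R)}" using nR by auto
      then have "(LINT t:{-R<..<R}|lborel. h t) = (LINT t:?D \<union> {- real (n R)<..<real (n R)}|lborel. h t)"
        by (rule arg_cong)
      also have "\<dots> = (LINT t:?D|lborel. h t) + (LINT t:{- real (n R)<..<real (n R)}|lborel. h t)"
        by (intro set_integral_Un int set_integrable_subset[OF int[of R]]) auto
      finally show ?thesis using R set[of R] set[of "real (n R)"] by simp
    qed
    also have "norm \<dots> \<le> (LINT t:?D|lborel. C / n R)"
      unfolding set_lebesgue_integral_def
    proof (rule order_trans[OF integral_norm_bound], rule integral_mono)
      show "integrable lborel (\<lambda>t. norm (indicator ?D t *\<^sub>R h t))"
        using set_integrable_subset[OF int[of R], of ?D] unfolding set_integrable_def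
        by (intro integrable_norm) auto
      have "?D \<in> sets lborel" by simp
      moreover have "emeasure lborel ?D < \<infinity>"
        by (rule emeasure_bounded_finite[OF bounded_subset[of "{-R<..<R}"]]) auto
      ultimately show "integrable lborel (\<lambda>t. indicator ?D t *\<^sub>R (C / n R))" by simp
      fix t
      have "norm (h t) \<le> C / n R" if "t \<in> ?D"
      proof -
        have "n R \<le> \<bar>t\<bar>" using that by auto
        then have "C / \<bar>t\<bar> \<le> C / n R" using nR C by (intro divide_left_mono) auto
        then show ?thesis using decay[of t] by linarith
      qed
      then show "norm (indicator ?D t *\<^sub>R h t) \<le> indicator ?D t *\<^sub>R (C / n R)"
        by (auto simp: indicator_def)
    qed
    also have "\<dots> = measure lborel ?D * (C / n R)"
      unfolding set_lebesgue_integral_def by simp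
    also have "measure lborel ?D = 2 * R - 2 * n R"
      using nR by (subst measure_Diff) auto
    also have "(2 * R - 2 * n R) * (C / n R) \<le> 2 * (C / n R)"
      using nR C by (intro mult_right_mono) auto
    finally show ?thesis by simp
  qed
  have "((\<lambda>R. ?I R - ?I (n R)) \<longlongrightarrow> 0) at_top"
  proof (rule Lim_null_comparison)
    show "eventually (\<lambda>R. norm (?I R - ?I (n R)) \<le> 2 * C / n R) at_top"
      using eventually_ge_at_top[of 1] by eventually_elim (rule bound)
    have "(\<lambda>m. 2 * C / real m) \<longlonglongrightarrow> 0" by (rule lim_const_over_n)
    then show "((\<lambda>R. 2 * C / n R) \<longlongrightarrow> 0) at_top" by (rule filterlim_compose[OF _ n])
  qed
  moreover have "((\<lambda>R. ?I (n R)) \<longlongrightarrow> L) at_top" by (rule filterlim_compose[OF lim n])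
  ultimately have "((\<lambda>R. (?I R - ?I (n R)) + ?I (n R)) \<longlongrightarrow> 0 + L) at_top" by (rule tendsto_add)
  then show ?thesis by simp
qed

lemma (in real_distribution) Levy_Inversion_at_top:
  fixes a b :: real
  assumes ab: "a \<le> b" and atoms: "measure M {a} = 0" "measure M {b} = 0"
  shows "((\<lambda>R::real. 1 / (2 * pi) * (CLBINT t=-R..R.
      (iexp (-(t * a)) - iexp (-(t * b))) / (\<i> * t) * char M t)) \<longlongrightarrow> of_real (measure M {a<..b})) at_top"
proof -
  let ?h = "\<lambda>t::real. (iexp (-(t * a)) - iexp (-(t * b))) / (\<i> * t) * char M t"
  have lim: "(\<lambda>n::nat. 1 / (2 * pi) * (CLBINT t=-n..n. ?h t)) \<longlonglongrightarrow> of_real (measure M {a<..b})"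
    using Levy_Inversion[OF ab atoms] by simp
  have "(\<lambda>n::nat. of_real (2 * pi) * (of_real (1 / (2 * pi)) * (CLBINT t=-n..n. ?h t)))
      \<longlonglongrightarrow> of_real (2 * pi) * of_real (measure M {a<..b})"
    using lim by (intro tendsto_mult tendsto_const) simp
  then have lim': "(\<lambda>n::nat. CLBINT t=-n..n. ?h t) \<longlonglongrightarrow> of_real (2 * pi) * of_real (measure M {a<..b})"
    by simp
  have "((\<lambda>R::real. CLBINT t=-R..R. ?h t) \<longlongrightarrow> of_real (2 * pi) * of_real (measure M {a<..b})) at_top"
  proof (rule tendsto_symmetric_integral_at_top[OF _ _ _ lim'])
    show "?h \<in> borel_measurable borel" by measurable
    \<comment> \<open>This uniform bound handles the neighbourhood of the singularity at 0, where
      the decay like 2 / |t| is of no use; at t = 0 itself the quotient is 0.\<close>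
    show "norm (?h t) \<le> b - a" for t
    proof (cases "t = 0")
      case False
      have "norm (?h t) \<le> norm ((iexp (-(t * a)) - iexp (-(t * b))) / (\<i> * t)) * 1"
        unfolding norm_mult by (intro mult_left_mono cmod_char_le_1) auto
      also have "\<dots> \<le> b - a"
        using Levy_Inversion_aux2[of "-b" "-a" t] ab False by simp
      finally show ?thesis .
    qed (use ab in simp)
    show "norm (?h t) \<le> 2 / \<bar>t\<bar>" for t
    proof -
      have "norm (?h t) \<le> norm ((iexp (-(t * a)) - iexp (-(t * b))) / (\<i> * t)) * 1"
        unfolding norm_mult by (intro mult_left_mono cmod_char_le_1) auto
      also have "\<dots> = norm (iexp (-(t * a)) - iexp (-(t * b))) / \<bar>t\<bar>"
        by (simp add: norm_divide norm_mult)
      also have "\<dots> \<le> 2 / \<bar>t\<bar>"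
      proof (rule divide_right_mono)
        show "norm (iexp (-(t * a)) - iexp (-(t * b))) \<le> 2"
          by (rule order_trans[OF norm_triangle_ineq4]) simp
      qed simp
      finally show ?thesis .
    qed
  qed
  then have "((\<lambda>R::real. of_real (1 / (2 * pi)) * (CLBINT t=-R..R. ?h t))
      \<longlongrightarrow> of_real (1 / (2 * pi)) * (of_real (2 * pi) * of_real (measure M {a<..b}))) at_top"
    by (intro tendsto_mult tendsto_const)
  then show ?thesis by simp
qed

section \<open>Poisson processes\<close>

text \<open>The index set varies with the outcome, so the product is written as the limit of
  products over initial segments, which are eventually constant at every outcome.\<close>

lemma measurable_prod_finite_index:
  fixes f :: "nat \<Rightarrow> 'w \<Rightarrow> complex"
  assumes f: "\<And>i. f i \<in> borel_measurable M" and P: "\<And>i. Measurable.pred M (P i)"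
    and fin: "\<And>\<omega>. \<omega> \<in> space M \<Longrightarrow> finite {i. P i \<omega>}"
  shows "(\<lambda>\<omega>. \<Prod>i | P i \<omega>. f i \<omega>) \<in> borel_measurable M"
proof (rule borel_measurable_LIMSEQ_metric)
  show "(\<lambda>\<omega>. \<Prod>i<n. if P i \<omega> then f i \<omega> else 1) \<in> borel_measurable M" for n
    using f P by measurable
  fix \<omega> assume \<omega>: "\<omega> \<in> space M"
  obtain m where m: "\<And>i. P i \<omega> \<Longrightarrow> i < m"
    using fin[OF \<omega>] by (metis (lifting) finite_nat_set_iff_bounded mem_Collect_eq)
  show "(\<lambda>n. \<Prod>i<n. if P i \<omega> then f i \<omega> else 1) \<longlonglongrightarrow> (\<Prod>i | P i \<omega>. f i \<omega>)"
  proof (rule tendsto_eventually, rule eventually_sequentiallyI[of m])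
    fix n assume "m \<le> n"
    then have "{i. P i \<omega>} = {i \<in> {..<n}. P i \<omega>}" using m by force
    moreover have "(\<Prod>i<n. if P i \<omega> then f i \<omega> else 1) = prod (\<lambda>i. f i \<omega>) {i \<in> {..<n}. P i \<omega>}"
      by (rule prod.inter_filter[symmetric]) simp
    ultimately show "(\<Prod>i<n. if P i \<omega> then f i \<omega> else 1) = (\<Prod>i | P i \<omega>. f i \<omega>)" by simp
  qed
qed

locale poisson_process = prob_space M for M :: "'w measure" +
  fixes X :: "nat \<Rightarrow> 'w \<Rightarrow> real^2" and lam :: real
  assumes lam_pos: "lam > 0" and ppp: "homogeneous_ppp M lam X"
begin

text \<open>A measure on pairs of an index and an outcome. Integrating against it is taking the
  expectation of a sum over points, so with the indicator of a window it produces the numerators of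
  \<open>palm_prob\<close>, and statements about all points of the window become almost everywhere
  statements.\<close>

abbreviation campbell :: "(nat \<times> 'w) measure" where
  "campbell \<equiv> count_space UNIV \<Otimes>\<^sub>M M"

sublocale campbell: pair_sigma_finite "count_space (UNIV :: nat set)" M
  by (intro pair_sigma_finite.intro sigma_finite_measure_count_space_countable
      sigma_finite_measure_axioms) auto

lemma measurable_point [measurable]: "X i \<in> borel_measurable M"
  using ppp by (simp add: homogeneous_ppp_def)

lemma finite_points: "\<omega> \<in> space M \<Longrightarrow> bounded B \<Longrightarrow> finite {i. X i \<omega> \<in> B}"
  using ppp unfolding homogeneous_ppp_def by (elim conjE) simp

lemma indep_point_counts:
  assumes "finite (I :: nat set)" "disjoint_family_on A I"
    "\<And>n. n \<in> I \<Longrightarrow> A n \<in> sets borel" "\<And>n. n \<in> I \<Longrightarrow> bounded (A n)"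
  shows "indep_vars (\<lambda>_. count_space UNIV) (\<lambda>n. point_count X (A n)) I"
proof -
  have "\<forall>(I :: nat set) A. finite I \<and> disjoint_family_on A I \<and>
          (\<forall>n\<in>I. A n \<in> sets borel \<and> bounded (A n)) \<longrightarrow>
        indep_vars (\<lambda>_. count_space UNIV) (\<lambda>n. point_count X (A n)) I"
    using ppp unfolding homogeneous_ppp_def by (elim conjE)
  from this[rule_format, of I A] show ?thesis using assms by simp
qed

text \<open>Measurability is read off from independence of a family with a single member.\<close>

lemma measurable_point_count:
  assumes "A \<in> sets borel" "bounded A"
  shows "point_count X A \<in> measurable M (count_space UNIV)"
proof -
  have "indep_vars (\<lambda>_. count_space UNIV) (\<lambda>n. point_count X A) {0::nat}"
    using indep_point_counts[of "{0::nat}" "\<lambda>_. A"] assms by (simp add: disjoint_family_on_def)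
  then show ?thesis by (simp add: indep_vars_def)
qed

section \<open>Poisson weights and moments of counts\<close>

definition weight :: "(real^2) set \<Rightarrow> nat \<Rightarrow> real" where
  "weight A k = (lam * measure lborel A) ^ k / fact k * exp (- (lam * measure lborel A))"

lemma weight_nonneg: "0 \<le> weight A k"
  using lam_pos by (simp add: weight_def)

lemma distr_point_count:
  assumes "A \<in> sets borel" "bounded A"
  shows "distr M (count_space UNIV) (point_count X A) = density (count_space UNIV) (\<lambda>k. ennreal (weight A k))"
proof (rule measure_eqI_countable[of _ UNIV])
  fix k :: nat
  have "emeasure (distr M (count_space UNIV) (point_count X A)) {k}
      = emeasure M {\<omega>\<in>space M. point_count X A \<omega> = k}"
    using measurable_point_count[OF assms]
    by (subst emeasure_distr) (auto intro!: arg_cong[where f="emeasure M"])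
  also have "\<dots> = ennreal (weight A k)"
    using assms ppp unfolding homogeneous_ppp_def weight_def by (simp add: emeasure_eq_measure)
  also have "\<dots> = emeasure (density (count_space UNIV) (\<lambda>k. ennreal (weight A k))) {k}"
    by (simp add: emeasure_density)
  finally show "emeasure (distr M (count_space UNIV) (point_count X A)) {k}
      = emeasure (density (count_space UNIV) (\<lambda>k. ennreal (weight A k))) {k}" .
qed auto

lemma expectation_point_count:
  fixes \<phi> :: "nat \<Rightarrow> 'b::{banach,second_countable_topology}"
  assumes A: "A \<in> sets borel" "bounded A" and sm: "summable (\<lambda>k. weight A k * norm (\<phi> k))"
  shows "integrable M (\<lambda>\<omega>. \<phi> (point_count X A \<omega>))"
    and "(\<lambda>k. weight A k *\<^sub>R \<phi> k) sums (LINT \<omega>|M. \<phi> (point_count X A \<omega>))"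
proof -
  note [measurable] = measurable_point_count[OF A]
  have i: "integrable (count_space UNIV) (\<lambda>k. weight A k *\<^sub>R \<phi> k)"
    using sm by (simp add: integrable_count_space_nat_iff abs_of_nonneg weight_nonneg)
  then have "integrable (density (count_space UNIV) (\<lambda>k. ennreal (weight A k))) \<phi>"
    by (subst integrable_density) (auto simp: weight_nonneg)
  then have "integrable (distr M (count_space UNIV) (point_count X A)) \<phi>"
    by (simp only: distr_point_count[OF A])
  then show "integrable M (\<lambda>\<omega>. \<phi> (point_count X A \<omega>))"
    by (subst (asm) integrable_distr_eq) auto
  have "(LINT \<omega>|M. \<phi> (point_count X A \<omega>)) = (LINT k|distr M (count_space UNIV) (point_count X A). \<phi> k)"
    by (subst integral_distr) auto
  also have "\<dots> = (LINT k|count_space UNIV. weight A k *\<^sub>R \<phi> k)"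
    unfolding distr_point_count[OF A] by (subst integral_density) (auto simp: weight_nonneg)
  finally show "(\<lambda>k. weight A k *\<^sub>R \<phi> k) sums (LINT \<omega>|M. \<phi> (point_count X A \<omega>))"
    using sums_integral_count_space_nat[OF i] by simp
qed

lemma weight_power_sums:
  fixes a :: complex
  shows "(\<lambda>k. weight A k *\<^sub>R a ^ k) sums exp (- of_real (lam * measure lborel A) * (1 - a))"
    and "summable (\<lambda>k. weight A k * norm (a ^ k))"
proof -
  define m where "m = lam * measure lborel A"
  have "exp (- of_real m) * ((of_real m * a) ^ k /\<^sub>R fact k) = weight A k *\<^sub>R a ^ k" for k
    unfolding weight_def m_def[symmetric]
    by (simp add: scaleR_conv_of_real exp_of_real[symmetric] power_mult_distrib divide_inverse del: exp_of_real)
  moreover have "exp (- of_real m) * exp (of_real m * a) = exp (- of_real m * (1 - a))"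
    by (simp add: exp_add[symmetric] algebra_simps)
  moreover have "(\<lambda>k. exp (- of_real m) * ((of_real m * a) ^ k /\<^sub>R fact k)) sums
      (exp (- of_real m) * exp (of_real m * a))"
    by (rule sums_mult[OF exp_converges])
  ultimately show "(\<lambda>k. weight A k *\<^sub>R a ^ k) sums exp (- of_real (lam * measure lborel A) * (1 - a))"
    by (simp only: m_def[symmetric])
  have "exp (- m) * ((m * norm a) ^ k /\<^sub>R fact k) = weight A k * norm (a ^ k)" for k
    unfolding weight_def m_def[symmetric] by (simp add: norm_power power_mult_distrib divide_inverse)
  moreover have "summable (\<lambda>k. exp (- m) * ((m * norm a) ^ k /\<^sub>R fact k))"
    by (rule summable_mult[OF sums_summable[OF exp_converges]])
  ultimately show "summable (\<lambda>k. weight A k * norm (a ^ k))" by (simp only:)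
qed

text \<open>The recursion that characterises Poisson weights. Both the Mecke equation and the second
  factorial moment go back to it.\<close>

lemma weight_Suc: "weight A (Suc k) * real (Suc k) = lam * measure lborel A * weight A k"
proof -
  have "fact (Suc k) = (real (Suc k) * fact k :: real)" by (rule fact_Suc)
  then show ?thesis unfolding weight_def by (simp del: of_nat_Suc fact_Suc add: field_simps)
qed

text \<open>The generating function differentiated in \<open>a\<close>: a cell with k points offers
  k choices of a distinguished point and leaves k - 1 factors. At k = 0 the truncated exponent is
  harmless because of the factor 0.\<close>

lemma weight_deriv_sums:
  fixes a :: complex
  shows "(\<lambda>k. weight A k *\<^sub>R (of_nat k * a ^ (k - 1))) sums
      (of_real (lam * measure lborel A) * exp (- of_real (lam * measure lborel A) * (1 - a)))"
    and "summable (\<lambda>k. weight A k * norm (of_nat k * a ^ (k - 1)))"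
proof -
  define m where "m = lam * measure lborel A"
  have e: "weight A (Suc k) *\<^sub>R (of_nat (Suc k) * a ^ (Suc k - 1)) = of_real m * (weight A k *\<^sub>R a ^ k)" for k
  proof -
    have "weight A (Suc k) *\<^sub>R (of_nat (Suc k) * a ^ (Suc k - 1)) = of_real (weight A (Suc k) * real (Suc k)) * a ^ k"
      by (simp add: scaleR_conv_of_real)
    then show ?thesis by (simp only: weight_Suc m_def scaleR_conv_of_real of_real_mult mult.assoc)
  qed
  have "(\<lambda>k. weight A (Suc k) *\<^sub>R (of_nat (Suc k) * a ^ (Suc k - 1))) sums
      (of_real m * exp (- of_real m * (1 - a)))"
    unfolding e m_def by (rule sums_mult[OF weight_power_sums(1)])
  then show "(\<lambda>k. weight A k *\<^sub>R (of_nat k * a ^ (k - 1))) sums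
      (of_real (lam * measure lborel A) * exp (- of_real (lam * measure lborel A) * (1 - a)))"
    by (subst (asm) sums_Suc_iff) (simp add: m_def)
  have e': "weight A (Suc k) * norm (of_nat (Suc k) * a ^ (Suc k - 1)) = m * (weight A k * norm (a ^ k))" for k
  proof -
    have "weight A (Suc k) * norm (of_nat (Suc k) * a ^ (Suc k - 1))
        = weight A (Suc k) * real (Suc k) * norm (a ^ k)"
      by (simp add: norm_mult del: of_nat_Suc)
    then show ?thesis by (simp only: weight_Suc m_def mult.assoc)
  qed
  have "summable (\<lambda>k. weight A (Suc k) * norm (of_nat (Suc k) * a ^ (Suc k - 1)))"
    unfolding e' by (rule summable_mult[OF weight_power_sums(2)])
  then show "summable (\<lambda>k. weight A k * norm (of_nat k * a ^ (k - 1)))"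
    by (subst (asm) summable_Suc_iff)
qed

lemma expectation_power_count:
  fixes a :: complex
  assumes "A \<in> sets borel" "bounded A"
  shows "integrable M (\<lambda>\<omega>. a ^ point_count X A \<omega>)"
    and "(LINT \<omega>|M. a ^ point_count X A \<omega>) = exp (- of_real (lam * measure lborel A) * (1 - a))"
proof -
  note * = expectation_point_count[OF assms weight_power_sums(2), of a]
  show "integrable M (\<lambda>\<omega>. a ^ point_count X A \<omega>)" by (rule *(1))
  show "(LINT \<omega>|M. a ^ point_count X A \<omega>) = exp (- of_real (lam * measure lborel A) * (1 - a))"
    by (rule sums_unique2[OF *(2) weight_power_sums(1)])
qed

lemma expectation_deriv_count:
  fixes a :: complex
  assumes "A \<in> sets borel" "bounded A"
  shows "integrable M (\<lambda>\<omega>. of_nat (point_count X A \<omega>) * a ^ (point_count X A \<omega> - 1))"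
    and "(LINT \<omega>|M. of_nat (point_count X A \<omega>) * a ^ (point_count X A \<omega> - 1))
      = of_real (lam * measure lborel A) * exp (- of_real (lam * measure lborel A) * (1 - a))"
proof -
  note * = expectation_point_count[OF assms weight_deriv_sums(2), of a]
  show "integrable M (\<lambda>\<omega>. of_nat (point_count X A \<omega>) * a ^ (point_count X A \<omega> - 1))" by (rule *(1))
  show "(LINT \<omega>|M. of_nat (point_count X A \<omega>) * a ^ (point_count X A \<omega> - 1))
      = of_real (lam * measure lborel A) * exp (- of_real (lam * measure lborel A) * (1 - a))"
    by (rule sums_unique2[OF *(2) weight_deriv_sums(1)])
qed

lemma expectation_count:
  assumes "A \<in> sets borel" "bounded A"
  shows "integrable M (\<lambda>\<omega>. real (point_count X A \<omega>))"
    and "(LINT \<omega>|M. real (point_count X A \<omega>)) = lam * measure lborel A"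
proof -
  have i: "integrable M (\<lambda>\<omega>. complex_of_real (real (point_count X A \<omega>)))"
    using expectation_deriv_count(1)[OF assms, of 1] by simp
  then show "integrable M (\<lambda>\<omega>. real (point_count X A \<omega>))" by (subst (asm) complex_of_real_integrable_eq)
  have "complex_of_real (LINT \<omega>|M. real (point_count X A \<omega>)) = complex_of_real (lam * measure lborel A)"
    using expectation_deriv_count(2)[OF assms, of 1] by (simp flip: integral_complex_of_real)
  then show "(LINT \<omega>|M. real (point_count X A \<omega>)) = lam * measure lborel A" by (simp only: of_real_eq_iff)
qed


lemma nn_integral_count_window:
  assumes "\<omega> \<in> space M" "bounded B"
  shows "(\<integral>\<^sup>+i. indicator B (X i \<omega>) \<partial>count_space UNIV) = ennreal (real (point_count X B \<omega>))"
proof -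
  have "(\<integral>\<^sup>+i. indicator B (X i \<omega>) \<partial>count_space UNIV)
      = (\<integral>\<^sup>+i. indicator {i. X i \<omega> \<in> B} i \<partial>count_space UNIV)"
    by (intro nn_integral_cong) (auto simp: indicator_def)
  then show ?thesis
    using finite_points[OF assms]
    by (simp add: point_count_def emeasure_count_space_finite ennreal_of_nat_eq_real_of_nat)
qed

lemma nn_integral_campbell_window:
  assumes B: "B \<in> sets borel" "bounded B"
  shows "(\<integral>\<^sup>+p. indicator B (X (fst p) (snd p)) \<partial>campbell) = ennreal (lam * measure lborel B)"
proof -
  have [measurable]: "(\<lambda>p. X (fst p) (snd p)) \<in> borel_measurable campbell"
    by (rule measurable_pair_measure_countable1) auto
  have "(\<integral>\<^sup>+p. indicator B (X (fst p) (snd p)) \<partial>campbell)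
      = (\<integral>\<^sup>+\<omega>. (\<integral>\<^sup>+i. indicator B (X i \<omega>) \<partial>count_space UNIV) \<partial>M)"
    using B by (subst campbell.nn_integral_snd[symmetric]) auto
  also have "\<dots> = (\<integral>\<^sup>+\<omega>. ennreal (real (point_count X B \<omega>)) \<partial>M)"
    by (intro nn_integral_cong nn_integral_count_window B)
  also have "\<dots> = ennreal (LINT \<omega>|M. real (point_count X B \<omega>))"
    by (rule nn_integral_eq_integral[OF expectation_count(1)[OF B]]) simp
  finally show ?thesis by (simp add: expectation_count(2)[OF B])
qed

text \<open>The window has finite Campbell mass, namely its mean number of points, so bounded
  functions are integrable over it and Fubini's theorem applies with a finite inner sum.\<close>

lemma campbell_window_integral:
  fixes f :: "nat \<Rightarrow> 'w \<Rightarrow> 'b::{banach,second_countable_topology}"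
  assumes B: "B \<in> sets borel" "bounded B" and f: "\<And>i. f i \<in> borel_measurable M"
    and le: "\<And>i \<omega>. norm (f i \<omega>) \<le> b"
  shows "integrable campbell (\<lambda>p. indicator B (X (fst p) (snd p)) *\<^sub>R f (fst p) (snd p))"
    and "(LINT p|campbell. indicator B (X (fst p) (snd p)) *\<^sub>R f (fst p) (snd p))
      = (\<integral>\<omega>. (\<Sum>i | X i \<omega> \<in> B. f i \<omega>) \<partial>M)"
proof -
  have X[measurable]: "(\<lambda>p. X (fst p) (snd p)) \<in> borel_measurable campbell"
    by (rule measurable_pair_measure_countable1) auto
  have F[measurable]: "(\<lambda>p. f (fst p) (snd p)) \<in> borel_measurable campbell"
    by (rule measurable_pair_measure_countable1) (auto intro: f)
  let ?A = "{p \<in> space campbell. X (fst p) (snd p) \<in> B}"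
  have A: "?A \<in> sets campbell" using B by measurable
  have "emeasure campbell ?A = (\<integral>\<^sup>+p. indicator B (X (fst p) (snd p)) \<partial>campbell)"
    by (subst nn_integral_indicator[OF A, symmetric]) (rule nn_integral_cong, simp add: indicator_def)
  then have fin: "emeasure campbell ?A < \<infinity>" by (simp add: nn_integral_campbell_window[OF B])
  show int: "integrable campbell (\<lambda>p. indicator B (X (fst p) (snd p)) *\<^sub>R f (fst p) (snd p))"
  proof (rule integrableI_bounded_set[OF A _ fin])
    show "(\<lambda>p. indicator B (X (fst p) (snd p)) *\<^sub>R f (fst p) (snd p)) \<in> borel_measurable campbell"
      using B by measurable
    show "AE p\<in>?A in campbell. norm (indicator B (X (fst p) (snd p)) *\<^sub>R f (fst p) (snd p)) \<le> b"
      using le by (auto simp: indicator_def)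
    show "AE p in campbell. p \<notin> ?A \<longrightarrow> indicator B (X (fst p) (snd p)) *\<^sub>R f (fst p) (snd p) = 0"
      by (rule AE_I2) (auto simp: indicator_def)
  qed
  have "(LINT p|campbell. indicator B (X (fst p) (snd p)) *\<^sub>R f (fst p) (snd p))
      = (LINT \<omega>|M. LINT i|count_space UNIV. indicator B (X i \<omega>) *\<^sub>R f i \<omega>)"
    using int by (subst campbell.integral_snd) (auto simp: case_prod_beta')
  also have "\<dots> = (\<integral>\<omega>. (\<Sum>i | X i \<omega> \<in> B. f i \<omega>) \<partial>M)"
  proof (rule Bochner_Integration.integral_cong[OF refl])
    fix \<omega> assume \<omega>: "\<omega> \<in> space M"
    have fin: "finite {i. X i \<omega> \<in> B}" by (rule finite_points[OF \<omega> B(2)])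
    have sub: "{i \<in> UNIV. indicator B (X i \<omega>) *\<^sub>R f i \<omega> \<noteq> 0} \<subseteq> {i. X i \<omega> \<in> B}"
      by (auto simp: indicator_def)
    have "(LINT i|count_space UNIV. indicator B (X i \<omega>) *\<^sub>R f i \<omega>)
        = (\<Sum>i | i \<in> UNIV \<and> indicator B (X i \<omega>) *\<^sub>R f i \<omega> \<noteq> 0. indicator B (X i \<omega>) *\<^sub>R f i \<omega>)"
      by (rule lebesgue_integral_count_space_finite_support) (rule finite_subset[OF sub fin])
    also have "\<dots> = (\<Sum>i | X i \<omega> \<in> B. f i \<omega>)"
      by (rule sum.mono_neutral_cong_left[OF fin]) (auto simp: indicator_def)
    finally show "(LINT i|count_space UNIV. indicator B (X i \<omega>) *\<^sub>R f i \<omega>) = (\<Sum>i | X i \<omega> \<in> B. f i \<omega>)" .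
  qed
  finally show "(LINT p|campbell. indicator B (X (fst p) (snd p)) *\<^sub>R f (fst p) (snd p))
      = (\<integral>\<omega>. (\<Sum>i | X i \<omega> \<in> B. f i \<omega>) \<partial>M)" .
qed

section \<open>Functionals that depend on finitely many cells\<close>

definition cell :: "(real^2) set \<Rightarrow> (real^2 \<Rightarrow> nat) \<Rightarrow> nat \<Rightarrow> (real^2) set" where
  "cell K c k = {x \<in> K. c x = k}"

lemma sets_cell:
  assumes "K \<in> sets borel" "c \<in> measurable borel (count_space UNIV)"
  shows "cell K c k \<in> sets borel"
proof -
  have "cell K c k = K \<inter> (c -` {k} \<inter> space borel)" by (auto simp: cell_def)
  also have "\<dots> \<in> sets borel" using assms by (intro sets.Int measurable_sets) auto
  finally show ?thesis .
qed

lemma bounded_cell: "bounded K \<Longrightarrow> bounded (cell K c k)"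
  by (rule bounded_subset) (auto simp: cell_def)

lemma disjoint_cells: "disjoint_family_on (cell K c) I"
  by (auto simp: disjoint_family_on_def cell_def)

lemma integral_cells:
  fixes a :: "nat \<Rightarrow> complex"
  assumes K: "K \<in> sets borel" "bounded K" and c: "c \<in> measurable borel (count_space UNIV)"
    and I: "finite I" "range c \<subseteq> I"
  shows "(LINT x:K|lborel. a (c x)) = (\<Sum>k\<in>I. measure lborel (cell K c k) * a k)"
proof -
  have fin: "emeasure lborel (cell K c k) < \<infinity>" for k
    by (rule emeasure_bounded_finite[OF bounded_cell[OF K(2)]])
  have "(LINT x:K|lborel. a (c x)) = (\<integral>x. (\<Sum>k\<in>I. indicator (cell K c k) x *\<^sub>R a k) \<partial>lborel)"
    unfolding set_lebesgue_integral_def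
  proof (rule Bochner_Integration.integral_cong[OF refl])
    fix x
    have "(\<Sum>k\<in>I. indicator (cell K c k) x *\<^sub>R a k) = (\<Sum>k\<in>{c x}. indicator (cell K c k) x *\<^sub>R a k)"
      by (rule sum.mono_neutral_right) (use I in \<open>auto simp: cell_def indicator_def\<close>)
    then show "indicator K x *\<^sub>R a (c x) = (\<Sum>k\<in>I. indicator (cell K c k) x *\<^sub>R a k)"
      by (simp add: cell_def indicator_def)
  qed
  also have "\<dots> = (\<Sum>k\<in>I. LINT x|lborel. indicator (cell K c k) x *\<^sub>R a k)"
    using sets_cell[OF K(1) c] fin by (intro Bochner_Integration.integral_sum integrable_scaleR_left integrable_real_indicator) auto
  also have "\<dots> = (\<Sum>k\<in>I. measure lborel (cell K c k) * a k)"
    using sets_cell[OF K(1) c] fin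
    by (intro sum.cong refl) (simp add: scaleR_conv_of_real[symmetric])
  finally show ?thesis .
qed

lemma prod_points_cells:
  fixes a :: "nat \<Rightarrow> complex"
  assumes \<omega>: "\<omega> \<in> space M" and K: "bounded K" and I: "finite I" "range c \<subseteq> I"
  shows "(\<Prod>j | X j \<omega> \<in> K. a (c (X j \<omega>))) = (\<Prod>k\<in>I. a k ^ point_count X (cell K c k) \<omega>)"
proof -
  let ?J = "{j. X j \<omega> \<in> K}"
  have "(\<Prod>j\<in>?J. a (c (X j \<omega>))) = (\<Prod>k\<in>I. \<Prod>j | j \<in> ?J \<and> c (X j \<omega>) = k. a (c (X j \<omega>)))"
    using finite_points[OF \<omega> K] I by (intro prod.group[symmetric]) auto
  also have "\<dots> = (\<Prod>k\<in>I. a k ^ point_count X (cell K c k) \<omega>)"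
    by (intro prod.cong refl) (simp add: point_count_def cell_def)
  finally show ?thesis .
qed

text \<open>Leaving out \<open>i\<close> affects the count of its own cell only; that count is
  positive, so the subtraction is not truncated.\<close>

lemma prod_points_cells_reduced:
  fixes a :: "nat \<Rightarrow> complex"
  assumes \<omega>: "\<omega> \<in> space M" and K: "bounded K" and I: "finite I" "range c \<subseteq> I" "k \<in> I"
    and i: "X i \<omega> \<in> cell K c k"
  shows "(\<Prod>j | X j \<omega> \<in> K \<and> j \<noteq> i. a (c (X j \<omega>)))
    = (\<Prod>l\<in>I. if l = k then a k ^ (point_count X (cell K c k) \<omega> - 1) else a l ^ point_count X (cell K c l) \<omega>)"
proof -
  let ?J = "{j. X j \<omega> \<in> K \<and> j \<noteq> i}"
  have "finite ?J" by (rule finite_subset[OF _ finite_points[OF \<omega> K]]) auto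
  then have "(\<Prod>j\<in>?J. a (c (X j \<omega>))) = (\<Prod>k\<in>I. \<Prod>j | j \<in> ?J \<and> c (X j \<omega>) = k. a (c (X j \<omega>)))"
    using I by (intro prod.group[symmetric]) auto
  also have "\<dots> = (\<Prod>l\<in>I. a l ^ card {j. j \<in> ?J \<and> c (X j \<omega>) = l})"
    by (intro prod.cong refl) simp
  also have "\<dots> = (\<Prod>l\<in>I. if l = k then a k ^ (point_count X (cell K c k) \<omega> - 1)
      else a l ^ point_count X (cell K c l) \<omega>)"
  proof (intro prod.cong refl)
    fix l
    show "a l ^ card {j. j \<in> ?J \<and> c (X j \<omega>) = l} = (if l = k then a k ^ (point_count X (cell K c k) \<omega> - 1)
      else a l ^ point_count X (cell K c l) \<omega>)"
    proof (cases "l = k")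
      case True
      have "{j. j \<in> ?J \<and> c (X j \<omega>) = k} = {j. X j \<omega> \<in> cell K c k} - {i}" by (auto simp: cell_def)
      then show ?thesis using True i by (simp add: point_count_def)
    next
      case False
      then have "{j. j \<in> ?J \<and> c (X j \<omega>) = l} = {j. X j \<omega> \<in> cell K c l}"
        using i by (auto simp: cell_def)
      then show ?thesis using False by (simp add: point_count_def)
    qed
  qed
  finally show ?thesis .
qed

lemma expectation_cells:
  fixes \<phi> :: "nat \<Rightarrow> nat \<Rightarrow> complex"
  assumes K: "K \<in> sets borel" "bounded K" and c: "c \<in> measurable borel (count_space UNIV)"
    and I: "finite I" and int: "\<And>k. k \<in> I \<Longrightarrow> integrable M (\<lambda>\<omega>. \<phi> k (point_count X (cell K c k) \<omega>))"
  shows "(\<integral>\<omega>. (\<Prod>k\<in>I. \<phi> k (point_count X (cell K c k) \<omega>)) \<partial>M)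
      = (\<Prod>k\<in>I. LINT \<omega>|M. \<phi> k (point_count X (cell K c k) \<omega>))"
    and "integrable M (\<lambda>\<omega>. \<Prod>k\<in>I. \<phi> k (point_count X (cell K c k) \<omega>))"
proof -
  have ind: "indep_vars (\<lambda>_. borel) (\<lambda>k \<omega>. \<phi> k (point_count X (cell K c k) \<omega>)) I"
    using sets_cell[OF K(1) c] bounded_cell[OF K(2)] disjoint_cells I
    by (intro indep_vars_compose2[OF indep_point_counts]) auto
  show "(\<integral>\<omega>. (\<Prod>k\<in>I. \<phi> k (point_count X (cell K c k) \<omega>)) \<partial>M)
      = (\<Prod>k\<in>I. LINT \<omega>|M. \<phi> k (point_count X (cell K c k) \<omega>))"
    by (rule indep_vars_lebesgue_integral[OF I ind int])
  show "integrable M (\<lambda>\<omega>. \<Prod>k\<in>I. \<phi> k (point_count X (cell K c k) \<omega>))"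
    by (rule indep_vars_integrable[OF I ind int])
qed

text \<open>Counts in disjoint cells are independent, so the expectation is a product of Poisson
  generating functions, and their exponents add up to the integral.\<close>

lemma laplace_functional_cells:
  fixes a :: "nat \<Rightarrow> complex"
  assumes K: "K \<in> sets borel" "bounded K" and c: "c \<in> measurable borel (count_space UNIV)"
    and fin: "finite (range c)"
  shows "(\<integral>\<omega>. (\<Prod>j | X j \<omega> \<in> K. a (c (X j \<omega>))) \<partial>M)
    = exp (- of_real lam * (LINT x:K|lborel. 1 - a (c x)))"
proof -
  let ?I = "range c"
  have "(\<integral>\<omega>. (\<Prod>j | X j \<omega> \<in> K. a (c (X j \<omega>))) \<partial>M)
      = (\<integral>\<omega>. (\<Prod>k\<in>?I. a k ^ point_count X (cell K c k) \<omega>) \<partial>M)"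
    by (intro Bochner_Integration.integral_cong refl prod_points_cells K fin subset_refl)
  also have "\<dots> = (\<Prod>k\<in>?I. LINT \<omega>|M. a k ^ point_count X (cell K c k) \<omega>)"
    by (intro expectation_cells(1)[where \<phi> = "\<lambda>k n. a k ^ n"] K c fin expectation_power_count(1)
      sets_cell bounded_cell)
  also have "\<dots> = (\<Prod>k\<in>?I. exp (- of_real (lam * measure lborel (cell K c k)) * (1 - a k)))"
    by (intro prod.cong refl expectation_power_count(2) sets_cell bounded_cell K c)
  also have "\<dots> = exp (\<Sum>k\<in>?I. - of_real (lam * measure lborel (cell K c k)) * (1 - a k))"
    by (rule exp_sum[OF fin, symmetric])
  also have "(\<Sum>k\<in>?I. - of_real (lam * measure lborel (cell K c k)) * (1 - a k))
      = - of_real lam * (LINT x:K|lborel. 1 - a (c x))"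
    by (subst integral_cells[OF K c fin subset_refl, of "\<lambda>k. 1 - a k"])
      (simp add: sum_distrib_left sum_negf mult.assoc)
  finally show ?thesis .
qed

text \<open>All points of cell \<open>k\<close> have the same reduced product. The sum is therefore
  the count of that cell times a power lowered by one, times independent powers for the other cells.
  The differentiated generating function of the first factor is the mean count times the
  undifferentiated one, which restores the full Laplace functional.\<close>

lemma mecke_cell:
  fixes a :: "nat \<Rightarrow> complex"
  assumes K: "K \<in> sets borel" "bounded K" and c: "c \<in> measurable borel (count_space UNIV)"
    and fin: "finite (range c)"
  shows "integrable M (\<lambda>\<omega>. \<Sum>i | X i \<omega> \<in> cell K c k. \<Prod>j | X j \<omega> \<in> K \<and> j \<noteq> i. a (c (X j \<omega>)))" (is ?int)
    and "(\<integral>\<omega>. (\<Sum>i | X i \<omega> \<in> cell K c k. \<Prod>j | X j \<omega> \<in> K \<and> j \<noteq> i. a (c (X j \<omega>))) \<partial>M)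
    = of_real (lam * measure lborel (cell K c k)) * exp (- of_real lam * (LINT x:K|lborel. 1 - a (c x)))" (is ?eq)
proof -
  \<comment> \<open>The label \<open>k\<close> need not be a value of \<open>c\<close>; its cell is
    then empty and both sides vanish.\<close>
  let ?I = "insert k (range c)"
  have I: "finite ?I" "range c \<subseteq> ?I" "k \<in> ?I" using fin by auto
  define \<phi> where "\<phi> l n = (if l = k then of_nat n * a k ^ (n - 1) else a l ^ n)" for l n
  have e: "(\<Sum>i | X i \<omega> \<in> cell K c k. \<Prod>j | X j \<omega> \<in> K \<and> j \<noteq> i. a (c (X j \<omega>)))
      = (\<Prod>l\<in>?I. \<phi> l (point_count X (cell K c l) \<omega>))" if \<omega>: "\<omega> \<in> space M" for \<omega>
  proof -
    let ?N = "\<lambda>l. point_count X (cell K c l) \<omega>"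
    let ?p = "\<Prod>l\<in>?I. if l = k then a k ^ (?N k - 1) else a l ^ ?N l"
    have "(\<Sum>i | X i \<omega> \<in> cell K c k. \<Prod>j | X j \<omega> \<in> K \<and> j \<noteq> i. a (c (X j \<omega>)))
        = (\<Sum>i | X i \<omega> \<in> cell K c k. ?p)"
      by (intro sum.cong refl prod_points_cells_reduced[OF \<omega> K(2) I]) simp
    also have "\<dots> = of_nat (?N k) * ?p" by (simp add: point_count_def)
    also have "?p = a k ^ (?N k - 1) * (\<Prod>l\<in>?I - {k}. a l ^ ?N l)"
      using I by (subst prod.remove[of _ k]) (auto intro!: prod.cong)
    also have "of_nat (?N k) * (a k ^ (?N k - 1) * (\<Prod>l\<in>?I - {k}. a l ^ ?N l)) = (\<Prod>l\<in>?I. \<phi> l (?N l))"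
      using I by (subst prod.remove[of _ k]) (auto intro!: prod.cong simp: \<phi>_def)
    finally show ?thesis .
  qed
  have cells: "cell K c l \<in> sets borel" "bounded (cell K c l)" for l
    by (intro sets_cell bounded_cell K c)+
  have int: "integrable M (\<lambda>\<omega>. \<phi> l (point_count X (cell K c l) \<omega>))" for l
  proof (cases "l = k")
    case True
    then show ?thesis using expectation_deriv_count(1)[OF cells[of k], where a = "a k"] by (simp only: \<phi>_def if_True refl)
  next
    case False
    then show ?thesis using expectation_power_count(1)[OF cells[of l], where a = "a l"] by (simp only: \<phi>_def if_False)
  qed
  have ex: "(LINT \<omega>|M. \<phi> l (point_count X (cell K c l) \<omega>))
      = (if l = k then of_real (lam * measure lborel (cell K c k)) else 1) * exp (- of_real (lam * measure lborel (cell K c l)) * (1 - a l))" for l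
  proof (cases "l = k")
    case True
    then show ?thesis using expectation_deriv_count(2)[OF cells[of k], where a = "a k"] by (simp only: \<phi>_def if_True refl)
  next
    case False
    then show ?thesis using expectation_power_count(2)[OF cells[of l], where a = "a l"] by (simp only: \<phi>_def if_False mult_1_left)
  qed
  show ?int
    by (subst Bochner_Integration.integrable_cong[OF refl e], assumption)
      (rule expectation_cells(2)[OF K c I(1) int])
  have "(\<integral>\<omega>. (\<Sum>i | X i \<omega> \<in> cell K c k. \<Prod>j | X j \<omega> \<in> K \<and> j \<noteq> i. a (c (X j \<omega>))) \<partial>M)
      = (\<integral>\<omega>. (\<Prod>l\<in>?I. \<phi> l (point_count X (cell K c l) \<omega>)) \<partial>M)"
    by (intro Bochner_Integration.integral_cong refl e)
  also have "\<dots> = (\<Prod>l\<in>?I. LINT \<omega>|M. \<phi> l (point_count X (cell K c l) \<omega>))"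
    by (rule expectation_cells(1)[OF K c I(1) int])
  also have "\<dots> = (\<Prod>l\<in>?I. if l = k then of_real (lam * measure lborel (cell K c k)) else 1) *
      (\<Prod>l\<in>?I. exp (- of_real (lam * measure lborel (cell K c l)) * (1 - a l)))"
    unfolding ex by (rule prod.distrib)
  also have "(\<Prod>l\<in>?I. if l = k then of_real (lam * measure lborel (cell K c k)) else 1)
      = (of_real (lam * measure lborel (cell K c k)) :: complex)"
    using I by (simp add: prod.delta)
  also have "(\<Prod>l\<in>?I. exp (- of_real (lam * measure lborel (cell K c l)) * (1 - a l)))
      = exp (\<Sum>l\<in>?I. - of_real (lam * measure lborel (cell K c l)) * (1 - a l))"
    by (rule exp_sum[OF I(1), symmetric])
  also have "(\<Sum>l\<in>?I. - of_real (lam * measure lborel (cell K c l)) * (1 - a l))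
      = - of_real lam * (LINT x:K|lborel. 1 - a (c x))"
    by (subst integral_cells[OF K c I(1,2), of "\<lambda>k. 1 - a k"])
      (simp only: sum_distrib_left of_real_mult mult.assoc minus_mult_left)
  finally show ?eq .
qed

end

section \<open>From simple weights to measurable weights\<close>

lemma norm_prod_le_one:
  fixes f :: "'a \<Rightarrow> complex"
  assumes "\<And>i. norm (f i) \<le> 1"
  shows "norm (prod f A) \<le> 1"
proof -
  have "norm (prod f A) = (\<Prod>i\<in>A. norm (f i))" by (rule prod_norm[symmetric])
  also have "\<dots> \<le> 1" by (rule prod_le_1) (simp add: assms)
  finally show ?thesis .
qed

text \<open>A simple function is presented as a label \<open>c\<close> and a table of values
  \<open>a\<close>, the form used with cells. General simple approximations are bounded only up to a
  factor 2, and projection onto the disc brings the bound back to 1.\<close>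

lemma simple_approximation_unit_disc:
  fixes u :: "'a::topological_space \<Rightarrow> complex"
  assumes u: "u \<in> borel_measurable borel" "\<And>x. norm (u x) \<le> 1"
  obtains c :: "nat \<Rightarrow> 'a \<Rightarrow> nat" and a where "\<And>n. c n \<in> measurable borel (count_space UNIV)"
    "\<And>n. finite (range (c n))" "\<And>n k. norm (a n k) \<le> 1" "\<And>x. (\<lambda>n. a n (c n x)) \<longlonglongrightarrow> u x"
proof -
  obtain F where "(\<forall>n. simple_function borel (F n)) \<and> (\<forall>x\<in>space borel. (\<lambda>n. F n x) \<longlonglongrightarrow> u x) \<and>
      (\<forall>n. \<forall>x\<in>space borel. dist (F n x) 0 \<le> 2 * dist (u x) 0)"
    using borel_measurable_implies_sequence_metric[OF u(1), of 0] by (elim exE) (rule that)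
  then have F: "\<And>n. simple_function borel (F n)" "\<And>x. (\<lambda>n. F n x) \<longlonglongrightarrow> u x"
    by auto
  let ?p = "closest_point (cball 0 1 :: complex set)"
  define G where "G n x = ?p (F n x)" for n x
  define c where "c n x = to_nat_on (range (G n)) (G n x)" for n x
  define a where "a n k = from_nat_into (range (G n)) k" for n k
  have G: "simple_function borel (G n)" for n
    unfolding G_def by (rule simple_function_compose1[OF F(1)])
  have fin: "finite (range (G n))" for n using simple_functionD(1)[OF G[of n]] by simp
  have pn: "norm (?p z) \<le> 1" for z
    using closest_point_in_set[of "cball 0 1 :: complex set" z] by simp
  have cont: "continuous_on UNIV ?p" by (intro continuous_on_closest_point) auto
  show ?thesis
  proof (rule that[of c a])
    fix n
    have "simple_function borel (c n)" unfolding c_def by (rule simple_function_compose1[OF G])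
    then show "c n \<in> measurable borel (count_space UNIV)" by (rule measurable_simple_function)
    have "range (c n) = to_nat_on (range (G n)) ` range (G n)" by (auto simp: c_def)
    then show "finite (range (c n))" using fin by simp
    fix k
    have "a n k \<in> range (G n)" unfolding a_def by (rule from_nat_into) simp
    then show "norm (a n k) \<le> 1" using pn by (auto simp: G_def)
  next
    fix x
    have "a n (c n x) = G n x" for n
      unfolding a_def c_def by (rule from_nat_into_to_nat_on) (auto simp: countable_finite[OF fin])
    moreover have "(\<lambda>n. G n x) \<longlonglongrightarrow> ?p (u x)"
      unfolding G_def using cont F(2)[of x]
      by (intro isCont_tendsto_compose[of "u x" ?p]) (auto simp: continuous_on_eq_continuous_at)
    moreover have "?p (u x) = u x" using u(2) by (intro closest_point_self) simp
    ultimately show "(\<lambda>n. a n (c n x)) \<longlonglongrightarrow> u x" by simp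
  qed
qed

lemma set_integral_tendsto_bounded:
  fixes u :: "real^2 \<Rightarrow> complex"
  assumes K: "K \<in> sets borel" "bounded K" and un: "\<And>n. un n \<in> borel_measurable borel"
    "\<And>n x. norm (un n x) \<le> 1" and lim: "\<And>x. (\<lambda>n. un n x) \<longlonglongrightarrow> u x"
  shows "(\<lambda>n. LINT x:K|lborel. 1 - un n x) \<longlonglongrightarrow> (LINT x:K|lborel. 1 - u x)"
  unfolding set_lebesgue_integral_def
proof (rule integral_dominated_convergence[where w = "\<lambda>x. 2 * indicator K x"])
  have u: "u \<in> borel_measurable borel"
    by (rule borel_measurable_LIMSEQ_metric[OF un(1) lim])
  show "(\<lambda>x. indicator K x *\<^sub>R (1 - u x)) \<in> borel_measurable lborel"
    "(\<lambda>x. indicator K x *\<^sub>R (1 - un n x)) \<in> borel_measurable lborel" for n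
    using u un(1) K by auto
  have "emeasure lborel K < \<infinity>" by (rule emeasure_bounded_finite[OF K(2)])
  then show "integrable lborel (\<lambda>x. 2 * indicator K x :: real)" using K by simp
  show "AE x in lborel. (\<lambda>n. indicator K x *\<^sub>R (1 - un n x)) \<longlonglongrightarrow> indicator K x *\<^sub>R (1 - u x)"
    by (intro AE_I2 tendsto_intros lim)
  have "norm (1 - un n x) \<le> 2" for n x
    using norm_triangle_ineq4[of 1 "un n x"] un(2)[of n x] by simp
  then show "AE x in lborel. norm (indicator K x *\<^sub>R (1 - un n x)) \<le> 2 * indicator K x" for n
    by (intro AE_I2) (auto simp: indicator_def)
qed

context poisson_process begin

lemma measurable_prod_points:
  fixes u :: "real^2 \<Rightarrow> complex"
  assumes "u \<in> borel_measurable borel" "K \<in> sets borel" "bounded K"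
  shows "(\<lambda>\<omega>. \<Prod>j | X j \<omega> \<in> K. u (X j \<omega>)) \<in> borel_measurable M"
  using assms by (intro measurable_prod_finite_index finite_points) auto

lemma measurable_prod_points_reduced:
  fixes w :: "real^2 \<Rightarrow> real^2 \<Rightarrow> complex"
  assumes "case_prod w \<in> borel_measurable (borel \<Otimes>\<^sub>M borel)" "K \<in> sets borel" "bounded K"
  shows "(\<lambda>\<omega>. \<Prod>j | X j \<omega> \<in> K \<and> j \<noteq> i. w (X i \<omega>) (X j \<omega>)) \<in> borel_measurable M"
proof (rule measurable_prod_finite_index)
  show "(\<lambda>\<omega>. w (X i \<omega>) (X j \<omega>)) \<in> borel_measurable M" for j
    using assms(1) by measurable
  show "Measurable.pred M (\<lambda>\<omega>. X j \<omega> \<in> K \<and> j \<noteq> i)" for j using assms(2) by measurable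
  show "finite {j. X j \<omega> \<in> K \<and> j \<noteq> i}" if "\<omega> \<in> space M" for \<omega>
    by (rule finite_subset[OF _ finite_points[OF that assms(3)]]) auto
qed

text \<open>At a fixed outcome the product has finitely many factors, so it converges factor by
  factor, with 1 as dominating function.\<close>

lemma laplace_functional:
  fixes u :: "real^2 \<Rightarrow> complex"
  assumes K: "K \<in> sets borel" "bounded K" and u: "u \<in> borel_measurable borel" "\<And>x. norm (u x) \<le> 1"
  shows "(LINT \<omega>|M. (\<Prod>j | X j \<omega> \<in> K. u (X j \<omega>))) = exp (- of_real lam * (LINT x:K|lborel. 1 - u x))"
proof -
  obtain c :: "nat \<Rightarrow> real^2 \<Rightarrow> nat" and a where c: "\<And>n. c n \<in> measurable borel (count_space UNIV)"
    "\<And>n. finite (range (c n))" and a: "\<And>n k. norm (a n k) \<le> 1" and lim: "\<And>x. (\<lambda>n. a n (c n x)) \<longlonglongrightarrow> u x"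
    by (rule simple_approximation_unit_disc[OF u]) (rule that)
  have ac: "(\<lambda>x. a n (c n x)) \<in> borel_measurable borel" for n
    by (rule measurable_compose[OF c(1)]) simp
  have "(\<lambda>n. LINT \<omega>|M. (\<Prod>j | X j \<omega> \<in> K. a n (c n (X j \<omega>)))) \<longlonglongrightarrow> (LINT \<omega>|M. (\<Prod>j | X j \<omega> \<in> K. u (X j \<omega>)))"
  proof (rule integral_dominated_convergence[where w = "\<lambda>_. 1"])
    show "AE \<omega> in M. (\<lambda>n. \<Prod>j | X j \<omega> \<in> K. a n (c n (X j \<omega>))) \<longlonglongrightarrow> (\<Prod>j | X j \<omega> \<in> K. u (X j \<omega>))"
      by (intro AE_I2 tendsto_prod lim)
  qed (auto intro!: norm_prod_le_one measurable_prod_points a ac u K)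
  moreover have "(\<lambda>n. LINT \<omega>|M. (\<Prod>j | X j \<omega> \<in> K. a n (c n (X j \<omega>))))
      \<longlonglongrightarrow> exp (- of_real lam * (LINT x:K|lborel. 1 - u x))"
    unfolding laplace_functional_cells[OF K c]
    by (intro tendsto_exp tendsto_mult tendsto_const set_integral_tendsto_bounded K ac a lim)
  ultimately show ?thesis by (rule LIMSEQ_unique)
qed

text \<open>The weight does not see the distinguished point, so \<open>mecke_cell\<close> can be
  summed over the cells that make up the window \<open>B\<close>.\<close>

lemma mecke_simple:
  fixes a :: "nat \<Rightarrow> complex"
  assumes K: "K \<in> sets borel" "bounded K" and B: "B \<in> sets borel" "B \<subseteq> K"
    and c: "c \<in> measurable borel (count_space UNIV)" "finite (range c)" and a: "\<And>k. norm (a k) \<le> 1"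
  shows "(LINT p|campbell. indicator B (X (fst p) (snd p)) *\<^sub>R
      (\<Prod>j | X j (snd p) \<in> K \<and> j \<noteq> fst p. a (c (X j (snd p)))))
    = of_real (lam * measure lborel B) * exp (- of_real lam * (LINT x:K|lborel. 1 - a (c x)))"
proof -
  have bB: "bounded B" by (rule bounded_subset[OF K(2) B(2)])
  \<comment> \<open>The label also records membership in \<open>B\<close>, which makes
    \<open>B\<close> a union of cells; \<open>L\<close> collects the labels of those cells.\<close>
  define e where "e x = prod_encode (c x, if x \<in> B then 1 else 0)" for x
  define b where "b k = a (fst (prod_decode k))" for k
  have be: "b (e x) = a (c x)" for x by (simp add: b_def e_def)
  have e: "e \<in> measurable borel (count_space UNIV)" unfolding e_def using c(1) B(1) by measurable
  have fe: "finite (range e)"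
  proof (rule finite_subset)
    show "range e \<subseteq> prod_encode ` (range c \<times> {0, 1})" by (auto simp: e_def)
    show "finite (prod_encode ` (range c \<times> {0, 1}))" using c(2) by simp
  qed
  define L where "L = {k \<in> range e. snd (prod_decode k) = 1}"
  have L: "finite L" using fe by (simp add: L_def)
  have eL: "e x \<in> L \<longleftrightarrow> x \<in> B" for x by (simp add: L_def e_def)
  have cells: "(\<Union>k\<in>L. cell K e k) = B" using B(2) eL by (auto simp: cell_def)
  let ?F = "\<lambda>i \<omega>. \<Prod>j | X j \<omega> \<in> K \<and> j \<noteq> i. b (e (X j \<omega>))"
  have m: "?F i \<in> borel_measurable M" for i
    using measurable_prod_points_reduced[of "\<lambda>x y. b (e y)" K i] K measurable_compose[OF e, of b]
    by (simp add: measurable_compose[OF measurable_snd] split_beta')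
  have "(LINT p|campbell. indicator B (X (fst p) (snd p)) *\<^sub>R ?F (fst p) (snd p))
      = (LINT \<omega>|M. (\<Sum>i | X i \<omega> \<in> B. ?F i \<omega>))"
    using a by (intro campbell_window_integral(2)[OF B(1) bB m, where b = 1] norm_prod_le_one) (simp add: b_def)
  also have "\<dots> = (LINT \<omega>|M. (\<Sum>k\<in>L. \<Sum>i | X i \<omega> \<in> cell K e k. ?F i \<omega>))"
  proof (rule Bochner_Integration.integral_cong[OF refl])
    fix \<omega> assume \<omega>: "\<omega> \<in> space M"
    have "(\<Sum>i | X i \<omega> \<in> B. ?F i \<omega>) = (\<Sum>k\<in>L. \<Sum>i | i \<in> {i. X i \<omega> \<in> B} \<and> e (X i \<omega>) = k. ?F i \<omega>)"
      using finite_points[OF \<omega> bB] L eL by (intro sum.group[symmetric]) auto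
    also have "\<dots> = (\<Sum>k\<in>L. \<Sum>i | X i \<omega> \<in> cell K e k. ?F i \<omega>)"
      using B(2) eL by (intro sum.cong refl arg_cong2[where f=sum]) (auto simp: cell_def)
    finally show "(\<Sum>i | X i \<omega> \<in> B. ?F i \<omega>) = (\<Sum>k\<in>L. \<Sum>i | X i \<omega> \<in> cell K e k. ?F i \<omega>)" .
  qed
  also have "\<dots> = (\<Sum>k\<in>L. LINT \<omega>|M. (\<Sum>i | X i \<omega> \<in> cell K e k. ?F i \<omega>))"
    by (intro Bochner_Integration.integral_sum mecke_cell(1) K e fe)
  also have "\<dots> = (\<Sum>k\<in>L. of_real (lam * measure lborel (cell K e k)) * exp (- of_real lam * (LINT x:K|lborel. 1 - b (e x))))"
    by (intro sum.cong refl mecke_cell(2) K e fe)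
  also have "\<dots> = of_real (lam * (\<Sum>k\<in>L. measure lborel (cell K e k))) * exp (- of_real lam * (LINT x:K|lborel. 1 - b (e x)))"
    by (simp only: sum_distrib_left sum_distrib_right of_real_sum)
  also have "(\<Sum>k\<in>L. measure lborel (cell K e k)) = measure lborel B"
  proof -
    have "emeasure lborel (cell K e k) \<noteq> \<infinity>" for k
      using emeasure_bounded_finite[OF bounded_cell[OF K(2)], of e k] by simp
    then have "measure lborel (\<Union>k\<in>L. cell K e k) = (\<Sum>k\<in>L. measure lborel (cell K e k))"
      using sets_cell[OF K(1) e] by (intro measure_finite_Union L disjoint_cells) auto
    then show ?thesis by (simp only: cells)
  qed
  finally show ?thesis by (simp only: be)
qed

lemma mecke_fixed:
  fixes u :: "real^2 \<Rightarrow> complex"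
  assumes K: "K \<in> sets borel" "bounded K" and B: "B \<in> sets borel" "B \<subseteq> K"
    and u: "u \<in> borel_measurable borel" "\<And>x. norm (u x) \<le> 1"
  shows "(LINT p|campbell. indicator B (X (fst p) (snd p)) *\<^sub>R
      (\<Prod>j | X j (snd p) \<in> K \<and> j \<noteq> fst p. u (X j (snd p))))
    = of_real (lam * measure lborel B) * exp (- of_real lam * (LINT x:K|lborel. 1 - u x))"
proof -
  have bB: "bounded B" by (rule bounded_subset[OF K(2) B(2)])
  obtain c :: "nat \<Rightarrow> real^2 \<Rightarrow> nat" and a where c: "\<And>n. c n \<in> measurable borel (count_space UNIV)"
    "\<And>n. finite (range (c n))" and a: "\<And>n k. norm (a n k) \<le> 1" and lim: "\<And>x. (\<lambda>n. a n (c n x)) \<longlonglongrightarrow> u x"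
    by (rule simple_approximation_unit_disc[OF u]) (rule that)
  have ac: "(\<lambda>x. a n (c n x)) \<in> borel_measurable borel" for n
    by (rule measurable_compose[OF c(1)]) simp
  let ?G = "\<lambda>v p. indicator B (X (fst p) (snd p)) *\<^sub>R (\<Prod>j | X j (snd p) \<in> K \<and> j \<noteq> fst p. v (X j (snd p)))"
  have int: "integrable campbell (?G v)" if v: "v \<in> borel_measurable borel" "\<And>x. norm (v x) \<le> 1" for v :: "real^2 \<Rightarrow> complex"
  proof (rule campbell_window_integral(1)[OF B(1) bB])
    show "(\<lambda>\<omega>. \<Prod>j | X j \<omega> \<in> K \<and> j \<noteq> i. v (X j \<omega>)) \<in> borel_measurable M" for i
      using measurable_prod_points_reduced[of "\<lambda>x y. v y" K i] K v
      by (simp add: measurable_compose[OF measurable_snd] split_beta')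
    show "norm (\<Prod>j | X j \<omega> \<in> K \<and> j \<noteq> i. v (X j \<omega>)) \<le> 1" for i \<omega> by (intro norm_prod_le_one v)
  qed
  have "(\<lambda>n. LINT p|campbell. ?G (\<lambda>x. a n (c n x)) p) \<longlonglongrightarrow> (LINT p|campbell. ?G u p)"
  proof (rule integral_dominated_convergence[where w = "\<lambda>p. indicator B (X (fst p) (snd p)) *\<^sub>R 1"])
    show "?G u \<in> borel_measurable campbell" by (rule borel_measurable_integrable[OF int[OF u]])
    show "?G (\<lambda>x. a n (c n x)) \<in> borel_measurable campbell" for n
      by (rule borel_measurable_integrable[OF int[OF ac a]])
    show "integrable campbell (\<lambda>p. indicator B (X (fst p) (snd p)) *\<^sub>R (1::real))"
      by (rule campbell_window_integral(1)[OF B(1) bB, of "\<lambda>_ _. 1" 1]) auto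
    show "AE p in campbell. (\<lambda>n. ?G (\<lambda>x. a n (c n x)) p) \<longlonglongrightarrow> ?G u p"
      by (intro AE_I2 tendsto_scaleR tendsto_const tendsto_prod lim)
    have "norm (\<Prod>j | X j (snd p) \<in> K \<and> j \<noteq> fst p. a n (c n (X j (snd p)))) \<le> 1" for n p
      by (intro norm_prod_le_one a)
    then show "AE p in campbell. norm (?G (\<lambda>x. a n (c n x)) p) \<le> indicator B (X (fst p) (snd p)) *\<^sub>R 1" for n
      by (intro AE_I2) (simp add: indicator_def)
  qed
  moreover have "(\<lambda>n. LINT p|campbell. ?G (\<lambda>x. a n (c n x)) p)
      \<longlonglongrightarrow> of_real (lam * measure lborel B) * exp (- of_real lam * (LINT x:K|lborel. 1 - u x))"
    by (subst mecke_simple[OF K B c a]) (intro tendsto_exp tendsto_mult tendsto_const set_integral_tendsto_bounded K ac a lim)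
  ultimately show ?thesis by (rule LIMSEQ_unique)
qed


section \<open>First and second factorial moment measures\<close>

lemma measurable_campbell:
  "(\<And>i. (\<lambda>\<omega>. f (i, \<omega>)) \<in> measurable M N) \<Longrightarrow> f \<in> measurable campbell N"
  by (rule measurable_pair_measure_countable1) auto

lemma measurable_campbell_point: "(\<lambda>p. X (fst p) (snd p)) \<in> borel_measurable campbell"
  by (rule measurable_campbell) simp

lemma emeasure_bounded_eq: "bounded A \<Longrightarrow> emeasure lborel (A :: (real^2) set) = ennreal (measure lborel A)"
  using emeasure_bounded_finite[of A] by (intro emeasure_eq_ennreal_measure) auto

text \<open>Campbell's formula. The image of the Campbell measure under the point map agrees with
  \<open>lam\<close> times Lebesgue measure on bounded sets, where mean counts are known, and then
  on all Borel sets by exhaustion with balls.\<close>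

lemma nn_integral_campbell:
  assumes h: "h \<in> borel_measurable borel"
  shows "(\<integral>\<^sup>+p. h (X (fst p) (snd p)) \<partial>campbell) = ennreal lam * (\<integral>\<^sup>+x. h x \<partial>lborel)"
proof -
  let ?D = "distr campbell borel (\<lambda>p. X (fst p) (snd p))"
  note X[measurable] = measurable_campbell_point
  have em: "emeasure ?D A = (\<integral>\<^sup>+p. indicator A (X (fst p) (snd p)) \<partial>campbell)" if "A \<in> sets borel" for A
  proof -
    have "emeasure ?D A = (\<integral>\<^sup>+x. indicator A x \<partial>?D)" using that by simp
    also have "\<dots> = (\<integral>\<^sup>+p. indicator A (X (fst p) (snd p)) \<partial>campbell)"
      using that by (intro nn_integral_distr) auto
    finally show ?thesis .
  qed
  have "scale_measure (ennreal lam) lborel = ?D"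
  proof (rule measure_eqI)
    fix A :: "(real^2) set" assume "A \<in> sets (scale_measure (ennreal lam) lborel)"
    then have A: "A \<in> sets borel" by simp
    let ?A = "\<lambda>n. A \<inter> ball 0 (real n)"
    have inc: "incseq ?A" by (auto simp: incseq_def)
    have un: "(\<Union>n. ?A n) = A" by (auto intro: reals_Archimedean2)
    have "(SUP n. emeasure ?D (?A n)) = emeasure ?D (\<Union>n. ?A n)"
      by (rule SUP_emeasure_incseq) (use A inc in auto)
    then have "emeasure ?D A = (SUP n. emeasure ?D (?A n))" by (simp only: un)
    also have "\<dots> = (SUP n. ennreal lam * emeasure lborel (?A n))"
    proof (intro SUP_cong refl)
      fix n
      have "bounded (?A n)" by (rule bounded_subset[OF bounded_ball]) auto
      then show "emeasure ?D (?A n) = ennreal lam * emeasure lborel (?A n)"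
        using A lam_pos by (simp add: em nn_integral_campbell_window emeasure_bounded_eq ennreal_mult)
    qed
    also have "\<dots> = ennreal lam * (SUP n. emeasure lborel (?A n))"
      by (rule SUP_mult_left_ennreal[symmetric])
    also have "(SUP n. emeasure lborel (?A n)) = emeasure lborel (\<Union>n. ?A n)"
      by (rule SUP_emeasure_incseq) (use A inc in auto)
    also have "(\<Union>n. ?A n) = A" by (rule un)
    finally show "emeasure (scale_measure (ennreal lam) lborel) A = emeasure ?D A" by simp
  qed simp
  then have "(\<integral>\<^sup>+x. h x \<partial>scale_measure (ennreal lam) lborel) = (\<integral>\<^sup>+x. h x \<partial>?D)" by simp
  then show ?thesis using h by (simp add: nn_integral_scale_measure nn_integral_distr)
qed

text \<open>Two applications of \<open>weight_Suc\<close> shift the series by two indices and pull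
  out the square of the mean.\<close>

lemma expectation_count_pairs:
  assumes A: "A \<in> sets borel" "bounded A"
  shows "integrable M (\<lambda>\<omega>. real (point_count X A \<omega> * (point_count X A \<omega> - 1)))"
    and "(LINT \<omega>|M. real (point_count X A \<omega> * (point_count X A \<omega> - 1))) = (lam * measure lborel A)\<^sup>2"
proof -
  define m where "m = lam * measure lborel A"
  let ?\<phi> = "\<lambda>k. real (k * (k - 1))"
  have "(\<lambda>k. complex_of_real (weight A k)) sums of_real 1"
    using weight_power_sums(1)[of A 1] by (simp add: scaleR_conv_of_real)
  then have w: "weight A sums 1" by (subst (asm) sums_of_real_iff)
  have e: "weight A (Suc (Suc k)) *\<^sub>R ?\<phi> (Suc (Suc k)) = m * m * weight A k" for k
  proof -
    have "weight A (Suc (Suc k)) *\<^sub>R ?\<phi> (Suc (Suc k)) = weight A (Suc (Suc k)) * real (Suc (Suc k)) * real (Suc k)"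
      by (simp add: algebra_simps)
    also have "\<dots> = m * (weight A (Suc k) * real (Suc k))"
      by (subst weight_Suc) (simp only: m_def mult.assoc)
    also have "\<dots> = m * m * weight A k" by (subst weight_Suc) (simp only: m_def mult.assoc)
    finally show ?thesis .
  qed
  have "(\<lambda>k. weight A (Suc (Suc k)) *\<^sub>R ?\<phi> (Suc (Suc k))) sums (m * m * 1)"
    unfolding e by (rule sums_mult[OF w])
  then have "(\<lambda>k. weight A (Suc k) *\<^sub>R ?\<phi> (Suc k)) sums (m * m)"
    using sums_Suc_iff[of "\<lambda>k. weight A (Suc k) *\<^sub>R ?\<phi> (Suc k)" "m * m"] by simp
  then have s: "(\<lambda>k. weight A k *\<^sub>R ?\<phi> k) sums (m * m)"
    using sums_Suc_iff[of "\<lambda>k. weight A k *\<^sub>R ?\<phi> k" "m * m"] by simp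
  have "summable (\<lambda>k. weight A k * norm (?\<phi> k))"
    using sums_summable[OF s] by simp
  note * = expectation_point_count[OF A this]
  show "integrable M (\<lambda>\<omega>. real (point_count X A \<omega> * (point_count X A \<omega> - 1)))" by (rule *(1))
  show "(LINT \<omega>|M. real (point_count X A \<omega> * (point_count X A \<omega> - 1))) = (lam * measure lborel A)\<^sup>2"
    using sums_unique2[OF *(2) s] by (simp add: m_def power2_eq_square)
qed

lemma expectation_count_disjoint:
  assumes A: "A \<in> sets borel" "bounded A" and C: "C \<in> sets borel" "bounded C" and disj: "A \<inter> C = {}"
  shows "integrable M (\<lambda>\<omega>. real (point_count X A \<omega>) * real (point_count X C \<omega>))"
    and "(LINT \<omega>|M. real (point_count X A \<omega>) * real (point_count X C \<omega>))
      = lam * measure lborel A * (lam * measure lborel C)"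
proof -
  let ?D = "\<lambda>n::nat. if n = 0 then A else C"
  let ?Y = "\<lambda>n \<omega>. real (point_count X (?D n) \<omega>)"
  have ind: "indep_vars (\<lambda>_. borel) ?Y {0, 1}"
    using A C disj by (intro indep_vars_compose2[OF indep_point_counts[of "{0,1}" ?D]])
      (auto simp: disjoint_family_on_def)
  have int: "integrable M (?Y n)" for n using A C by (auto intro: expectation_count)
  have "integrable M (\<lambda>\<omega>. \<Prod>n\<in>{0,1}. ?Y n \<omega>)"
    by (rule indep_vars_integrable[OF _ ind int]) simp
  then show "integrable M (\<lambda>\<omega>. real (point_count X A \<omega>) * real (point_count X C \<omega>))" by simp
  have "(LINT \<omega>|M. (\<Prod>n\<in>{0,1}. ?Y n \<omega>)) = (\<Prod>n\<in>{0,1}. LINT \<omega>|M. ?Y n \<omega>)"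
    by (rule indep_vars_lebesgue_integral[OF _ ind int]) simp
  then show "(LINT \<omega>|M. real (point_count X A \<omega>) * real (point_count X C \<omega>))
      = lam * measure lborel A * (lam * measure lborel C)"
    by (simp add: expectation_count(2)[OF A] expectation_count(2)[OF C])
qed

text \<open>Integration against the second factorial moment measure.\<close>

definition pair_integral :: "((real^2) \<times> (real^2) \<Rightarrow> ennreal) \<Rightarrow> ennreal" where
  "pair_integral h = (\<integral>\<^sup>+p. (\<integral>\<^sup>+j. indicator (- {fst p}) j * h (X (fst p) (snd p), X j (snd p))
     \<partial>count_space UNIV) \<partial>campbell)"

text \<open>Two points in disjoint sets have distinct indices, so the sum over pairs is the product
  of two independent counts.\<close>

lemma pair_integral_disjoint:
  assumes A: "A \<in> sets borel" "bounded A" and C: "C \<in> sets borel" "bounded C" and disj: "A \<inter> C = {}"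
  shows "pair_integral (indicator (A \<times> C)) = ennreal (lam * measure lborel A * (lam * measure lborel C))"
proof -
  have e: "indicator (- {fst p}) j * (indicator (A \<times> C) (X (fst p) (snd p), X j (snd p)) :: ennreal)
      = indicator A (X (fst p) (snd p)) * indicator C (X j (snd p))" for p j
    using disj by (auto simp: indicator_def)
  have "pair_integral (indicator (A \<times> C))
      = (\<integral>\<^sup>+p. indicator A (X (fst p) (snd p)) * (\<integral>\<^sup>+j. indicator C (X j (snd p)) \<partial>count_space UNIV) \<partial>campbell)"
    unfolding pair_integral_def e by (intro nn_integral_cong nn_integral_cmult) auto
  also have "\<dots> = (\<integral>\<^sup>+p. indicator A (X (fst p) (snd p)) * ennreal (real (point_count X C (snd p))) \<partial>campbell)"
    using C by (intro nn_integral_cong) (auto simp: nn_integral_count_window space_pair_measure)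
  also have "\<dots> = (\<integral>\<^sup>+\<omega>. (\<integral>\<^sup>+i. indicator A (X i \<omega>) * ennreal (real (point_count X C \<omega>)) \<partial>count_space UNIV) \<partial>M)"
  proof (subst campbell.nn_integral_snd[symmetric])
    show "(\<lambda>p. indicator A (X (fst p) (snd p)) * ennreal (real (point_count X C (snd p)))) \<in> borel_measurable campbell"
      using A measurable_compose[OF measurable_point_count[OF C], of "\<lambda>n. ennreal (real (n))" borel]
      by (intro measurable_campbell borel_measurable_times_ennreal) (auto simp: comp_def)
  qed simp
  also have "\<dots> = (\<integral>\<^sup>+\<omega>. ennreal (real (point_count X A \<omega>) * real (point_count X C \<omega>)) \<partial>M)"
  proof (rule nn_integral_cong)
    fix \<omega> assume "\<omega> \<in> space M"
    then show "(\<integral>\<^sup>+i. indicator A (X i \<omega>) * ennreal (real (point_count X C \<omega>)) \<partial>count_space UNIV)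
        = ennreal (real (point_count X A \<omega>) * real (point_count X C \<omega>))"
      using A by (subst nn_integral_multc) (auto simp: nn_integral_count_window ennreal_mult)
  qed
  also have "\<dots> = ennreal (LINT \<omega>|M. real (point_count X A \<omega>) * real (point_count X C \<omega>))"
    by (rule nn_integral_eq_integral[OF expectation_count_disjoint(1)[OF assms]]) simp
  finally show ?thesis by (simp only: expectation_count_disjoint(2)[OF assms])
qed

text \<open>Each of the n points in \<open>A\<close> sees n - 1 others, which gives the factorial
  moment of the count.\<close>

lemma pair_integral_square:
  assumes A: "A \<in> sets borel" "bounded A"
  shows "pair_integral (indicator (A \<times> A)) = ennreal ((lam * measure lborel A)\<^sup>2)"
proof -
  have inner: "(\<integral>\<^sup>+j. indicator (- {i}) j * indicator (A \<times> A) (X i \<omega>, X j \<omega>) \<partial>count_space UNIV)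
      = indicator A (X i \<omega>) * ennreal (real (point_count X A \<omega> - 1))" if \<omega>: "\<omega> \<in> space M" for i \<omega>
  proof (cases "X i \<omega> \<in> A")
    case True
    have fin: "finite {j. X j \<omega> \<in> A}" by (rule finite_points[OF \<omega> A(2)])
    have "(\<integral>\<^sup>+j. indicator (- {i}) j * indicator (A \<times> A) (X i \<omega>, X j \<omega>) \<partial>count_space UNIV)
        = (\<integral>\<^sup>+j. indicator ({j. X j \<omega> \<in> A} - {i}) j \<partial>count_space UNIV)"
      using True by (intro nn_integral_cong) (auto simp: indicator_def)
    also have "\<dots> = of_nat (card ({j. X j \<omega> \<in> A} - {i}))"
      using fin by (simp add: emeasure_count_space_finite)
    also have "card ({j. X j \<omega> \<in> A} - {i}) = point_count X A \<omega> - 1"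
      using True fin by (simp add: point_count_def)
    finally show ?thesis using True by (simp add: ennreal_of_nat_eq_real_of_nat)
  qed (simp add: indicator_def)
  have "pair_integral (indicator (A \<times> A))
      = (\<integral>\<^sup>+p. indicator A (X (fst p) (snd p)) * ennreal (real (point_count X A (snd p) - 1)) \<partial>campbell)"
    unfolding pair_integral_def by (intro nn_integral_cong inner) (auto simp: space_pair_measure)
  also have "\<dots> = (\<integral>\<^sup>+\<omega>. (\<integral>\<^sup>+i. indicator A (X i \<omega>) * ennreal (real (point_count X A \<omega> - 1)) \<partial>count_space UNIV) \<partial>M)"
  proof (subst campbell.nn_integral_snd[symmetric])
    show "(\<lambda>p. indicator A (X (fst p) (snd p)) * ennreal (real (point_count X A (snd p) - 1))) \<in> borel_measurable campbell"
      using A measurable_compose[OF measurable_point_count[OF A], of "\<lambda>n. ennreal (real (n - 1))" borel]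
      by (intro measurable_campbell borel_measurable_times_ennreal) (auto simp: comp_def)
  qed simp
  also have "\<dots> = (\<integral>\<^sup>+\<omega>. ennreal (real (point_count X A \<omega> * (point_count X A \<omega> - 1))) \<partial>M)"
  proof (rule nn_integral_cong)
    fix \<omega> assume "\<omega> \<in> space M"
    then show "(\<integral>\<^sup>+i. indicator A (X i \<omega>) * ennreal (real (point_count X A \<omega> - 1)) \<partial>count_space UNIV)
        = ennreal (real (point_count X A \<omega> * (point_count X A \<omega> - 1)))"
      using A by (subst nn_integral_multc) (auto simp: nn_integral_count_window ennreal_mult)
  qed
  also have "\<dots> = ennreal (LINT \<omega>|M. real (point_count X A \<omega> * (point_count X A \<omega> - 1)))"
    by (rule nn_integral_eq_integral[OF expectation_count_pairs(1)[OF A]]) simp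
  finally show ?thesis by (simp only: expectation_count_pairs(2)[OF A])
qed

text \<open>\<open>pair_integral\<close> presented as a measure, so that a uniqueness theorem
  extends its values on rectangles to all measurable functions. The elements of the source space are
  (j, (i, \<omega>)), and the density removes the diagonal j = i.\<close>

definition moment_measure :: "((real^2) \<times> (real^2)) measure" where
  "moment_measure = distr (density (count_space UNIV \<Otimes>\<^sub>M campbell) (\<lambda>q. indicator (- {fst (snd q)}) (fst q)))
     (borel \<Otimes>\<^sub>M borel) (\<lambda>q. (X (fst (snd q)) (snd (snd q)), X (fst q) (snd (snd q))))"

lemma nn_integral_moment_measure:
  assumes h: "h \<in> borel_measurable (borel \<Otimes>\<^sub>M borel)"
  shows "(\<integral>\<^sup>+z. h z \<partial>moment_measure) = pair_integral h"
proof -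
  interpret P: pair_sigma_finite "count_space (UNIV :: nat set)" campbell
    by (intro pair_sigma_finite.intro sigma_finite_measure_count_space_countable campbell.P.sigma_finite_measure_axioms) auto
  let ?Q = "count_space (UNIV :: nat set) \<Otimes>\<^sub>M campbell"
  have mQ: "f \<in> measurable ?Q N" if "\<And>i j. (\<lambda>\<omega>. f (j, i, \<omega>)) \<in> measurable M N" for f :: "_ \<Rightarrow> 'z" and N
    by (intro measurable_pair_measure_countable1 measurable_campbell that) auto
  have XX: "(\<lambda>q. (X (fst (snd q)) (snd (snd q)), X (fst q) (snd (snd q)))) \<in> measurable ?Q (borel \<Otimes>\<^sub>M borel)"
    by (rule mQ) simp
  have ind: "(\<lambda>q. indicator (- {fst (snd q)}) (fst q) :: ennreal) \<in> borel_measurable ?Q"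
    by (rule mQ) simp
  have "(\<integral>\<^sup>+z. h z \<partial>moment_measure)
      = (\<integral>\<^sup>+q. indicator (- {fst (snd q)}) (fst q) * h (X (fst (snd q)) (snd (snd q)), X (fst q) (snd (snd q))) \<partial>?Q)"
    unfolding moment_measure_def using XX h ind measurable_compose[OF XX h]
    by (subst nn_integral_distr, simp, simp, subst nn_integral_density) auto
  also have "\<dots> = pair_integral h"
    unfolding pair_integral_def using ind measurable_compose[OF XX h]
    by (subst P.nn_integral_snd[symmetric]) auto
  finally show ?thesis .
qed

text \<open>Overlapping sides are the difficulty. The rectangle is cut into two rectangles with
  disjoint sides and the square over \<open>A \<inter> C\<close>; with means \<open>a\<close>,
  \<open>b\<close>, \<open>p\<close> of the three disjoint pieces the contributions add up to (a +
  p) (b + p).\<close>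

lemma emeasure_moment_measure_bounded:
  assumes A: "A \<in> sets borel" "bounded A" and C: "C \<in> sets borel" "bounded C"
  shows "emeasure moment_measure (A \<times> C) = (ennreal lam * emeasure lborel A) * (ennreal lam * emeasure lborel C)"
proof -
  have em: "emeasure moment_measure Q = pair_integral (indicator Q)" if "Q \<in> sets (borel \<Otimes>\<^sub>M borel)" for Q
    using that by (subst nn_integral_moment_measure[symmetric]) (auto simp: moment_measure_def)
  have sets: "sets moment_measure = sets (borel \<Otimes>\<^sub>M borel)" by (simp add: moment_measure_def)
  define a where "a = lam * measure lborel (A - C)"
  define b where "b = lam * measure lborel (C - A)"
  define p where "p = lam * measure lborel (A \<inter> C)"
  have nn: "a \<ge> 0" "b \<ge> 0" "p \<ge> 0" using lam_pos by (auto simp: a_def b_def p_def)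
  have fin: "emeasure lborel D \<noteq> \<infinity>" if "bounded D" for D :: "(real^2) set"
    using emeasure_bounded_finite[OF that] by simp
  have bd: "bounded (A - C)" "bounded (C - A)" "bounded (A \<inter> C)"
    using A C by (auto intro: bounded_subset[of A] bounded_subset[of C])
  have mA: "lam * measure lborel A = a + p"
  proof -
    have "A = (A - C) \<union> (A \<inter> C)" by auto
    then have "measure lborel A = measure lborel ((A - C) \<union> (A \<inter> C))" by simp
    also have "\<dots> = measure lborel (A - C) + measure lborel (A \<inter> C)"
      using A C bd by (intro measure_Union fin) auto
    finally show ?thesis by (simp add: a_def p_def distrib_left)
  qed
  have mC: "lam * measure lborel C = b + p"
  proof -
    have "C = (C - A) \<union> (A \<inter> C)" by auto
    then have "measure lborel C = measure lborel ((C - A) \<union> (A \<inter> C))" by simp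
    also have "\<dots> = measure lborel (C - A) + measure lborel (A \<inter> C)"
      using A C bd by (intro measure_Union fin) auto
    finally show ?thesis by (simp add: b_def p_def distrib_left)
  qed
  have split: "A \<times> C = ((A - C) \<times> C) \<union> (((A \<inter> C) \<times> (C - A)) \<union> ((A \<inter> C) \<times> (A \<inter> C)))" by auto
  have "emeasure moment_measure (A \<times> C) = emeasure moment_measure
      (((A - C) \<times> C) \<union> (((A \<inter> C) \<times> (C - A)) \<union> ((A \<inter> C) \<times> (A \<inter> C))))"
    by (rule arg_cong[OF split])
  also have "\<dots> = emeasure moment_measure ((A - C) \<times> C)
      + emeasure moment_measure (((A \<inter> C) \<times> (C - A)) \<union> ((A \<inter> C) \<times> (A \<inter> C)))"
    by (rule plus_emeasure[symmetric]) (use A C in \<open>auto simp: sets\<close>)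
  also have "emeasure moment_measure (((A \<inter> C) \<times> (C - A)) \<union> ((A \<inter> C) \<times> (A \<inter> C)))
      = emeasure moment_measure ((A \<inter> C) \<times> (C - A)) + emeasure moment_measure ((A \<inter> C) \<times> (A \<inter> C))"
    by (rule plus_emeasure[symmetric]) (use A C in \<open>auto simp: sets\<close>)
  also have "emeasure moment_measure ((A - C) \<times> C) = ennreal (a * (b + p))"
    using A C bd by (subst em, simp, subst pair_integral_disjoint) (auto simp: a_def mC[symmetric])
  also have "emeasure moment_measure ((A \<inter> C) \<times> (C - A)) = ennreal (p * b)"
    using A C bd by (subst em, simp, subst pair_integral_disjoint) (auto simp: p_def b_def)
  also have "emeasure moment_measure ((A \<inter> C) \<times> (A \<inter> C)) = ennreal (p\<^sup>2)"
    using A C bd by (subst em, simp, subst pair_integral_square) (auto simp: p_def)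
  also have "ennreal (a * (b + p)) + (ennreal (p * b) + ennreal (p\<^sup>2)) = ennreal (a * (b + p) + (p * b + p\<^sup>2))"
    using nn by (simp add: ennreal_plus)
  also have "a * (b + p) + (p * b + p\<^sup>2) = (a + p) * (b + p)" by (simp add: algebra_simps power2_eq_square)
  also have "ennreal ((a + p) * (b + p)) = (ennreal lam * emeasure lborel A) * (ennreal lam * emeasure lborel C)"
    using lam_pos A C by (simp add: mA[symmetric] mC[symmetric] emeasure_bounded_eq ennreal_mult)
  finally show ?thesis .
qed

lemma emeasure_moment_measure_rectangle:
  assumes A: "A \<in> sets borel" and C: "C \<in> sets borel"
  shows "emeasure moment_measure (A \<times> C) = (ennreal lam * emeasure lborel A) * (ennreal lam * emeasure lborel C)"
proof -
  have sets: "sets moment_measure = sets (borel \<Otimes>\<^sub>M borel)" by (simp add: moment_measure_def)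
  let ?R = "\<lambda>D n. D \<inter> ball (0::real^2) (real n)"
  have inc: "incseq (?R D)" for D by (auto simp: incseq_def)
  have un: "(\<Union>n. ?R D n) = D" for D by (auto intro: reals_Archimedean2)
  have bd: "bounded (?R D n)" for D n by (rule bounded_subset[OF bounded_ball]) auto
  have mb: "?R D n \<in> sets borel" if "D \<in> sets borel" for D n using that by auto
  have leb: "emeasure lborel D = (SUP n. emeasure lborel (?R D n))" if "D \<in> sets borel" for D
  proof -
    have "(SUP n. emeasure lborel (?R D n)) = emeasure lborel (\<Union>n. ?R D n)"
      by (rule SUP_emeasure_incseq) (use that inc in auto)
    then show ?thesis by (simp only: un)
  qed
  have 1: "emeasure moment_measure (A \<times> C) = (ennreal lam * emeasure lborel A) * (ennreal lam * emeasure lborel C)"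
    if C: "C \<in> sets borel" "bounded C" for C
  proof -
    have "(\<Union>n. ?R A n \<times> C) = A \<times> C" using un[of A] by blast
    moreover have "(SUP n. emeasure moment_measure (?R A n \<times> C)) = emeasure moment_measure (\<Union>n. ?R A n \<times> C)"
      using A C inc[of A] by (intro SUP_emeasure_incseq) (auto simp: sets incseq_def)
    ultimately have "emeasure moment_measure (A \<times> C) = (SUP n. emeasure moment_measure (?R A n \<times> C))" by simp
    also have "\<dots> = (SUP n. (ennreal lam * (ennreal lam * emeasure lborel C)) * emeasure lborel (?R A n))"
      by (intro SUP_cong refl) (simp only: emeasure_moment_measure_bounded[OF mb[OF A] bd C] ac_simps)
    also have "\<dots> = (ennreal lam * (ennreal lam * emeasure lborel C)) * emeasure lborel A"
      unfolding leb[OF A] by (rule SUP_mult_left_ennreal[symmetric])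
    finally show ?thesis by (simp only: ac_simps)
  qed
  have "(\<Union>n. A \<times> ?R C n) = A \<times> C" using un[of C] by blast
  moreover have "(SUP n. emeasure moment_measure (A \<times> ?R C n)) = emeasure moment_measure (\<Union>n. A \<times> ?R C n)"
    using A C inc[of C] by (intro SUP_emeasure_incseq) (auto simp: sets incseq_def)
  ultimately have "emeasure moment_measure (A \<times> C) = (SUP n. emeasure moment_measure (A \<times> ?R C n))" by simp
  also have "\<dots> = (SUP n. (ennreal lam * (ennreal lam * emeasure lborel A)) * emeasure lborel (?R C n))"
    by (intro SUP_cong refl) (simp only: 1[OF mb[OF C] bd] ac_simps)
  also have "\<dots> = (ennreal lam * (ennreal lam * emeasure lborel A)) * emeasure lborel C"
    unfolding leb[OF C] by (rule SUP_mult_left_ennreal[symmetric])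
  finally show ?thesis by (simp only: ac_simps)
qed

lemma pair_integral_eq:
  assumes h: "h \<in> borel_measurable (borel \<Otimes>\<^sub>M borel)"
  shows "pair_integral h = ennreal (lam\<^sup>2) * (\<integral>\<^sup>+z. h z \<partial>(lborel \<Otimes>\<^sub>M lborel))"
proof -
  have c: "ennreal (1 / lam\<^sup>2) * (ennreal lam * ennreal lam) = 1"
    using lam_pos by (simp add: ennreal_mult[symmetric] power2_eq_square)
  \<comment> \<open>Uniqueness of product measures needs an unscaled product on one side, so the
    factor is moved to \<open>moment_measure\<close>.\<close>
  have "lborel \<Otimes>\<^sub>M lborel = scale_measure (ennreal (1 / lam\<^sup>2)) moment_measure"
  proof (rule pair_measure_eqI)
    show "sets (lborel \<Otimes>\<^sub>M lborel) = sets (scale_measure (ennreal (1 / lam\<^sup>2)) moment_measure)"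
      by (simp add: moment_measure_def)
    fix A C :: "(real^2) set" assume "A \<in> sets lborel" "C \<in> sets lborel"
    then have "emeasure (scale_measure (ennreal (1 / lam\<^sup>2)) moment_measure) (A \<times> C)
        = (ennreal (1 / lam\<^sup>2) * (ennreal lam * ennreal lam)) * (emeasure lborel A * emeasure lborel C)"
      by (simp only: emeasure_scale_measure emeasure_moment_measure_rectangle sets_lborel ac_simps)
    then show "emeasure lborel A * emeasure lborel C = emeasure (scale_measure (ennreal (1 / lam\<^sup>2)) moment_measure) (A \<times> C)"
      by (simp only: c mult_1_left)
  qed (rule lborel.sigma_finite_measure_axioms)+
  then have "(\<integral>\<^sup>+z. h z \<partial>(lborel \<Otimes>\<^sub>M lborel)) = (\<integral>\<^sup>+z. h z \<partial>scale_measure (ennreal (1 / lam\<^sup>2)) moment_measure)"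
    by simp
  also have "\<dots> = ennreal (1 / lam\<^sup>2) * pair_integral h"
  proof -
    have "h \<in> borel_measurable moment_measure" using h by (simp add: moment_measure_def)
    then show ?thesis by (simp only: nn_integral_scale_measure nn_integral_moment_measure[OF h])
  qed
  finally have "ennreal (lam\<^sup>2) * (\<integral>\<^sup>+z. h z \<partial>(lborel \<Otimes>\<^sub>M lborel))
      = (ennreal (1 / lam\<^sup>2) * (ennreal lam * ennreal lam)) * pair_integral h"
    using lam_pos by (simp only: power2_eq_square ennreal_mult order_less_imp_le ac_simps)
  then show ?thesis by (simp only: c mult_1_left)
qed

end

section \<open>The Mecke equation\<close>

context poisson_process begin

definition mecke_lhs :: "(real^2) set \<Rightarrow> (real^2) set \<Rightarrow> (real^2 \<Rightarrow> real^2 \<Rightarrow> complex) \<Rightarrow> complex" where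
  "mecke_lhs B K w = (LINT p|campbell. indicator B (X (fst p) (snd p)) *\<^sub>R
     (\<Prod>j | X j (snd p) \<in> K \<and> j \<noteq> fst p. w (X (fst p) (snd p)) (X j (snd p))))"

text \<open>By the Laplace functional the inner exponential is the expected product over a Poisson
  process seen from \<open>x\<close>, with no factor for \<open>x\<close> itself.\<close>

definition mecke_rhs :: "(real^2) set \<Rightarrow> (real^2) set \<Rightarrow> (real^2 \<Rightarrow> real^2 \<Rightarrow> complex) \<Rightarrow> complex" where
  "mecke_rhs B K w = of_real lam * (LINT x:B|lborel. exp (- of_real lam * (LINT y:K|lborel. 1 - w x y)))"

definition window_distance :: "(real^2) set \<Rightarrow> (real^2) set \<Rightarrow>
    (real^2 \<Rightarrow> real^2 \<Rightarrow> complex) \<Rightarrow> (real^2 \<Rightarrow> real^2 \<Rightarrow> complex) \<Rightarrow> ennreal" where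
  "window_distance B K w v = (\<integral>\<^sup>+z. indicator B (fst z) * indicator K (snd z) *
     ennreal (norm (w (fst z) (snd z) - v (fst z) (snd z))) \<partial>(lborel \<Otimes>\<^sub>M lborel))"

lemma integrable_mecke:
  fixes w :: "real^2 \<Rightarrow> real^2 \<Rightarrow> complex"
  assumes K: "K \<in> sets borel" "bounded K" and B: "B \<in> sets borel" "B \<subseteq> K"
    and w: "case_prod w \<in> borel_measurable (borel \<Otimes>\<^sub>M borel)" "\<And>x y. norm (w x y) \<le> 1"
  shows "integrable campbell (\<lambda>p. indicator B (X (fst p) (snd p)) *\<^sub>R
     (\<Prod>j | X j (snd p) \<in> K \<and> j \<noteq> fst p. w (X (fst p) (snd p)) (X j (snd p))))"
  by (rule campbell_window_integral(1)[OF B(1) bounded_subset[OF K(2) B(2)]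
      measurable_prod_points_reduced[OF w(1) K], where b = 1]) (rule norm_prod_le_one, rule w(2))

text \<open>On the cell of the distinguished point the weight is one fixed function of the other
  point, so \<open>mecke_fixed\<close> applies with the cell as window; the sum over cells is the
  integral over \<open>B\<close>.\<close>

lemma mecke_fibrewise_simple:
  fixes W :: "nat \<Rightarrow> real^2 \<Rightarrow> complex"
  assumes K: "K \<in> sets borel" "bounded K" and B: "B \<in> sets borel" "B \<subseteq> K"
    and c: "c \<in> measurable borel (count_space UNIV)" "finite (range c)"
    and W: "\<And>k. W k \<in> borel_measurable borel" "\<And>x y. norm (W (c x) y) \<le> 1"
  shows "mecke_lhs B K (\<lambda>x. W (c x)) = mecke_rhs B K (\<lambda>x. W (c x))"
proof -
  have bB: "bounded B" by (rule bounded_subset[OF K(2) B(2)])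
  let ?G = "\<lambda>k p. indicator (cell B c k) (X (fst p) (snd p)) *\<^sub>R (\<Prod>j | X j (snd p) \<in> K \<and> j \<noteq> fst p. W k (X j (snd p)))"
  let ?a = "\<lambda>k. exp (- of_real lam * (LINT y:K|lborel. 1 - W k y))"
  have Wk: "norm (W k y) \<le> 1" if "k \<in> range c" for k y using that W(2) by auto
  have cB: "cell B c k \<in> sets borel" "cell B c k \<subseteq> K" for k
    using sets_cell[OF B(1) c(1)] B(2) by (auto simp: cell_def)
  have "indicator B (X (fst p) (snd p)) *\<^sub>R (\<Prod>j | X j (snd p) \<in> K \<and> j \<noteq> fst p. W (c (X (fst p) (snd p))) (X j (snd p)))
      = (\<Sum>k\<in>range c. ?G k p)" for p
  proof -
    let ?x = "X (fst p) (snd p)"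
    have "(\<Sum>k\<in>range c. ?G k p) = (\<Sum>k\<in>{c ?x}. ?G k p)"
      by (rule sum.mono_neutral_right[OF c(2)]) (auto simp: cell_def indicator_def)
    then show ?thesis by (simp add: cell_def indicator_def)
  qed
  then have "mecke_lhs B K (\<lambda>x. W (c x)) = (LINT p|campbell. (\<Sum>k\<in>range c. ?G k p))"
    unfolding mecke_lhs_def by simp
  also have "\<dots> = (\<Sum>k\<in>range c. LINT p|campbell. ?G k p)"
  proof (rule Bochner_Integration.integral_sum)
    fix k assume k: "k \<in> range c"
    have "case_prod (\<lambda>x. W k) \<in> borel_measurable (borel \<Otimes>\<^sub>M borel)"
      unfolding split_beta' by (rule measurable_compose[OF measurable_snd W(1)])
    then show "integrable campbell (?G k)"
      by (rule integrable_mecke[OF K cB]) (rule Wk[OF k])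
  qed
  also have "\<dots> = (\<Sum>k\<in>range c. of_real (lam * measure lborel (cell B c k)) * ?a k)"
    by (intro sum.cong refl mecke_fixed K cB W(1) Wk)
  also have "\<dots> = of_real lam * (\<Sum>k\<in>range c. measure lborel (cell B c k) * ?a k)"
    by (simp only: sum_distrib_left of_real_mult mult.assoc)
  also have "(\<Sum>k\<in>range c. measure lborel (cell B c k) * ?a k) = (LINT x:B|lborel. ?a (c x))"
    by (rule integral_cells[OF B(1) bB c subset_refl, symmetric])
  finally show ?thesis by (simp only: mecke_rhs_def)
qed

text \<open>The difference of two products with factors in the unit disc is at most the sum of the
  differences of the factors. Summed over the distinguished point as well, this is an integral over
  pairs of distinct points, which the second factorial moment measure evaluates.\<close>

lemma mecke_lhs_lipschitz:
  fixes w v :: "real^2 \<Rightarrow> real^2 \<Rightarrow> complex"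
  assumes K: "K \<in> sets borel" "bounded K" and B: "B \<in> sets borel" "B \<subseteq> K"
    and w: "case_prod w \<in> borel_measurable (borel \<Otimes>\<^sub>M borel)" "\<And>x y. norm (w x y) \<le> 1"
    and v: "case_prod v \<in> borel_measurable (borel \<Otimes>\<^sub>M borel)" "\<And>x y. norm (v x y) \<le> 1"
  shows "ennreal (norm (mecke_lhs B K w - mecke_lhs B K v)) \<le> ennreal (lam\<^sup>2) * window_distance B K w v"
proof -
  let ?G = "\<lambda>w p. indicator B (X (fst p) (snd p)) *\<^sub>R (\<Prod>j | X j (snd p) \<in> K \<and> j \<noteq> fst p. w (X (fst p) (snd p)) (X j (snd p)))"
  let ?h = "\<lambda>z. indicator B (fst z) * indicator K (snd z) * ennreal (norm (w (fst z) (snd z) - v (fst z) (snd z)))"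
  have iw: "integrable campbell (?G w)" and iv: "integrable campbell (?G v)"
    by (rule integrable_mecke[OF K B w], rule integrable_mecke[OF K B v])
  have mh: "?h \<in> borel_measurable (borel \<Otimes>\<^sub>M borel)"
    using w(1) v(1) K B unfolding split_beta' by measurable
  have le: "ennreal (norm (?G w p - ?G v p))
      \<le> (\<integral>\<^sup>+j. indicator (- {fst p}) j * ?h (X (fst p) (snd p), X j (snd p)) \<partial>count_space UNIV)"
    if p: "p \<in> space campbell" for p
  proof (cases "X (fst p) (snd p) \<in> B")
    case True
    let ?J = "{j. X j (snd p) \<in> K \<and> j \<noteq> fst p}"
    let ?d = "\<lambda>j. norm (w (X (fst p) (snd p)) (X j (snd p)) - v (X (fst p) (snd p)) (X j (snd p)))"
    have "snd p \<in> space M" using p by (auto simp: space_pair_measure)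
    from finite_points[OF this K(2)] have fin: "finite ?J" by (rule rev_finite_subset) auto
    have "norm (?G w p - ?G v p) \<le> (\<Sum>j\<in>?J. ?d j)"
      using True norm_prod_diff[of ?J "\<lambda>j. w (X (fst p) (snd p)) (X j (snd p))" "\<lambda>j. v (X (fst p) (snd p)) (X j (snd p))"] w(2) v(2)
      by simp
    then have "ennreal (norm (?G w p - ?G v p)) \<le> ennreal (\<Sum>j\<in>?J. ?d j)" by (rule ennreal_leI)
    also have "\<dots> = (\<Sum>j\<in>?J. ennreal (?d j))" by (rule sum_ennreal[symmetric]) simp
    also have "\<dots> = (\<integral>\<^sup>+j. ennreal (?d j) \<partial>count_space ?J)"
      by (rule nn_integral_count_space_finite[OF fin, symmetric])
    also have "\<dots> = (\<integral>\<^sup>+j. ennreal (?d j) * indicator ?J j \<partial>count_space UNIV)"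
      by (rule nn_integral_count_space_indicator) simp
    also have "\<dots> = (\<integral>\<^sup>+j. indicator (- {fst p}) j * ?h (X (fst p) (snd p), X j (snd p)) \<partial>count_space UNIV)"
      using True by (intro nn_integral_cong) (auto simp: indicator_def)
    finally show ?thesis .
  qed simp
  have "mecke_lhs B K w - mecke_lhs B K v = (LINT p|campbell. ?G w p - ?G v p)"
    unfolding mecke_lhs_def by (rule Bochner_Integration.integral_diff[OF iw iv, symmetric])
  then have "ennreal (norm (mecke_lhs B K w - mecke_lhs B K v)) = ennreal (norm (LINT p|campbell. ?G w p - ?G v p))"
    by (simp only:)
  also have "\<dots> \<le> (\<integral>\<^sup>+p. ennreal (norm (?G w p - ?G v p)) \<partial>campbell)"
    by (rule integral_norm_bound_ennreal[OF Bochner_Integration.integrable_diff[OF iw iv]])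
  also have "\<dots> \<le> pair_integral ?h"
    unfolding pair_integral_def by (rule nn_integral_mono) (rule le)
  also have "\<dots> = ennreal (lam\<^sup>2) * window_distance B K w v"
    unfolding window_distance_def by (rule pair_integral_eq[OF mh])
  finally show ?thesis .
qed

text \<open>The exponential is 1-Lipschitz on the left half-plane; one factor \<open>lam\<close>
  comes from the exponent and one from the front of \<open>mecke_rhs\<close>.\<close>

lemma mecke_rhs_lipschitz:
  fixes w v :: "real^2 \<Rightarrow> real^2 \<Rightarrow> complex"
  assumes K: "K \<in> sets borel" "bounded K" and B: "B \<in> sets borel" "B \<subseteq> K"
    and w: "case_prod w \<in> borel_measurable (borel \<Otimes>\<^sub>M borel)" "\<And>x y. norm (w x y) \<le> 1"
    and v: "case_prod v \<in> borel_measurable (borel \<Otimes>\<^sub>M borel)" "\<And>x y. norm (v x y) \<le> 1"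
  shows "ennreal (norm (mecke_rhs B K w - mecke_rhs B K v)) \<le> ennreal (lam\<^sup>2) * window_distance B K w v"
proof -
  define I where "I w x = (LINT y:K|lborel. 1 - w x y)" for w :: "real^2 \<Rightarrow> real^2 \<Rightarrow> complex" and x
  let ?e = "\<lambda>w x. exp (- of_real lam * I w x)"
  have fK: "emeasure lborel K < \<infinity>" by (rule emeasure_bounded_finite[OF K(2)])
  have fB: "emeasure lborel B < \<infinity>" by (rule emeasure_bounded_finite[OF bounded_subset[OF K(2) B(2)]])
  have slice: "u x \<in> borel_measurable borel" if "case_prod u \<in> borel_measurable (borel \<Otimes>\<^sub>M borel)"
    for u :: "real^2 \<Rightarrow> real^2 \<Rightarrow> complex" and x
    using measurable_compose[OF measurable_Pair1' that, of x] by simp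
  have intK: "integrable lborel (\<lambda>y. indicator K y *\<^sub>R (1 - u x y))"
    if u: "case_prod u \<in> borel_measurable (borel \<Otimes>\<^sub>M borel)" "\<And>x y. norm (u x y) \<le> 1"
    for u :: "real^2 \<Rightarrow> real^2 \<Rightarrow> complex" and x
  proof (rule integrableI_bounded_set_indicator[where B = 2])
    show "(\<lambda>y. 1 - u x y) \<in> borel_measurable lborel" using slice[OF u(1), of x] by simp
    show "AE y in lborel. y \<in> K \<longrightarrow> norm (1 - u x y) \<le> 2"
      using norm_triangle_ineq4[of 1 "u x y" for y] u(2) by (intro AE_I2 impI) (smt (verit) norm_one)
  qed (use K fK in auto)
  \<comment> \<open>Weights in the unit disc keep the exponents in the left half-plane.\<close>
  have ReI: "Re (I u x) \<ge> 0"
    if u: "case_prod u \<in> borel_measurable (borel \<Otimes>\<^sub>M borel)" "\<And>x y. norm (u x y) \<le> 1"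
    for u :: "real^2 \<Rightarrow> real^2 \<Rightarrow> complex" and x
  proof -
    have "Re (I u x) = (LINT y|lborel. Re (indicator K y *\<^sub>R (1 - u x y)))"
      unfolding I_def set_lebesgue_integral_def by (rule integral_Re[OF intK[OF u], symmetric])
    also have "\<dots> \<ge> 0"
    proof (rule Bochner_Integration.integral_nonneg)
      fix y
      have "Re (u x y) \<le> 1" using complex_Re_le_cmod[of "u x y"] u(2)[of x y] by linarith
      then show "0 \<le> Re (indicator K y *\<^sub>R (1 - u x y))" by (simp add: indicator_def)
    qed
    finally show ?thesis .
  qed
  have mI: "I u \<in> borel_measurable borel"
    if u: "case_prod u \<in> borel_measurable (borel \<Otimes>\<^sub>M borel)" for u :: "real^2 \<Rightarrow> real^2 \<Rightarrow> complex"
  proof -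
    have "case_prod (\<lambda>x y. indicator K y *\<^sub>R (1 - u x y)) \<in> borel_measurable (borel \<Otimes>\<^sub>M lborel)"
      using u K unfolding split_beta' by measurable
    then show ?thesis
      unfolding I_def[abs_def] set_lebesgue_integral_def
      by (rule lborel.borel_measurable_lebesgue_integral)
  qed
  have intB: "integrable lborel (\<lambda>x. indicator B x *\<^sub>R ?e u x)"
    if u: "case_prod u \<in> borel_measurable (borel \<Otimes>\<^sub>M borel)" "\<And>x y. norm (u x y) \<le> 1"
    for u :: "real^2 \<Rightarrow> real^2 \<Rightarrow> complex"
  proof (rule integrableI_bounded_set_indicator[where B = 1])
    show "?e u \<in> borel_measurable lborel" using mI[OF u(1)] by measurable
    show "AE x in lborel. x \<in> B \<longrightarrow> norm (?e u x) \<le> 1"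
      using ReI[OF u] lam_pos by (intro AE_I2 impI) (simp add: norm_exp_eq_Re)
  qed (use B fB in auto)
  have le: "ennreal (norm (?e w x - ?e v x))
      \<le> ennreal lam * (\<integral>\<^sup>+y. indicator K y * ennreal (norm (w x y - v x y)) \<partial>lborel)" for x
  proof -
    have "norm (?e w x - ?e v x) \<le> norm (- of_real lam * I w x - (- of_real lam * I v x))"
      using ReI[OF w, of x] ReI[OF v, of x] lam_pos by (intro norm_exp_diff_le) auto
    also have "\<dots> = lam * norm (I v x - I w x)"
    proof -
      have "- of_real lam * I w x - (- of_real lam * I v x) = of_real lam * (I v x - I w x)"
        by (simp add: algebra_simps)
      then show ?thesis using lam_pos by (simp add: norm_mult)
    qed
    finally have "ennreal (norm (?e w x - ?e v x)) \<le> ennreal lam * ennreal (norm (I v x - I w x))"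
      using lam_pos by (simp add: ennreal_leI ennreal_mult[symmetric])
    also have "I v x - I w x = (LINT y|lborel. indicator K y *\<^sub>R (1 - v x y) - indicator K y *\<^sub>R (1 - w x y))"
      unfolding I_def set_lebesgue_integral_def
      by (rule Bochner_Integration.integral_diff[OF intK[OF v] intK[OF w], symmetric])
    also have "ennreal (norm \<dots>) \<le> (\<integral>\<^sup>+y. ennreal (norm (indicator K y *\<^sub>R (1 - v x y) - indicator K y *\<^sub>R (1 - w x y))) \<partial>lborel)"
      by (rule integral_norm_bound_ennreal[OF Bochner_Integration.integrable_diff[OF intK[OF v] intK[OF w]]])
    also have "\<dots> = (\<integral>\<^sup>+y. indicator K y * ennreal (norm (w x y - v x y)) \<partial>lborel)"
      by (intro nn_integral_cong) (auto simp: indicator_def)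
    finally show ?thesis by (simp add: mult_left_mono)
  qed
  have "mecke_rhs B K w - mecke_rhs B K v
      = of_real lam * (LINT x|lborel. indicator B x *\<^sub>R ?e w x - indicator B x *\<^sub>R ?e v x)"
    unfolding mecke_rhs_def I_def[symmetric] set_lebesgue_integral_def[of lborel B]
    by (subst Bochner_Integration.integral_diff[OF intB[OF w] intB[OF v]]) (simp add: right_diff_distrib)
  then have "ennreal (norm (mecke_rhs B K w - mecke_rhs B K v))
      = ennreal lam * ennreal (norm (LINT x|lborel. indicator B x *\<^sub>R ?e w x - indicator B x *\<^sub>R ?e v x))"
    using lam_pos by (simp add: norm_mult ennreal_mult)
  also have "ennreal (norm (LINT x|lborel. indicator B x *\<^sub>R ?e w x - indicator B x *\<^sub>R ?e v x))
      \<le> (\<integral>\<^sup>+x. ennreal (norm (indicator B x *\<^sub>R ?e w x - indicator B x *\<^sub>R ?e v x)) \<partial>lborel)"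
    by (rule integral_norm_bound_ennreal[OF Bochner_Integration.integrable_diff[OF intB[OF w] intB[OF v]]])
  also have "\<dots> = (\<integral>\<^sup>+x. indicator B x * ennreal (norm (?e w x - ?e v x)) \<partial>lborel)"
    by (intro nn_integral_cong) (auto simp: indicator_def)
  also have "\<dots> \<le> (\<integral>\<^sup>+x. indicator B x * (ennreal lam * (\<integral>\<^sup>+y. indicator K y * ennreal (norm (w x y - v x y)) \<partial>lborel)) \<partial>lborel)"
    by (intro nn_integral_mono mult_left_mono le) simp
  also have "\<dots> = ennreal lam * window_distance B K w v"
  proof -
    have m2: "(\<lambda>z. indicator B (fst z) * indicator K (snd z) * ennreal (norm (w (fst z) (snd z) - v (fst z) (snd z))))
        \<in> borel_measurable (lborel \<Otimes>\<^sub>M lborel)"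
      using w(1) v(1) K B unfolding split_beta' by measurable
    have my: "(\<lambda>y. indicator K y * ennreal (norm (w x y - v x y))) \<in> borel_measurable lborel" for x
      using slice[OF w(1), of x] slice[OF v(1), of x] K by measurable
    have "window_distance B K w v = (\<integral>\<^sup>+x. (\<integral>\<^sup>+y. indicator B x * indicator K y * ennreal (norm (w x y - v x y)) \<partial>lborel) \<partial>lborel)"
      unfolding window_distance_def by (subst lborel.nn_integral_fst[OF m2, symmetric]) simp
    also have "\<dots> = (\<integral>\<^sup>+x. indicator B x * (\<integral>\<^sup>+y. indicator K y * ennreal (norm (w x y - v x y)) \<partial>lborel) \<partial>lborel)"
      by (intro nn_integral_cong) (simp only: mult.assoc nn_integral_cmult[OF my])
    finally have wd: "window_distance B K w v = (\<integral>\<^sup>+x. indicator B x * (\<integral>\<^sup>+y. indicator K y * ennreal (norm (w x y - v x y)) \<partial>lborel) \<partial>lborel)" .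
    have mm: "(\<lambda>x. indicator B x * (\<integral>\<^sup>+y. indicator K y * ennreal (norm (w x y - v x y)) \<partial>lborel)) \<in> borel_measurable lborel"
    proof -
      have "(\<lambda>z. indicator K (snd z) * ennreal (norm (w (fst z) (snd z) - v (fst z) (snd z))))
          \<in> borel_measurable (lborel \<Otimes>\<^sub>M lborel)"
        using w(1) v(1) K unfolding split_beta' by measurable
      from lborel.borel_measurable_nn_integral_fst[OF this] show ?thesis using B by simp
    qed
    show ?thesis
      unfolding wd by (subst nn_integral_cmult[OF mm, symmetric]) (simp only: ac_simps)
  qed
  finally have "ennreal (norm (mecke_rhs B K w - mecke_rhs B K v)) \<le> ennreal lam * (ennreal lam * window_distance B K w v)"
    by (simp add: mult_left_mono)
  also have "\<dots> = ennreal (lam\<^sup>2) * window_distance B K w v"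
    using lam_pos by (simp add: power2_eq_square ennreal_mult mult.assoc)
  finally show ?thesis .
qed

text \<open>Both sides are continuous in the weight for the same distance and agree on a dense
  class.\<close>

lemma mecke_equation:
  fixes w :: "real^2 \<Rightarrow> real^2 \<Rightarrow> complex"
  assumes K: "K \<in> sets borel" "bounded K" and B: "B \<in> sets borel" "B \<subseteq> K"
    and w: "case_prod w \<in> borel_measurable (borel \<Otimes>\<^sub>M borel)" "\<And>x y. norm (w x y) \<le> 1"
  shows "mecke_lhs B K w = mecke_rhs B K w"
proof -
  \<comment> \<open>Lebesgue measure restricted to the windows: the density theorem needs finite
    measures, and the distance for their product is \<open>window_distance\<close>.\<close>
  let ?M1 = "density lborel (indicator B)" and ?M2 = "density lborel (indicator K)"
  have fin: "emeasure lborel B < \<infinity>" "emeasure lborel K < \<infinity>"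
    by (rule emeasure_bounded_finite[OF bounded_subset[OF K(2) B(2)]], rule emeasure_bounded_finite[OF K(2)])
  have fm: "finite_measure ?M1" "finite_measure ?M2"
    using fin K B by (auto intro!: finite_measureI simp: emeasure_density)
  interpret M2: finite_measure ?M2 by (rule fm)
  interpret P: finite_measure "?M1 \<Otimes>\<^sub>M ?M2" by (rule finite_measure_pair_measure[OF fm(2,1)])
  have s: "sets ?M1 = sets borel" "sets ?M2 = sets borel" by simp_all
  have sP: "borel_measurable (?M1 \<Otimes>\<^sub>M ?M2) = (borel_measurable (borel \<Otimes>\<^sub>M borel) :: ((real^2) \<times> (real^2) \<Rightarrow> complex) set)"
    by (intro measurable_cong_sets sets_pair_measure_cong s refl)
  have wP: "case_prod w \<in> borel_measurable (?M1 \<Otimes>\<^sub>M ?M2)" using w(1) by (simp only: sP)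
  \<comment> \<open>The factor 2 counts the two sides, each with Lipschitz constant
    \<open>lam\<^sup>2\<close>.\<close>
  have bound: "norm (mecke_lhs B K w - mecke_rhs B K w) \<le> 2 * lam\<^sup>2 * e" if e: "e > 0" for e
  proof -
    obtain g where g: "fibrewise_simple ?M1 ?M2 g" "\<And>z. norm (g z) \<le> 1"
        "(LINT z|(?M1 \<Otimes>\<^sub>M ?M2). norm (case_prod w z - g z)) < e"
    proof (rule fibrewise_simple_dense[OF fm wP _ e])
      show "norm (case_prod w z) \<le> 1" for z using w(2) by (simp add: split_beta')
    qed (rule that)
    obtain c :: "real^2 \<Rightarrow> nat" and W where cW: "c \<in> measurable ?M1 (count_space UNIV) \<and> finite (range c) \<and>
        (\<forall>k. W k \<in> borel_measurable ?M2) \<and> g = (\<lambda>(x, y). W (c x) y)"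
      using g(1) unfolding fibrewise_simple_def by (elim exE) (rule that)
    then have c: "c \<in> measurable borel (count_space UNIV)" "finite (range c)"
        and W: "\<And>k. W k \<in> borel_measurable borel" and gW: "g = (\<lambda>(x, y). W (c x) y)" by auto
    let ?v = "\<lambda>x. W (c x)"
    have v1: "norm (?v x y) \<le> 1" for x y using g(2)[of "(x, y)"] by (simp add: gW)
    have v: "case_prod ?v \<in> borel_measurable (borel \<Otimes>\<^sub>M borel)"
      using fibrewise_simple_measurable[OF g(1)] by (simp add: gW sP)
    have mgP: "g \<in> borel_measurable (?M1 \<Otimes>\<^sub>M ?M2)" by (rule fibrewise_simple_measurable[OF g(1)])
    have "window_distance B K w ?v = (\<integral>\<^sup>+z. ennreal (norm (case_prod w z - g z)) \<partial>(?M1 \<Otimes>\<^sub>M ?M2))"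
    proof -
      have md: "(\<lambda>z. ennreal (norm (case_prod w z - g z))) \<in> borel_measurable (lborel \<Otimes>\<^sub>M lborel)"
        using w(1) v by (simp add: gW measurable_cong_sets[OF sets_pair_measure_cong[OF sets_lborel sets_lborel] refl])
      have "?M1 \<Otimes>\<^sub>M ?M2 = density (lborel \<Otimes>\<^sub>M lborel) (\<lambda>(x, y). indicator B x * indicator K y)"
        using K B M2.sigma_finite_measure_axioms lborel.sigma_finite_measure_axioms
        by (intro pair_measure_density) auto
      then show ?thesis
        using md K B by (simp add: window_distance_def nn_integral_density split_beta' gW)
    qed
    also have "\<dots> = ennreal (LINT z|(?M1 \<Otimes>\<^sub>M ?M2). norm (case_prod w z - g z))"
    proof (rule nn_integral_eq_integral)
      have "integrable (?M1 \<Otimes>\<^sub>M ?M2) (case_prod w)"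
        using w(2) by (intro P.integrable_const_bound[where B=1] wP) (auto simp: split_beta')
      moreover have "integrable (?M1 \<Otimes>\<^sub>M ?M2) g"
        using g(2) by (intro P.integrable_const_bound[where B=1] mgP) auto
      ultimately show "integrable (?M1 \<Otimes>\<^sub>M ?M2) (\<lambda>z. norm (case_prod w z - g z))"
        by (intro integrable_norm Bochner_Integration.integrable_diff)
    qed simp
    also have "\<dots> \<le> ennreal e" using g(3) by (intro ennreal_leI) simp
    finally have d: "window_distance B K w ?v \<le> ennreal e" .
    have l2: "ennreal (norm a) \<le> ennreal (lam\<^sup>2) * window_distance B K w ?v \<Longrightarrow> norm a \<le> lam\<^sup>2 * e" for a :: complex
    proof -
      assume "ennreal (norm a) \<le> ennreal (lam\<^sup>2) * window_distance B K w ?v"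
      also have "\<dots> \<le> ennreal (lam\<^sup>2) * ennreal e" by (intro mult_left_mono d) simp
      also have "\<dots> = ennreal (lam\<^sup>2 * e)" using e by (simp add: ennreal_mult)
      finally show "norm a \<le> lam\<^sup>2 * e" using e by (simp add: ennreal_le_iff)
    qed
    have "mecke_lhs B K ?v = mecke_rhs B K ?v" by (rule mecke_fibrewise_simple[where W = W and c = c, OF K B c W v1])
    then have "mecke_lhs B K w - mecke_rhs B K w
        = (mecke_lhs B K w - mecke_lhs B K ?v) - (mecke_rhs B K w - mecke_rhs B K ?v)" by simp
    then have "norm (mecke_lhs B K w - mecke_rhs B K w)
        \<le> norm (mecke_lhs B K w - mecke_lhs B K ?v) + norm (mecke_rhs B K w - mecke_rhs B K ?v)"
      by (simp only: norm_triangle_ineq4)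
    also have "\<dots> \<le> lam\<^sup>2 * e + lam\<^sup>2 * e"
      by (intro add_mono l2 mecke_lhs_lipschitz mecke_rhs_lipschitz K B w v v1)
    finally show ?thesis by (simp add: algebra_simps)
  qed
  have "norm (mecke_lhs B K w - mecke_rhs B K w) \<le> 0"
  proof (rule field_le_epsilon)
    fix e :: real assume "e > 0"
    then have "e / (2 * lam\<^sup>2) > 0" using lam_pos by simp
    from bound[OF this] show "norm (mecke_lhs B K w - mecke_rhs B K w) \<le> 0 + e"
      using lam_pos by simp
  qed
  then show ?thesis by simp
qed

end

section \<open>Receivers as independent marks\<close>

definition direction :: "real \<Rightarrow> real^2" where
  "direction \<theta> = vector [cos \<theta>, sin \<theta>]"

lemma direction_nth [simp]: "direction \<theta> $ 1 = cos \<theta>" "direction \<theta> $ 2 = sin \<theta>"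
  by (simp_all add: direction_def vector_2)

lemma norm_direction [simp]: "norm (direction \<theta>) = 1"
  by (simp add: norm_vec_def L2_set_def sum_2)

lemma continuous_direction: "continuous_on UNIV direction"
proof -
  have "direction = (\<lambda>\<theta>. \<chi> i. if i = 1 then cos \<theta> else sin \<theta>)"
  proof
    fix \<theta>
    have "direction \<theta> $ i = (\<chi> i. if i = 1 then cos \<theta> else sin \<theta>) $ i" for i :: 2
      using exhaust_2[of i] by auto
    then show "direction \<theta> = (\<chi> i. if i = 1 then cos \<theta> else sin \<theta>)" by (simp add: vec_eq_iff)
  qed
  moreover have "continuous_on UNIV (\<lambda>\<theta>. if i = (1::2) then cos \<theta> else sin \<theta> :: real)" for i
    by (cases "i = 1") (auto intro!: continuous_intros)
  then have "continuous_on UNIV (\<lambda>\<theta>. (\<chi> i. if i = (1::2) then cos \<theta> else sin \<theta>) :: real^2)"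
    by (rule continuous_on_vec_lambda)
  ultimately show ?thesis by (simp only:)
qed

lemma measurable_direction [measurable]: "direction \<in> borel_measurable borel"
  by (rule borel_measurable_continuous_onI[OF continuous_direction])

abbreviation angle_measure :: "real measure" where
  "angle_measure \<equiv> uniform_measure lborel {0..<2 * pi}"

lemma prob_space_angle_measure: "prob_space angle_measure"
  by (rule prob_space_uniform_measure) (auto simp: emeasure_lborel_Ico)

lemma sets_angle_measure [simp, measurable_cong]: "sets angle_measure = sets borel"
  by simp

locale bipolar = poisson_process M X lam
  for M :: "'w measure" and X :: "nat \<Rightarrow> 'w \<Rightarrow> real^2" and lam :: real +
  fixes \<Theta> :: "nat \<Rightarrow> 'w \<Rightarrow> real" and r :: real
  assumes network: "bipolar_network M lam X \<Theta>" and r_pos: "r > 0"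
begin

sublocale angle: prob_space angle_measure by (rule prob_space_angle_measure)

abbreviation Y :: "nat \<Rightarrow> 'w \<Rightarrow> real^2" where
  "Y \<equiv> receiver r X \<Theta>"

lemma receiver_eq: "Y i \<omega> = X i \<omega> + r *\<^sub>R direction (\<Theta> i \<omega>)"
  by (simp add: receiver_def direction_def)

lemma indep_angles: "indep_vars (\<lambda>_. borel) \<Theta> UNIV"
  using network unfolding bipolar_network_def by (elim conjE)

lemma measurable_angle [measurable]: "\<Theta> i \<in> borel_measurable M"
  using indep_angles by (simp add: indep_vars_def)

lemma distr_angle: "distr M borel (\<Theta> i) = angle_measure"
  using network unfolding bipolar_network_def by (elim conjE) simp

lemma measurable_receiver [measurable]: "Y i \<in> borel_measurable M"
proof -
  have "(\<lambda>\<omega>. X i \<omega> + r *\<^sub>R direction (\<Theta> i \<omega>)) \<in> borel_measurable M"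
    by (intro borel_measurable_add borel_measurable_scaleR borel_measurable_const measurable_point
        measurable_compose[OF measurable_angle measurable_direction])
  then show ?thesis by (simp only: receiver_eq[symmetric])
qed

section \<open>Separating positions from angles\<close>

abbreviation seqs :: "(nat \<Rightarrow> 'b::topological_space) measure" where
  "seqs \<equiv> PiM UNIV (\<lambda>_. borel)"

lemma measurable_X_seq: "(\<lambda>\<omega> i. X i \<omega>) \<in> measurable M seqs"
  by (rule measurable_abs_UNIV) simp

lemma measurable_angle_seq: "(\<lambda>\<omega> i. \<Theta> i \<omega>) \<in> measurable M seqs"
  by (rule measurable_abs_UNIV) simp

lemma measurable_joint: "(\<lambda>\<omega>. (\<lambda>i. X i \<omega>, \<lambda>i. \<Theta> i \<omega>)) \<in> measurable M (seqs \<Otimes>\<^sub>M seqs)"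
  by (rule measurable_Pair[OF measurable_X_seq measurable_angle_seq])

text \<open>Here independence of the two generated sigma-algebras becomes a product law on sequence
  space.\<close>

lemma joint_distr:
  "distr M seqs (\<lambda>\<omega> i. X i \<omega>) \<Otimes>\<^sub>M distr M seqs (\<lambda>\<omega> i. \<Theta> i \<omega>)
    = distr M (seqs \<Otimes>\<^sub>M seqs) (\<lambda>\<omega>. (\<lambda>i. X i \<omega>, \<lambda>i. \<Theta> i \<omega>))"
proof (rule pair_measure_eqI)
  let ?X = "\<lambda>\<omega> i. X i \<omega>" and ?T = "\<lambda>\<omega> i. \<Theta> i \<omega>"
  show "sigma_finite_measure (distr M seqs ?X)" "sigma_finite_measure (distr M seqs ?T)"
    by (intro prob_space_imp_sigma_finite prob_space_distr measurable_X_seq measurable_angle_seq)+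
  show "sets (distr M seqs ?X \<Otimes>\<^sub>M distr M seqs ?T)
      = sets (distr M (seqs \<Otimes>\<^sub>M seqs) (\<lambda>\<omega>. (?X \<omega>, ?T \<omega>)))"
    unfolding sets_distr by (intro sets_pair_measure_cong sets_distr)
  fix A B assume "A \<in> sets (distr M seqs ?X)" "B \<in> sets (distr M seqs ?T)"
  then have AB: "A \<in> sets seqs" "B \<in> sets seqs" by simp_all
  have "indep_set (sets (vimage_algebra (space M) ?X seqs)) (sets (vimage_algebra (space M) ?T seqs))"
    using network unfolding bipolar_network_def by (elim conjE)
  moreover have "?X -` A \<inter> space M \<in> sets (vimage_algebra (space M) ?X seqs)"
    "?T -` B \<inter> space M \<in> sets (vimage_algebra (space M) ?T seqs)"
    by (intro in_vimage_algebra AB)+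
  ultimately have "prob ((?X -` A \<inter> space M) \<inter> (?T -` B \<inter> space M))
      = prob (?X -` A \<inter> space M) * prob (?T -` B \<inter> space M)"
    by (rule indep_setD)
  moreover have "(\<lambda>\<omega>. (?X \<omega>, ?T \<omega>)) -` (A \<times> B) \<inter> space M = (?X -` A \<inter> space M) \<inter> (?T -` B \<inter> space M)"
    by auto
  ultimately show "emeasure (distr M seqs ?X) A * emeasure (distr M seqs ?T) B
      = emeasure (distr M (seqs \<Otimes>\<^sub>M seqs) (\<lambda>\<omega>. (?X \<omega>, ?T \<omega>))) (A \<times> B)"
    using AB by (simp add: emeasure_distr measurable_X_seq measurable_angle_seq measurable_joint
        emeasure_eq_measure ennreal_mult[symmetric])
qed

text \<open>Under the product law the angles may be taken from an independent outcome \<omega>', so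
  that the positions are frozen in the inner integral.\<close>

lemma nn_integral_decouple:
  assumes F: "F \<in> borel_measurable (seqs \<Otimes>\<^sub>M seqs)"
  shows "(\<integral>\<^sup>+\<omega>. F (\<lambda>i. X i \<omega>, \<lambda>i. \<Theta> i \<omega>) \<partial>M) = (\<integral>\<^sup>+\<omega>. (\<integral>\<^sup>+\<omega>'. F (\<lambda>i. X i \<omega>, \<lambda>i. \<Theta> i \<omega>') \<partial>M) \<partial>M)"
proof -
  let ?A = "distr M seqs (\<lambda>\<omega> i. X i \<omega>)" and ?B = "distr M seqs (\<lambda>\<omega> i. \<Theta> i \<omega>)"
  interpret B: prob_space ?B by (rule prob_space_distr[OF measurable_angle_seq])
  have F': "F \<in> borel_measurable (?A \<Otimes>\<^sub>M ?B)"
    using F by (simp cong: measurable_cong_sets)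
  have "(\<integral>\<^sup>+\<omega>. F (\<lambda>i. X i \<omega>, \<lambda>i. \<Theta> i \<omega>) \<partial>M) = (\<integral>\<^sup>+z. F z \<partial>(?A \<Otimes>\<^sub>M ?B))"
    unfolding joint_distr using F by (intro nn_integral_distr[symmetric] measurable_joint) simp
  also have "\<dots> = (\<integral>\<^sup>+x. (\<integral>\<^sup>+t. F (x, t) \<partial>?B) \<partial>?A)"
    by (rule B.nn_integral_fst[OF F', symmetric])
  also have "\<dots> = (\<integral>\<^sup>+\<omega>. (\<integral>\<^sup>+t. F (\<lambda>i. X i \<omega>, t) \<partial>?B) \<partial>M)"
    using B.borel_measurable_nn_integral_fst[OF F'] by (subst nn_integral_distr[OF measurable_X_seq]) auto
  also have "\<dots> = (\<integral>\<^sup>+\<omega>. (\<integral>\<^sup>+\<omega>'. F (\<lambda>i. X i \<omega>, \<lambda>i. \<Theta> i \<omega>') \<partial>M) \<partial>M)"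
  proof (rule nn_integral_cong)
    fix \<omega>
    have "(\<lambda>t. F (\<lambda>i. X i \<omega>, t)) \<in> borel_measurable seqs"
      by (rule measurable_compose[OF measurable_Pair1' F]) (simp add: space_PiM)
    then show "(\<integral>\<^sup>+t. F (\<lambda>i. X i \<omega>, t) \<partial>?B) = (\<integral>\<^sup>+\<omega>'. F (\<lambda>i. X i \<omega>, \<lambda>i. \<Theta> i \<omega>') \<partial>M)"
      by (intro nn_integral_distr measurable_angle_seq) simp
  qed
  finally show ?thesis .
qed

lemma integral_decouple:
  fixes F :: "_ \<Rightarrow> complex"
  assumes F: "F \<in> borel_measurable (seqs \<Otimes>\<^sub>M seqs)" and b: "\<And>z. norm (F z) \<le> b"
  shows "(LINT \<omega>|M. F (\<lambda>i. X i \<omega>, \<lambda>i. \<Theta> i \<omega>)) = (LINT \<omega>|M. (LINT \<omega>'|M. F (\<lambda>i. X i \<omega>, \<lambda>i. \<Theta> i \<omega>')))"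
proof -
  let ?A = "distr M seqs (\<lambda>\<omega> i. X i \<omega>)" and ?B = "distr M seqs (\<lambda>\<omega> i. \<Theta> i \<omega>)"
  interpret A: prob_space ?A by (rule prob_space_distr[OF measurable_X_seq])
  interpret B: prob_space ?B by (rule prob_space_distr[OF measurable_angle_seq])
  interpret AB: pair_prob_space ?A ?B ..
  have F': "F \<in> borel_measurable (?A \<Otimes>\<^sub>M ?B)"
    using F by (simp cong: measurable_cong_sets)
  have int: "integrable (?A \<Otimes>\<^sub>M ?B) F"
    using b by (intro AB.integrable_const_bound[where B=b] F') auto
  have "(LINT \<omega>|M. F (\<lambda>i. X i \<omega>, \<lambda>i. \<Theta> i \<omega>)) = (LINT z|(?A \<Otimes>\<^sub>M ?B). F z)"
    unfolding joint_distr by (rule integral_distr[OF measurable_joint F, symmetric])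
  also have "\<dots> = (LINT x|?A. (LINT t|?B. F (x, t)))"
    by (rule AB.integral_fst'[OF int, symmetric])
  also have "\<dots> = (LINT \<omega>|M. (LINT t|?B. F (\<lambda>i. X i \<omega>, t)))"
    using AB.integrable_fst'[OF int] by (subst integral_distr[OF measurable_X_seq]) auto
  also have "\<dots> = (LINT \<omega>|M. (LINT \<omega>'|M. F (\<lambda>i. X i \<omega>, \<lambda>i. \<Theta> i \<omega>')))"
  proof (rule Bochner_Integration.integral_cong[OF refl])
    fix \<omega>
    have "(\<lambda>t. F (\<lambda>i. X i \<omega>, t)) \<in> borel_measurable seqs"
      by (rule measurable_compose[OF measurable_Pair1' F]) (simp add: space_PiM)
    then show "(LINT t|?B. F (\<lambda>i. X i \<omega>, t)) = (LINT \<omega>'|M. F (\<lambda>i. X i \<omega>, \<lambda>i. \<Theta> i \<omega>'))"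
      by (rule integral_distr[OF measurable_angle_seq])
  qed
  finally show ?thesis .
qed

text \<open>The sum lives in \<^typ>\<open>ennreal\<close>, since a divergent \<^const>\<open>infsum\<close> would be 0.\<close>

definition shot :: "nat set \<Rightarrow> (real^2 \<Rightarrow> real) \<Rightarrow> real^2 \<Rightarrow> (nat \<Rightarrow> real^2) \<Rightarrow> (nat \<Rightarrow> real) \<Rightarrow> ennreal" where
  "shot J g a x t = (\<Sum>j. ennreal (indicator J j * g (x j + r *\<^sub>R direction (t j) - a)))"

lemma infsum_eq_shot:
  assumes "\<And>z. 0 \<le> g z"
  shows "infsum (\<lambda>j. g (Y j \<omega> - a)) J = enn2real (shot J g a (\<lambda>j. X j \<omega>) (\<lambda>j. \<Theta> j \<omega>))"
  unfolding shot_def receiver_eq by (rule infsum_eq_enn2real_suminf) (rule assms)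

lemma measurable_seq_component: "(\<lambda>x. x i) \<in> measurable (seqs :: (nat \<Rightarrow> 'b::topological_space) measure) borel"
  by (rule measurable_component_singleton) simp

lemma measurable_shot:
  assumes g: "g \<in> borel_measurable borel" and a: "a \<in> borel_measurable seqs"
  shows "(\<lambda>z. shot J g (a (fst z)) (fst z) (snd z)) \<in> borel_measurable (seqs \<Otimes>\<^sub>M seqs)"
proof -
  note [measurable] = g a measurable_compose[OF measurable_fst measurable_seq_component]
    measurable_compose[OF measurable_snd measurable_seq_component]
    measurable_compose[OF measurable_compose[OF measurable_snd measurable_seq_component] measurable_direction]
  show ?thesis unfolding shot_def by measurable
qed

text \<open>The Laplace factor contributed by one receiver, given that its transmitter is at
  \<open>z\<close>.\<close>

definition mark_average :: "complex \<Rightarrow> (real^2 \<Rightarrow> real) \<Rightarrow> real^2 \<Rightarrow> complex" where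
  "mark_average s g z = (LINT t|angle_measure. exp (- s * of_real (g (z + r *\<^sub>R direction t))))"

lemma norm_exp_le_one: "Re s \<ge> 0 \<Longrightarrow> x \<ge> 0 \<Longrightarrow> norm (exp (- s * of_real x)) \<le> 1"
  by (simp add: norm_exp_eq_Re)

text \<open>With frozen positions only transmitters in \<open>K\<close> can have a receiver in the
  support of the gain around the centre, since a receiver lies at distance \<open>r\<close> from its
  transmitter. The exponential is thus a finite product in independent angles and its expectation
  factors. The centre \<open>a\<close> may depend on the transmitters; the factor
  \<open>\<phi>\<close> confines it to a region where one bounded \<open>K\<close> serves for all
  outcomes.\<close>

lemma marks_integral:
  fixes \<phi> :: "(nat \<Rightarrow> real^2) \<Rightarrow> complex"
  assumes g: "g \<in> borel_measurable borel" "\<And>z. 0 \<le> g z" "\<And>z. \<rho> < norm z \<Longrightarrow> g z = 0"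
    and s: "Re s \<ge> 0"
    and a: "a \<in> borel_measurable seqs"
    and \<phi>: "\<phi> \<in> borel_measurable seqs" "\<And>x. norm (\<phi> x) \<le> 1"
    and K: "bounded K" "\<And>x. \<phi> x \<noteq> 0 \<Longrightarrow> cball (a x) (\<rho> + r) \<subseteq> K"
  shows "(LINT \<omega>|M. \<phi> (\<lambda>i. X i \<omega>) * exp (- s * of_real (infsum (\<lambda>j. g (Y j \<omega> - a (\<lambda>i. X i \<omega>))) J)))
    = (LINT \<omega>|M. \<phi> (\<lambda>i. X i \<omega>) * (\<Prod>j | X j \<omega> \<in> K \<and> j \<in> J. mark_average s g (X j \<omega> - a (\<lambda>i. X i \<omega>))))"
proof -
  define F where "F z = \<phi> (fst z) * exp (- s * of_real (enn2real (shot J g (a (fst z)) (fst z) (snd z))))" for z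
  have F: "F \<in> borel_measurable (seqs \<Otimes>\<^sub>M seqs)"
    unfolding F_def using measurable_shot[OF g(1) a] measurable_compose[OF measurable_fst \<phi>(1)] by measurable
  have nF: "norm (F z) \<le> 1" for z
  proof -
    have "norm (F z) \<le> 1 * 1"
      unfolding F_def norm_mult by (intro mult_mono \<phi> norm_exp_le_one s) auto
    then show ?thesis by simp
  qed
  have "(LINT \<omega>|M. \<phi> (\<lambda>i. X i \<omega>) * exp (- s * of_real (infsum (\<lambda>j. g (Y j \<omega> - a (\<lambda>i. X i \<omega>))) J)))
      = (LINT \<omega>|M. F (\<lambda>i. X i \<omega>, \<lambda>i. \<Theta> i \<omega>))"
    by (intro Bochner_Integration.integral_cong refl)
      (simp only: F_def fst_conv snd_conv, subst infsum_eq_shot, rule g(2), rule refl)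
  also have "\<dots> = (LINT \<omega>|M. (LINT \<omega>'|M. F (\<lambda>i. X i \<omega>, \<lambda>i. \<Theta> i \<omega>')))"
    by (rule integral_decouple[OF F nF])
  also have "\<dots> = (LINT \<omega>|M. \<phi> (\<lambda>i. X i \<omega>) * (\<Prod>j | X j \<omega> \<in> K \<and> j \<in> J. mark_average s g (X j \<omega> - a (\<lambda>i. X i \<omega>))))"
  proof (rule Bochner_Integration.integral_cong[OF refl])
    fix \<omega> assume \<omega>: "\<omega> \<in> space M"
    let ?x = "\<lambda>i. X i \<omega>"
    let ?J = "{j. X j \<omega> \<in> K \<and> j \<in> J}"
    show "(LINT \<omega>'|M. F (?x, \<lambda>i. \<Theta> i \<omega>')) = \<phi> ?x * (\<Prod>j\<in>?J. mark_average s g (X j \<omega> - a ?x))"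
    proof (cases "\<phi> ?x = 0")
      case False
      have fin: "finite ?J" by (rule finite_subset[OF _ finite_points[OF \<omega> K(1)]]) auto
      let ?e = "\<lambda>j t. exp (- s * of_real (g (X j \<omega> - a ?x + r *\<^sub>R direction t)))"
      have me: "?e j \<in> borel_measurable borel" for j using g(1) by measurable
      \<comment> \<open>Beyond distance \<rho> + r from the centre no choice of angle brings the
        receiver within \<rho>.\<close>
      have zero: "g (X j \<omega> + r *\<^sub>R direction t - a ?x) = 0" if "X j \<omega> \<notin> K" for j t
      proof (rule g(3))
        have "X j \<omega> \<notin> cball (a ?x) (\<rho> + r)" using that K(2)[OF False] by blast
        then have "\<rho> + r < norm (X j \<omega> - a ?x)" by (simp add: dist_norm norm_minus_commute)
        moreover have "norm (X j \<omega> - a ?x) \<le> norm (X j \<omega> + r *\<^sub>R direction t - a ?x) + norm (r *\<^sub>R direction t)"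
          using norm_triangle_ineq4[of "X j \<omega> + r *\<^sub>R direction t - a ?x" "r *\<^sub>R direction t"] by (simp add: algebra_simps)
        ultimately show "\<rho> < norm (X j \<omega> + r *\<^sub>R direction t - a ?x)" using r_pos by simp
      qed
      have "enn2real (shot J g (a ?x) ?x t) = (\<Sum>j\<in>?J. g (X j \<omega> - a ?x + r *\<^sub>R direction (t j)))" for t
      proof -
        have "enn2real (shot J g (a ?x) ?x t) = infsum (\<lambda>j. g (X j \<omega> + r *\<^sub>R direction (t j) - a ?x)) J"
          unfolding shot_def by (rule infsum_eq_enn2real_suminf[symmetric]) (rule g(2))
        also have "\<dots> = infsum (\<lambda>j. g (X j \<omega> + r *\<^sub>R direction (t j) - a ?x)) ?J"
          by (rule infsum_cong_neutral) (auto simp: zero)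
        also have "\<dots> = (\<Sum>j\<in>?J. g (X j \<omega> - a ?x + r *\<^sub>R direction (t j)))"
          using fin by (simp add: algebra_simps)
        finally show ?thesis .
      qed
      then have "F (?x, t) = \<phi> ?x * (\<Prod>j\<in>?J. ?e j (t j))" for t
        using fin by (simp only: F_def fst_conv snd_conv of_real_sum sum_distrib_left exp_sum)
      then have "(LINT \<omega>'|M. F (?x, \<lambda>i. \<Theta> i \<omega>')) = (LINT \<omega>'|M. \<phi> ?x * (\<Prod>j\<in>?J. ?e j (\<Theta> j \<omega>')))"
        by (simp only:)
      also have "\<dots> = \<phi> ?x * (LINT \<omega>'|M. (\<Prod>j\<in>?J. ?e j (\<Theta> j \<omega>')))" by simp
      also have "(LINT \<omega>'|M. (\<Prod>j\<in>?J. ?e j (\<Theta> j \<omega>'))) = (\<Prod>j\<in>?J. LINT \<omega>'|M. ?e j (\<Theta> j \<omega>'))"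
      proof (rule indep_vars_lebesgue_integral[OF fin])
        show "indep_vars (\<lambda>_. borel) (\<lambda>j \<omega>'. ?e j (\<Theta> j \<omega>')) ?J"
          by (rule indep_vars_compose2[OF indep_vars_subset[OF indep_angles]]) (rule subset_UNIV, rule me)
        show "integrable M (\<lambda>\<omega>'. ?e j (\<Theta> j \<omega>'))" for j
          by (intro integrable_const_bound[where B=1] AE_I2 norm_exp_le_one s g(2))
            (rule measurable_compose[OF measurable_angle me])
      qed
      also have "\<dots> = (\<Prod>j\<in>?J. mark_average s g (X j \<omega> - a ?x))"
      proof (intro prod.cong refl)
        fix j
        have "(LINT \<omega>'|M. ?e j (\<Theta> j \<omega>')) = (LINT t|distr M borel (\<Theta> j). ?e j t)"
          by (rule integral_distr[OF measurable_angle me, symmetric])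
        then show "(LINT \<omega>'|M. ?e j (\<Theta> j \<omega>')) = mark_average s g (X j \<omega> - a ?x)"
          by (simp only: distr_angle mark_average_def)
      qed
      finally show ?thesis .
    qed (simp add: F_def)
  qed
  finally show ?thesis .
qed

lemma norm_mark_average_le_one:
  assumes "g \<in> borel_measurable borel" "\<And>z. 0 \<le> g z" "Re s \<ge> 0"
  shows "norm (mark_average s g z) \<le> 1"
proof -
  have "norm (mark_average s g z) \<le> (LINT t|angle_measure. norm (exp (- s * of_real (g (z + r *\<^sub>R direction t)))))"
    unfolding mark_average_def by (rule integral_norm_bound)
  also have "\<dots> \<le> (LINT t|angle_measure. 1)"
    using assms by (intro integral_mono angle.integrable_const_bound[where B=1] norm_exp_le_one) (auto intro!: norm_exp_le_one)
  finally show ?thesis by (simp add: angle.prob_space)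
qed

lemma measurable_mark_average:
  assumes g: "g \<in> borel_measurable borel"
  shows "mark_average s g \<in> borel_measurable borel"
proof -
  have "case_prod (\<lambda>z t. exp (- s * of_real (g (z + r *\<^sub>R direction t)))) \<in> borel_measurable (borel \<Otimes>\<^sub>M angle_measure)"
    using g unfolding split_beta' by measurable
  then show ?thesis unfolding mark_average_def[abs_def] by (rule angle.borel_measurable_lebesgue_integral)
qed

text \<open>For each angle the displacement is a translation, which preserves Lebesgue measure; by
  Fubini averaging over angles does not change the integral. The centre disappears for the same
  reason, and \<open>K\<close> because the integrand vanishes outside it.\<close>

lemma mark_average_translate:
  assumes g: "g \<in> borel_measurable borel" "\<And>z. 0 \<le> g z" "\<And>z. \<rho> < norm z \<Longrightarrow> g z = 0"
    and s: "Re s \<ge> 0" and K: "cball a (\<rho> + r) \<subseteq> K"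
  shows "(LINT x:K|lborel. 1 - mark_average s g (x - a)) = (LINT z|lborel. 1 - exp (- s * of_real (g z)))"
proof -
  let ?f = "\<lambda>z. 1 - exp (- s * of_real (g z))"
  have mf: "?f \<in> borel_measurable borel" using g(1) by measurable
  have nf: "norm (?f z) \<le> 2" for z
  proof -
    have "norm (?f z) \<le> norm (1::complex) + norm (exp (- s * of_real (g z)))" by (rule norm_triangle_ineq4)
    also have "\<dots> \<le> 1 + 1" by (intro add_mono norm_exp_le_one s g(2)) simp
    finally show ?thesis by simp
  qed
  have avg: "1 - mark_average s g z = (LINT t|angle_measure. ?f (z + r *\<^sub>R direction t))" for z
  proof -
    have "integrable angle_measure (\<lambda>t. exp (- s * of_real (g (z + r *\<^sub>R direction t))))"
    proof (intro angle.integrable_const_bound[where B=1] AE_I2 norm_exp_le_one s g(2))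
      have "(\<lambda>t. g (z + r *\<^sub>R direction t)) \<in> borel_measurable borel"
        by (rule measurable_compose[OF _ g(1)]) measurable
      then show "(\<lambda>t. exp (- s * of_real (g (z + r *\<^sub>R direction t)))) \<in> borel_measurable angle_measure"
        by measurable
    qed
    then show ?thesis
      unfolding mark_average_def by (subst Bochner_Integration.integral_diff) (auto simp: angle.prob_space)
  qed
  have zero: "?f (z + r *\<^sub>R direction t) = 0" if "\<rho> + r < norm z" for z t
  proof -
    have "norm z \<le> norm (z + r *\<^sub>R direction t) + norm (r *\<^sub>R direction t)"
      using norm_triangle_ineq4[of "z + r *\<^sub>R direction t" "r *\<^sub>R direction t"] by simp
    then have "\<rho> < norm (z + r *\<^sub>R direction t)" using that r_pos by simp
    then show ?thesis by (simp add: g(3))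
  qed
  have "(LINT x:K|lborel. 1 - mark_average s g (x - a)) = (LINT x|lborel. 1 - mark_average s g (x - a))"
    unfolding set_lebesgue_integral_def
  proof (rule Bochner_Integration.integral_cong[OF refl])
    fix x
    have "1 - mark_average s g (x - a) = 0" if "x \<notin> K"
    proof -
      have *: "\<rho> + r < norm (x - a)" using that K by (auto simp: subset_iff dist_norm norm_minus_commute not_le)
      show ?thesis unfolding avg by (simp only: zero[OF *] Bochner_Integration.integral_zero)
    qed
    then show "indicator K x *\<^sub>R (1 - mark_average s g (x - a)) = 1 - mark_average s g (x - a)"
      by (auto simp: indicator_def)
  qed
  also have "\<dots> = (LINT z|lborel. 1 - mark_average s g z)"
  proof -
    have "(LINT z|lborel. 1 - mark_average s g z) = (LINT z|distr lborel borel ((+) (- a)). 1 - mark_average s g z)"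
      by (simp only: lborel_distr_plus)
    also have "\<dots> = (LINT x|lborel. 1 - mark_average s g (- a + x))"
      using measurable_mark_average[OF g(1)] by (intro integral_distr) auto
    finally show ?thesis by (simp add: algebra_simps)
  qed
  also have "\<dots> = (LINT z|lborel. (LINT t|angle_measure. ?f (z + r *\<^sub>R direction t)))"
    by (simp only: avg)
  also have "\<dots> = (LINT t|angle_measure. (LINT z|lborel. ?f (z + r *\<^sub>R direction t)))"
  proof -
    interpret P: pair_sigma_finite lborel angle_measure
      by (intro pair_sigma_finite.intro lborel.sigma_finite_measure_axioms angle.sigma_finite_measure_axioms)
    \<comment> \<open>The integrand is bounded by 2 and supported in a ball times the probability
      space of angles, hence in a set of finite measure.\<close>
    have "integrable (lborel \<Otimes>\<^sub>M angle_measure) (case_prod (\<lambda>z t. ?f (z + r *\<^sub>R direction t)))"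
    proof (rule integrableI_bounded_set[where A = "cball 0 (\<rho> + r) \<times> UNIV" and B = 2])
      show "cball 0 (\<rho> + r) \<times> UNIV \<in> sets (lborel \<Otimes>\<^sub>M angle_measure)" by (intro pair_measureI) auto
      show "case_prod (\<lambda>z t. ?f (z + r *\<^sub>R direction t)) \<in> borel_measurable (lborel \<Otimes>\<^sub>M angle_measure)"
        using mf unfolding split_beta' by measurable
      have "emeasure (lborel \<Otimes>\<^sub>M angle_measure) (cball (0::real^2) (\<rho> + r) \<times> UNIV)
          = emeasure lborel (cball (0::real^2) (\<rho> + r)) * emeasure angle_measure UNIV"
        by (rule angle.emeasure_pair_measure_Times) auto
      also have "\<dots> < \<infinity>"
        using emeasure_bounded_finite[OF bounded_cball[of "0::real^2" "\<rho> + r"]] angle.emeasure_space_1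
        by (simp add: space_uniform_measure)
      finally show "emeasure (lborel \<Otimes>\<^sub>M angle_measure) (cball (0::real^2) (\<rho> + r) \<times> UNIV) < \<infinity>" .
      show "AE z\<in>cball 0 (\<rho> + r) \<times> UNIV in lborel \<Otimes>\<^sub>M angle_measure.
          norm (case_prod (\<lambda>z t. ?f (z + r *\<^sub>R direction t)) z) \<le> 2"
        by (intro AE_I2 impI) (simp only: split_beta' nf)
      have "case_prod (\<lambda>z t. ?f (z + r *\<^sub>R direction t)) z = 0" if "z \<notin> cball 0 (\<rho> + r) \<times> UNIV" for z
      proof -
        have "\<rho> + r < norm (fst z)" using that by (cases z) auto
        then show ?thesis by (simp only: split_beta' zero)
      qed
      then show "AE z in lborel \<Otimes>\<^sub>M angle_measure. z \<notin> cball 0 (\<rho> + r) \<times> UNIV \<longrightarrow>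
          case_prod (\<lambda>z t. ?f (z + r *\<^sub>R direction t)) z = 0"
        by (intro AE_I2 impI)
    qed
    from P.Fubini_integral[OF this] show ?thesis by simp
  qed
  also have "\<dots> = (LINT t|angle_measure. (LINT z|lborel. ?f z))"
  proof (rule Bochner_Integration.integral_cong[OF refl])
    fix t
    have "(LINT z|lborel. ?f z) = (LINT z|distr lborel borel ((+) (r *\<^sub>R direction t)). ?f z)"
      by (simp only: lborel_distr_plus)
    also have "\<dots> = (LINT z|lborel. ?f (r *\<^sub>R direction t + z))"
      using mf by (intro integral_distr) auto
    finally show "(LINT z|lborel. ?f (z + r *\<^sub>R direction t)) = (LINT z|lborel. ?f z)"
      by (simp only: add.commute)
  qed
  also have "\<dots> = (LINT z|lborel. ?f z)" using angle.prob_space by simp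
  finally show ?thesis .
qed

end

lemma nn_integral_lborel_translate:
  fixes q :: "real^2 \<Rightarrow> ennreal"
  assumes "q \<in> borel_measurable borel"
  shows "(\<integral>\<^sup>+z. q (z + a) \<partial>lborel) = (\<integral>\<^sup>+z. q z \<partial>lborel)"
proof -
  have "(\<integral>\<^sup>+z. q z \<partial>lborel) = (\<integral>\<^sup>+z. q z \<partial>distr lborel borel ((+) a))" by (simp only: lborel_distr_plus)
  also have "\<dots> = (\<integral>\<^sup>+z. q (a + z) \<partial>lborel)" using assms by (intro nn_integral_distr) auto
  finally show ?thesis by (simp only: add.commute)
qed

context bipolar begin

section \<open>Laplace transforms for gains of bounded support\<close>

lemma laplace_receivers_bounded_support:
  assumes g: "g \<in> borel_measurable borel" "\<And>z. 0 \<le> g z" "\<And>z. \<rho> < norm z \<Longrightarrow> g z = 0"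
    and s: "Re s \<ge> 0"
  shows "(LINT \<omega>|M. exp (- s * of_real (infsum (\<lambda>j. g (Y j \<omega> - 0)) UNIV)))
    = exp (- of_real lam * (LINT z|lborel. 1 - exp (- s * of_real (g z))))"
proof -
  let ?K = "cball (0::real^2) (\<rho> + r)"
  have "(LINT \<omega>|M. 1 * exp (- s * of_real (infsum (\<lambda>j. g (Y j \<omega> - 0)) UNIV)))
      = (LINT \<omega>|M. 1 * (\<Prod>j | X j \<omega> \<in> ?K \<and> j \<in> UNIV. mark_average s g (X j \<omega> - 0)))"
    by (rule marks_integral[where \<phi> = "\<lambda>_. 1" and a = "\<lambda>_. 0" and \<rho> = \<rho>, OF g s]) auto
  also have "\<dots> = (LINT \<omega>|M. (\<Prod>j | X j \<omega> \<in> ?K. mark_average s g (X j \<omega>)))" by simp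
  also have "\<dots> = exp (- of_real lam * (LINT x:?K|lborel. 1 - mark_average s g x))"
    using g(1,2) s by (intro laplace_functional measurable_mark_average norm_mark_average_le_one) auto
  also have "(LINT x:?K|lborel. 1 - mark_average s g x) = (LINT z|lborel. 1 - exp (- s * of_real (g z)))"
    using mark_average_translate[where a = 0 and K = ?K, OF g s] by simp
  finally show ?thesis by simp
qed

lemma measurable_interference:
  fixes g :: "real^2 \<Rightarrow> real"
  assumes g: "g \<in> borel_measurable borel" "\<And>z. 0 \<le> g z" and a: "a \<in> borel_measurable seqs"
  shows "(\<lambda>\<omega>. infsum (\<lambda>j. g (Y j \<omega> - a (\<lambda>i. X i \<omega>))) J) \<in> borel_measurable M"
proof -
  have "(\<lambda>\<omega>. shot J g (a (\<lambda>i. X i \<omega>)) (\<lambda>i. X i \<omega>) (\<lambda>i. \<Theta> i \<omega>)) \<in> borel_measurable M"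
    using measurable_compose[OF measurable_joint measurable_shot[OF g(1) a]] by simp
  then show ?thesis by (subst infsum_eq_shot[OF g(2)]) measurable
qed

text \<open>The interference observed by transmitter \<open>i\<close> in its own coordinates,
  without its own receiver: the counterpart under the Palm distribution of the interference at the
  origin.\<close>

definition reduced :: "(real^2 \<Rightarrow> real) \<Rightarrow> nat \<Rightarrow> 'w \<Rightarrow> real" where
  "reduced g i \<omega> = infsum (\<lambda>j. g (Y j \<omega> - X i \<omega>)) (- {i})"

lemma measurable_reduced:
  assumes "g \<in> borel_measurable borel" "\<And>z. 0 \<le> g z"
  shows "reduced g i \<in> borel_measurable M"
  unfolding reduced_def[abs_def]
  by (rule measurable_interference[OF assms measurable_seq_component])

lemma reduced_nonneg: "(\<And>z. 0 \<le> g z) \<Longrightarrow> 0 \<le> reduced g i \<omega>"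
  unfolding reduced_def by (rule infsum_nonneg) simp

text \<open>For each fixed \<open>i\<close> the angles are averaged out, which leaves a product with
  weight \<open>mark_average s g (y - x)\<close> over the other transmitters. The Mecke equation
  applies, and by translation invariance its inner integral does not depend on \<open>x\<close>, so
  the window enters only through its area.\<close>

lemma palm_laplace_bounded_support:
  assumes g: "g \<in> borel_measurable borel" "\<And>z. 0 \<le> g z" "\<And>z. \<rho> < norm z \<Longrightarrow> g z = 0"
    and s: "Re s \<ge> 0" and \<rho>: "\<rho> \<ge> 0" and B: "B \<in> sets borel" "bounded B"
  shows "(LINT p|campbell. indicator B (X (fst p) (snd p)) *\<^sub>R exp (- s * of_real (reduced g (fst p) (snd p))))
    = of_real (lam * measure lborel B) * exp (- of_real lam * (LINT z|lborel. 1 - exp (- s * of_real (g z))))"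
proof -
  obtain b where b: "b > 0" "\<And>x. x \<in> B \<Longrightarrow> norm x \<le> b" using B(2) by (auto simp: bounded_pos)
  \<comment> \<open>\<open>b\<close> covers the window, \<rho> the support of the gain and
    \<open>r\<close> the offset of a receiver from its transmitter.\<close>
  let ?K = "cball (0::real^2) (b + (\<rho> + r))"
  let ?w = "\<lambda>x y. mark_average s g (y - x)"
  have K: "?K \<in> sets borel" "bounded ?K" by auto
  have BK: "B \<subseteq> ?K" using b \<rho> r_pos by force
  have sub: "cball x (\<rho> + r) \<subseteq> ?K" if "x \<in> B" for x
    using b(2)[OF that] norm_triangle_le[of x _ "b + (\<rho> + r)"]
    by (intro cball_subset_cball_iff[THEN iffD2] disjI1) (simp add: dist_norm)
  have mw: "case_prod ?w \<in> borel_measurable (borel \<Otimes>\<^sub>M borel)"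
    unfolding split_beta' by (rule measurable_compose[OF _ measurable_mark_average[OF g(1)]]) measurable
  have nw: "norm (?w x y) \<le> 1" for x y by (rule norm_mark_average_le_one[OF g(1,2) s])
  let ?f1 = "\<lambda>p. indicator B (X (fst p) (snd p)) *\<^sub>R exp (- s * of_real (reduced g (fst p) (snd p)))"
  let ?f2 = "\<lambda>p. indicator B (X (fst p) (snd p)) *\<^sub>R (\<Prod>j | X j (snd p) \<in> ?K \<and> j \<noteq> fst p. ?w (X (fst p) (snd p)) (X j (snd p)))"
  have i1: "integrable campbell ?f1"
  proof (rule campbell_window_integral(1)[OF B])
    show "(\<lambda>\<omega>. exp (- s * of_real (reduced g i \<omega>))) \<in> borel_measurable M" for i
      using measurable_reduced[OF g(1,2), of i] by measurable
    show "norm (exp (- s * of_real (reduced g i \<omega>))) \<le> 1" for i \<omega>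
      by (intro norm_exp_le_one s reduced_nonneg g(2))
  qed
  have i2: "integrable campbell ?f2" by (rule integrable_mecke[OF K B(1) BK mw nw])
  have eq: "(LINT \<omega>|M. ?f1 (i, \<omega>)) = (LINT \<omega>|M. ?f2 (i, \<omega>))" for i
  proof -
    \<comment> \<open>The indicator of the window is the factor that keeps the random centre
      \<open>X i\<close> bounded.\<close>
    let ?\<phi> = "\<lambda>x::nat \<Rightarrow> real^2. complex_of_real (indicator B (x i))"
    have "(LINT \<omega>|M. ?\<phi> (\<lambda>i. X i \<omega>) * exp (- s * of_real (infsum (\<lambda>j. g (Y j \<omega> - (\<lambda>x. x i) (\<lambda>i. X i \<omega>))) (- {i}))))
        = (LINT \<omega>|M. ?\<phi> (\<lambda>i. X i \<omega>) * (\<Prod>j | X j \<omega> \<in> ?K \<and> j \<in> - {i}. mark_average s g (X j \<omega> - (\<lambda>x. x i) (\<lambda>i. X i \<omega>))))"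
    proof (rule marks_integral[OF g s measurable_seq_component])
      have "(\<lambda>y. complex_of_real (indicator B y)) \<in> borel_measurable borel" using B by measurable
      then show "?\<phi> \<in> borel_measurable seqs" by (rule measurable_compose[OF measurable_seq_component])
      show "norm (?\<phi> x) \<le> 1" for x by (simp add: indicator_def)
      show "bounded ?K" by simp
      show "cball (x i) (\<rho> + r) \<subseteq> ?K" if "?\<phi> x \<noteq> 0" for x
        using that by (intro sub) (auto simp: indicator_def split: if_splits)
    qed
    then show ?thesis by (simp add: reduced_def scaleR_conv_of_real)
  qed
  have "(LINT p|campbell. ?f1 p) = (LINT i|count_space UNIV. (LINT \<omega>|M. ?f1 (i, \<omega>)))"
    by (rule campbell.integral_fst'[OF i1, symmetric])
  also have "\<dots> = (LINT i|count_space UNIV. (LINT \<omega>|M. ?f2 (i, \<omega>)))" by (simp only: eq)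
  also have "\<dots> = (LINT p|campbell. ?f2 p)" by (rule campbell.integral_fst'[OF i2])
  also have "\<dots> = mecke_lhs B ?K ?w" by (simp only: mecke_lhs_def)
  also have "\<dots> = mecke_rhs B ?K ?w" by (rule mecke_equation[OF K B(1) BK mw nw])
  also have "\<dots> = of_real lam * (LINT x:B|lborel. exp (- of_real lam * (LINT z|lborel. 1 - exp (- s * of_real (g z)))))"
    unfolding mecke_rhs_def
    by (intro arg_cong2[where f="(*)"] refl set_lebesgue_integral_cong arg_cong[where f=exp])
      (use B in \<open>auto simp: mark_average_translate[OF g s sub]\<close>)
  also have "\<dots> = of_real lam * (of_real (measure lborel B) * exp (- of_real lam * (LINT z|lborel. 1 - exp (- s * of_real (g z)))))"
    using B emeasure_bounded_finite[OF B(2)] by (simp add: set_lebesgue_integral_def scaleR_conv_of_real)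
  finally show ?thesis by simp
qed

section \<open>Mean sums over receivers\<close>

definition mark_average_nn :: "(real^2 \<Rightarrow> ennreal) \<Rightarrow> real^2 \<Rightarrow> ennreal" where
  "mark_average_nn q z = (\<integral>\<^sup>+t. q (z + r *\<^sub>R direction t) \<partial>angle_measure)"

lemma measurable_mark_average_nn:
  assumes q: "q \<in> borel_measurable borel"
  shows "mark_average_nn q \<in> borel_measurable borel"
proof -
  have "case_prod (\<lambda>z t. q (z + r *\<^sub>R direction t)) \<in> borel_measurable (borel \<Otimes>\<^sub>M angle_measure)"
    unfolding split_beta' by (rule measurable_compose[OF _ q]) measurable
  then show ?thesis unfolding mark_average_nn_def[abs_def] by (rule angle.borel_measurable_nn_integral)
qed

lemma nn_integral_mark_average_nn:
  assumes q: "q \<in> borel_measurable borel"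
  shows "(\<integral>\<^sup>+z. mark_average_nn q z \<partial>lborel) = (\<integral>\<^sup>+z. q z \<partial>lborel)"
proof -
  interpret P: pair_sigma_finite lborel angle_measure
    by (intro pair_sigma_finite.intro lborel.sigma_finite_measure_axioms angle.sigma_finite_measure_axioms)
  have m: "case_prod (\<lambda>z t. q (z + r *\<^sub>R direction t)) \<in> borel_measurable (lborel \<Otimes>\<^sub>M angle_measure)"
    unfolding split_beta' by (rule measurable_compose[OF _ q]) measurable
  have "(\<integral>\<^sup>+z. mark_average_nn q z \<partial>lborel) = (\<integral>\<^sup>+t. (\<integral>\<^sup>+z. q (z + r *\<^sub>R direction t) \<partial>lborel) \<partial>angle_measure)"
    unfolding mark_average_nn_def by (rule P.Fubini'[OF m, symmetric])
  also have "\<dots> = (\<integral>\<^sup>+t. (\<integral>\<^sup>+z. q z \<partial>lborel) \<partial>angle_measure)"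
    by (simp only: nn_integral_lborel_translate[OF q])
  also have "\<dots> = (\<integral>\<^sup>+z. q z \<partial>lborel)" using angle.emeasure_space_1 by simp
  finally show ?thesis .
qed

lemma nn_integral_marks:
  assumes q: "q \<in> borel_measurable borel" and a: "a \<in> borel_measurable seqs" and f: "f \<in> borel_measurable seqs"
  shows "(\<integral>\<^sup>+\<omega>. f (\<lambda>i. X i \<omega>) * q (Y j \<omega> - a (\<lambda>i. X i \<omega>)) \<partial>M)
    = (\<integral>\<^sup>+\<omega>. f (\<lambda>i. X i \<omega>) * mark_average_nn q (X j \<omega> - a (\<lambda>i. X i \<omega>)) \<partial>M)"
proof -
  note [measurable] = q a f measurable_compose[OF measurable_fst measurable_seq_component]
    measurable_compose[OF measurable_snd measurable_seq_component]
    measurable_compose[OF measurable_compose[OF measurable_snd measurable_seq_component] measurable_direction]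
  define F where "F z = f (fst z) * q (fst z j + r *\<^sub>R direction (snd z j) - a (fst z))" for z :: "(nat \<Rightarrow> real^2) \<times> (nat \<Rightarrow> real)"
  have F: "F \<in> borel_measurable (seqs \<Otimes>\<^sub>M seqs)"
    unfolding F_def by measurable
  have "(\<integral>\<^sup>+\<omega>. f (\<lambda>i. X i \<omega>) * q (Y j \<omega> - a (\<lambda>i. X i \<omega>)) \<partial>M) = (\<integral>\<^sup>+\<omega>. F (\<lambda>i. X i \<omega>, \<lambda>i. \<Theta> i \<omega>) \<partial>M)"
    by (simp only: F_def receiver_eq fst_conv snd_conv)
  also have "\<dots> = (\<integral>\<^sup>+\<omega>. (\<integral>\<^sup>+\<omega>'. F (\<lambda>i. X i \<omega>, \<lambda>i. \<Theta> i \<omega>') \<partial>M) \<partial>M)" by (rule nn_integral_decouple[OF F])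
  also have "\<dots> = (\<integral>\<^sup>+\<omega>. f (\<lambda>i. X i \<omega>) * mark_average_nn q (X j \<omega> - a (\<lambda>i. X i \<omega>)) \<partial>M)"
  proof (rule nn_integral_cong)
    fix \<omega>
    let ?x = "\<lambda>i. X i \<omega>"
    have mq: "(\<lambda>t. q (X j \<omega> - a ?x + r *\<^sub>R direction t)) \<in> borel_measurable borel"
      by (rule measurable_compose[OF _ q]) measurable
    have "(\<integral>\<^sup>+\<omega>'. F (?x, \<lambda>i. \<Theta> i \<omega>') \<partial>M) = (\<integral>\<^sup>+\<omega>'. f ?x * q (X j \<omega> - a ?x + r *\<^sub>R direction (\<Theta> j \<omega>')) \<partial>M)"
      by (simp add: F_def algebra_simps)
    also have "\<dots> = f ?x * (\<integral>\<^sup>+\<omega>'. q (X j \<omega> - a ?x + r *\<^sub>R direction (\<Theta> j \<omega>')) \<partial>M)"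
      by (rule nn_integral_cmult) (rule measurable_compose[OF measurable_angle mq])
    also have "(\<integral>\<^sup>+\<omega>'. q (X j \<omega> - a ?x + r *\<^sub>R direction (\<Theta> j \<omega>')) \<partial>M)
        = (\<integral>\<^sup>+t. q (X j \<omega> - a ?x + r *\<^sub>R direction t) \<partial>distr M borel (\<Theta> j))"
      using mq by (intro nn_integral_distr[symmetric] measurable_angle) simp
    finally show "(\<integral>\<^sup>+\<omega>'. F (?x, \<lambda>i. \<Theta> i \<omega>') \<partial>M) = f ?x * mark_average_nn q (X j \<omega> - a ?x)"
      by (simp only: distr_angle mark_average_nn_def)
  qed
  finally show ?thesis .
qed

text \<open>Campbell's formula for the receivers: averaging over angles preserves the integral, so
  their intensity is that of the transmitters.\<close>

lemma nn_integral_receivers: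
  assumes q: "q \<in> borel_measurable borel"
  shows "(\<integral>\<^sup>+\<omega>. (\<Sum>j. q (Y j \<omega>)) \<partial>M) = ennreal lam * (\<integral>\<^sup>+z. q z \<partial>lborel)"
proof -
  have "(\<integral>\<^sup>+\<omega>. (\<Sum>j. q (Y j \<omega>)) \<partial>M) = (\<Sum>j. \<integral>\<^sup>+\<omega>. q (Y j \<omega>) \<partial>M)"
    by (rule nn_integral_suminf) (rule measurable_compose[OF measurable_receiver q])
  also have "\<dots> = (\<Sum>j. \<integral>\<^sup>+\<omega>. mark_average_nn q (X j \<omega>) \<partial>M)"
    using nn_integral_marks[OF q, of "\<lambda>_. 0" "\<lambda>_. 1"] by simp
  also have "\<dots> = (\<integral>\<^sup>+j. (\<integral>\<^sup>+\<omega>. mark_average_nn q (X j \<omega>) \<partial>M) \<partial>count_space UNIV)"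
    by (rule nn_integral_count_space_nat[symmetric])
  also have "\<dots> = (\<integral>\<^sup>+p. mark_average_nn q (X (fst p) (snd p)) \<partial>campbell)"
    using measurable_compose[OF measurable_campbell_point measurable_mark_average_nn[OF q]]
    by (subst nn_integral_fst[symmetric]) auto
  also have "\<dots> = ennreal lam * (\<integral>\<^sup>+z. mark_average_nn q z \<partial>lborel)"
    by (rule nn_integral_campbell[OF measurable_mark_average_nn[OF q]])
  finally show ?thesis by (simp only: nn_integral_mark_average_nn[OF q])
qed

text \<open>After averaging over angles this is an integral over ordered pairs of distinct
  transmitters. It serves twice: with the far part of a gain it gives finiteness, and with the
  indicator of \<open>{0}\<close> it shows that no receiver sits on another transmitter.\<close>

lemma nn_integral_reduced:
  assumes q: "q \<in> borel_measurable borel" and B: "B \<in> sets borel"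
  shows "(\<integral>\<^sup>+p. indicator B (X (fst p) (snd p)) * (\<Sum>j. indicator (- {fst p}) j * q (Y j (snd p) - X (fst p) (snd p))) \<partial>campbell)
    = ennreal (lam\<^sup>2) * (emeasure lborel B * (\<integral>\<^sup>+z. q z \<partial>lborel))"
proof -
  let ?h = "\<lambda>z. indicator B (fst z) * mark_average_nn q (snd z - fst z)"
  have mh: "?h \<in> borel_measurable (borel \<Otimes>\<^sub>M borel)"
  proof -
    have "(\<lambda>z. mark_average_nn q (snd z - fst z)) \<in> borel_measurable (borel \<Otimes>\<^sub>M borel)"
      by (rule measurable_compose[OF _ measurable_mark_average_nn[OF q]]) measurable
    then show ?thesis using B by measurable
  qed
  have swap: "(\<integral>\<^sup>+p. (\<Sum>j. f j (fst p) (snd p)) \<partial>campbell) = (\<Sum>j. (\<Sum>i. (\<integral>\<^sup>+\<omega>. f j i \<omega> \<partial>M)))"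
    if f: "\<And>i j. f j i \<in> borel_measurable M" for f :: "nat \<Rightarrow> nat \<Rightarrow> 'w \<Rightarrow> ennreal"
  proof -
    have mf: "(\<lambda>p. f j (fst p) (snd p)) \<in> borel_measurable campbell" for j
      by (rule measurable_campbell) (simp add: f)
    have "(\<integral>\<^sup>+p. (\<Sum>j. f j (fst p) (snd p)) \<partial>campbell) = (\<Sum>j. (\<integral>\<^sup>+p. f j (fst p) (snd p) \<partial>campbell))"
      by (rule nn_integral_suminf[OF mf])
    also have "\<dots> = (\<Sum>j. (\<Sum>i. (\<integral>\<^sup>+\<omega>. f j i \<omega> \<partial>M)))"
      by (subst nn_integral_fst[OF mf, symmetric]) (simp add: nn_integral_count_space_nat)
    finally show ?thesis .
  qed
  let ?f = "\<lambda>j i \<omega>. indicator B (X i \<omega>) * (indicator (- {i}) j * q (Y j \<omega> - X i \<omega>))"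
  let ?m = "\<lambda>j i \<omega>. indicator B (X i \<omega>) * (indicator (- {i}) j * mark_average_nn q (X j \<omega> - X i \<omega>))"
  have f: "?f j i \<in> borel_measurable M" for i j
    using B measurable_compose[OF _ q, of "\<lambda>\<omega>. Y j \<omega> - X i \<omega>" M] by measurable
  have m: "?m j i \<in> borel_measurable M" for i j
    using B measurable_compose[OF _ measurable_mark_average_nn[OF q], of "\<lambda>\<omega>. X j \<omega> - X i \<omega>" M] by measurable
  have eq: "(\<integral>\<^sup>+\<omega>. ?f j i \<omega> \<partial>M) = (\<integral>\<^sup>+\<omega>. ?m j i \<omega> \<partial>M)" for i j
  proof -
    have "(\<lambda>x. indicator B (x i) * indicator (- {i}) j :: ennreal) \<in> borel_measurable seqs"
      using B measurable_seq_component by measurable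
    from nn_integral_marks[OF q measurable_seq_component[of i] this, of j]
    show ?thesis by (simp only: mult.assoc)
  qed
  have "(\<integral>\<^sup>+p. indicator B (X (fst p) (snd p)) * (\<Sum>j. indicator (- {fst p}) j * q (Y j (snd p) - X (fst p) (snd p))) \<partial>campbell)
      = (\<integral>\<^sup>+p. (\<Sum>j. ?f j (fst p) (snd p)) \<partial>campbell)"
    by (simp only: ennreal_suminf_cmult)
  also have "\<dots> = (\<Sum>j. (\<Sum>i. (\<integral>\<^sup>+\<omega>. ?m j i \<omega> \<partial>M)))" by (subst swap[of ?f, OF f]) (simp only: eq)
  also have "\<dots> = (\<integral>\<^sup>+p. (\<Sum>j. ?m j (fst p) (snd p)) \<partial>campbell)" by (rule swap[of ?m, OF m, symmetric])
  also have "\<dots> = pair_integral ?h"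
    unfolding pair_integral_def nn_integral_count_space_nat by (simp only: fst_conv snd_conv ac_simps)
  also have "\<dots> = ennreal (lam\<^sup>2) * (\<integral>\<^sup>+z. ?h z \<partial>(lborel \<Otimes>\<^sub>M lborel))" by (rule pair_integral_eq[OF mh])
  also have "(\<integral>\<^sup>+z. ?h z \<partial>(lborel \<Otimes>\<^sub>M lborel)) = (\<integral>\<^sup>+x. (\<integral>\<^sup>+y. indicator B x * mark_average_nn q (y - x) \<partial>lborel) \<partial>lborel)"
    using mh by (subst lborel.nn_integral_fst[symmetric]) (auto cong: measurable_cong_sets)
  also have "\<dots> = (\<integral>\<^sup>+x. indicator B x * (\<integral>\<^sup>+z. q z \<partial>lborel) \<partial>lborel)"
  proof (rule nn_integral_cong)
    fix x
    have my: "(\<lambda>y. mark_average_nn q (y - x)) \<in> borel_measurable lborel"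
      using measurable_compose[OF _ measurable_mark_average_nn[OF q], of "\<lambda>y. y - x" borel] by simp
    have "(\<integral>\<^sup>+y. mark_average_nn q (y - x) \<partial>lborel) = (\<integral>\<^sup>+z. q z \<partial>lborel)"
      using nn_integral_lborel_translate[OF measurable_mark_average_nn[OF q], of "- x"] nn_integral_mark_average_nn[OF q]
      by simp
    then show "(\<integral>\<^sup>+y. indicator B x * mark_average_nn q (y - x) \<partial>lborel) = indicator B x * (\<integral>\<^sup>+z. q z \<partial>lborel)"
      by (subst nn_integral_cmult[OF my]) simp
  qed
  also have "\<dots> = emeasure lborel B * (\<integral>\<^sup>+z. q z \<partial>lborel)"
    using B by (subst nn_integral_multc) auto
  finally show ?thesis .
qed

end

section \<open>Gains of unbounded support and almost sure finiteness\<close>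

text \<open>Nothing but measurability and a sign is required inside the unit disc: for \<kappa> = 1
  the path gain behaves there like \<open>norm z powr - \<alpha>\<close>, which is not integrable
  near 0.\<close>

definition admissible :: "(real^2 \<Rightarrow> real) \<Rightarrow> bool" where
  "admissible g \<longleftrightarrow> g \<in> borel_measurable borel \<and> (\<forall>z. 0 \<le> g z) \<and>
     (\<integral>\<^sup>+z. ennreal (indicator {z. 1 \<le> norm z} z * g z) \<partial>lborel) < \<infinity>"

lemma admissibleD:
  assumes "admissible g"
  shows "g \<in> borel_measurable borel" "\<And>z. 0 \<le> g z"
    "(\<integral>\<^sup>+z. ennreal (indicator {z. 1 \<le> norm z} z * g z) \<partial>lborel) < \<infinity>"
  using assms by (auto simp: admissible_def)

definition truncate :: "(real^2 \<Rightarrow> real) \<Rightarrow> nat \<Rightarrow> real^2 \<Rightarrow> real" where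
  "truncate g n z = indicator (cball 0 (real n)) z * g z"

lemma truncate_props:
  assumes "admissible g"
  shows "truncate g n \<in> borel_measurable borel" "\<And>z. 0 \<le> truncate g n z"
    "\<And>z. real n < norm z \<Longrightarrow> truncate g n z = 0"
  using admissibleD[OF assms] by (auto simp: truncate_def[abs_def] indicator_def)

lemma truncate_eventually: "eventually (\<lambda>n. truncate g n z = g z) sequentially"
proof -
  obtain m where "norm z \<le> real m" using real_arch_simple by blast
  then have "truncate g n z = g z" if "m \<le> n" for n using that by (simp add: truncate_def)
  then show ?thesis by (rule eventually_sequentiallyI)
qed

lemma norm_one_minus_exp_le:
  fixes s :: complex
  assumes "Re s \<ge> 0" "x \<ge> 0"
  shows "norm (1 - exp (- s * of_real x)) \<le> 2" "norm (1 - exp (- s * of_real x)) \<le> norm s * x"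
proof -
  have "norm (exp (- s * of_real x)) \<le> 1" using assms by (simp add: norm_exp_eq_Re)
  then show "norm (1 - exp (- s * of_real x)) \<le> 2"
    using norm_triangle_ineq4[of 1 "exp (- s * of_real x)"] norm_one[where 'a=complex] by linarith
  have "norm (exp 0 - exp (- s * of_real x)) \<le> norm (0 - (- s * of_real x))"
    using assms by (intro norm_exp_diff_le) auto
  then show "norm (1 - exp (- s * of_real x)) \<le> norm s * x" using assms by (simp add: norm_mult)
qed

text \<open>The bound 2 is used on the unit disc, where \<open>g\<close> need not be integrable, and
  the bound linear in \<open>g\<close> outside.\<close>

lemma integrable_one_minus_exp:
  assumes g: "admissible g" and s: "Re s \<ge> 0"
  shows "integrable lborel (\<lambda>z. 1 - exp (- s * of_real (g z)))"
proof (rule integrableI_bounded)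
  note g' = admissibleD[OF g]
  show "(\<lambda>z. 1 - exp (- s * of_real (g z))) \<in> borel_measurable lborel" using g'(1) by measurable
  have "ennreal (norm (1 - exp (- s * of_real (g z))))
      \<le> 2 * indicator (ball 0 1) z + ennreal (norm s) * ennreal (indicator {z. 1 \<le> norm z} z * g z)" for z
  proof (cases "norm z < 1")
    case True
    have "ennreal (norm (1 - exp (- s * of_real (g z)))) \<le> ennreal 2"
      by (intro ennreal_leI norm_one_minus_exp_le s g'(2))
    then show ?thesis using True by simp
  next
    case False
    have "ennreal (norm (1 - exp (- s * of_real (g z)))) \<le> ennreal (norm s * g z)"
      by (intro ennreal_leI norm_one_minus_exp_le s g'(2))
    then show ?thesis using False g'(2) by (simp add: ennreal_mult)
  qed
  then have "(\<integral>\<^sup>+z. ennreal (norm (1 - exp (- s * of_real (g z)))) \<partial>lborel)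
      \<le> (\<integral>\<^sup>+z. 2 * indicator (ball 0 1) z + ennreal (norm s) * ennreal (indicator {z. 1 \<le> norm z} z * g z) \<partial>lborel)"
    by (intro nn_integral_mono) simp
  also have "\<dots> = 2 * emeasure lborel (ball (0::real^2) 1)
      + ennreal (norm s) * (\<integral>\<^sup>+z. ennreal (indicator {z. 1 \<le> norm z} z * g z) \<partial>lborel)"
  proof -
    have m1: "(\<lambda>z. 2 * indicator (ball 0 1) z :: ennreal) \<in> borel_measurable (lborel :: (real^2) measure)"
      by (intro borel_measurable_times_ennreal borel_measurable_const borel_measurable_indicator) simp
    have "{z::real^2. 1 \<le> norm z} \<in> sets borel" by measurable
    then have m2: "(\<lambda>z. ennreal (indicator {z. 1 \<le> norm z} z * g z)) \<in> borel_measurable lborel"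
      using g'(1) by measurable
    have m3: "(\<lambda>z. ennreal (norm s) * ennreal (indicator {z. 1 \<le> norm z} z * g z)) \<in> borel_measurable lborel"
      by (intro borel_measurable_times_ennreal borel_measurable_const m2)
    show ?thesis
      unfolding nn_integral_add[OF m1 m3] nn_integral_cmult[OF m2]
      by (subst nn_integral_cmult_indicator) simp_all
  qed
  also have "\<dots> < \<infinity>"
    using g'(3) emeasure_bounded_finite[OF bounded_ball[of "0::real^2" 1]]
    by (simp add: ennreal_mult_less_top)
  finally show "(\<integral>\<^sup>+z. ennreal (norm (1 - exp (- s * of_real (g z)))) \<partial>lborel) < \<infinity>" .
qed

lemma integral_truncate_tendsto:
  assumes g: "admissible g" and s: "Re s \<ge> 0"
  shows "(\<lambda>n. LINT z|lborel. 1 - exp (- s * of_real (truncate g n z))) \<longlonglongrightarrow> (LINT z|lborel. 1 - exp (- s * of_real (g z)))"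
proof (rule integral_dominated_convergence[where w = "\<lambda>z. norm (1 - exp (- s * of_real (g z)))"])
  show "(\<lambda>z. 1 - exp (- s * of_real (g z))) \<in> borel_measurable lborel"
    using admissibleD(1)[OF g] by measurable
  show "(\<lambda>z. 1 - exp (- s * of_real (truncate g n z))) \<in> borel_measurable lborel" for n
    using truncate_props(1)[OF g, of n] by measurable
  show "integrable lborel (\<lambda>z. norm (1 - exp (- s * of_real (g z))))"
    by (intro integrable_norm integrable_one_minus_exp g s)
  show "AE z in lborel. (\<lambda>n. 1 - exp (- s * of_real (truncate g n z))) \<longlonglongrightarrow> 1 - exp (- s * of_real (g z))"
  proof (rule AE_I2)
    fix z
    show "(\<lambda>n. 1 - exp (- s * of_real (truncate g n z))) \<longlonglongrightarrow> 1 - exp (- s * of_real (g z))"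
      by (rule tendsto_eventually, rule eventually_mono[OF truncate_eventually[of g z]]) simp
  qed
  \<comment> \<open>The truncated gain at a point is either \<open>g\<close> or 0, and in the latter
    case the left side is 0.\<close>
  show "AE z in lborel. norm (1 - exp (- s * of_real (truncate g n z))) \<le> norm (1 - exp (- s * of_real (g z)))" for n
    by (intro AE_I2) (simp add: truncate_def indicator_def)
qed

context bipolar begin

lemma shot_truncate_tendsto:
  assumes g: "admissible g"
  shows "(\<lambda>n. shot J (truncate g n) a x t) \<longlonglongrightarrow> shot J g a x t"
proof -
  let ?z = "\<lambda>j. x j + r *\<^sub>R direction (t j) - a"
  have "(\<lambda>n. \<integral>\<^sup>+j. ennreal (indicator J j * truncate g n (?z j)) \<partial>count_space UNIV)
      \<longlonglongrightarrow> (\<integral>\<^sup>+j. ennreal (indicator J j * g (?z j)) \<partial>count_space UNIV)"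
  proof (rule nn_integral_LIMSEQ)
    show "incseq (\<lambda>n j. ennreal (indicator J j * truncate g n (?z j)))"
      using admissibleD(2)[OF g]
      by (intro monoI le_funI ennreal_leI) (auto simp: truncate_def indicator_def)
    show "(\<lambda>n. ennreal (indicator J j * truncate g n (?z j))) \<longlonglongrightarrow> ennreal (indicator J j * g (?z j))" for j
      by (rule tendsto_eventually, rule eventually_mono[OF truncate_eventually[of g "?z j"]]) simp
  qed simp
  then show ?thesis unfolding shot_def nn_integral_count_space_nat .
qed

text \<open>Finiteness is essential: if the sum were infinite, its real value would be 0, while the
  truncated sums grow.\<close>

lemma enn2real_shot_tendsto:
  assumes g: "admissible g" and fin: "shot J g a x t < \<infinity>"
  shows "(\<lambda>n. enn2real (shot J (truncate g n) a x t)) \<longlonglongrightarrow> enn2real (shot J g a x t)"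
proof (rule tendsto_enn2real)
  have "ennreal (enn2real (shot J g a x t)) = shot J g a x t" using fin by simp
  then show "(\<lambda>n. shot J (truncate g n) a x t) \<longlonglongrightarrow> ennreal (enn2real (shot J g a x t))"
    using shot_truncate_tendsto[OF g] by (simp only:)
qed simp

text \<open>A receiver within distance 1 of \<open>a\<close> has its transmitter within 1 + r, and
  there are finitely many of those, so only the far field needs to be controlled.\<close>

lemma shot_finite:
  assumes g: "\<And>z. 0 \<le> g z" and \<omega>: "\<omega> \<in> space M"
    and far: "(\<Sum>j. indicator J j * ennreal (indicator {z. 1 \<le> norm z} (Y j \<omega> - a) * g (Y j \<omega> - a))) < \<infinity>"
  shows "shot J g a (\<lambda>i. X i \<omega>) (\<lambda>i. \<Theta> i \<omega>) < \<infinity>"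
proof -
  let ?near = "\<lambda>j. indicator J j * ennreal (indicator {z. norm z < 1} (Y j \<omega> - a) * g (Y j \<omega> - a))"
  let ?far = "\<lambda>j. indicator J j * ennreal (indicator {z. 1 \<le> norm z} (Y j \<omega> - a) * g (Y j \<omega> - a))"
  let ?N = "{j. X j \<omega> \<in> ball a (1 + r)}"
  have fin: "finite ?N" by (rule finite_points[OF \<omega>]) simp
  have "shot J g a (\<lambda>i. X i \<omega>) (\<lambda>i. \<Theta> i \<omega>) = (\<Sum>j. ?near j + ?far j)"
    unfolding shot_def receiver_eq[symmetric] by (intro suminf_cong) (auto simp: indicator_def)
  also have "\<dots> = (\<Sum>j. ?near j) + (\<Sum>j. ?far j)" by (rule suminf_add[symmetric]) auto
  also have "(\<Sum>j. ?near j) = (\<Sum>j\<in>?N. ?near j)"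
  proof (rule suminf_finite[OF fin])
    fix j assume "j \<notin> ?N"
    then have "1 + r \<le> norm (X j \<omega> - a)" by (simp add: dist_norm norm_minus_commute)
    also have "\<dots> \<le> norm (Y j \<omega> - a) + norm (r *\<^sub>R direction (\<Theta> j \<omega>))"
      using norm_triangle_ineq4[of "Y j \<omega> - a" "r *\<^sub>R direction (\<Theta> j \<omega>)"]
      by (simp add: receiver_eq algebra_simps)
    finally have "1 \<le> norm (Y j \<omega> - a)" using r_pos by simp
    then show "?near j = 0" by simp
  qed
  also have "(\<Sum>j\<in>?N. ?near j) + (\<Sum>j. ?far j) < \<infinity>"
    using far fin by (auto simp: indicator_def)
  finally show ?thesis .
qed

lemma far_field_finite:
  assumes g: "admissible g"
  defines "q \<equiv> \<lambda>z. ennreal (indicator {z. 1 \<le> norm z} z * g z)"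
  shows "q \<in> borel_measurable borel" "(\<integral>\<^sup>+z. q z \<partial>lborel) < \<infinity>"
proof -
  have "{z::real^2. 1 \<le> norm z} \<in> sets borel" by measurable
  then show "q \<in> borel_measurable borel" unfolding q_def using admissibleD(1)[OF g] by measurable
  show "(\<integral>\<^sup>+z. q z \<partial>lborel) < \<infinity>" unfolding q_def by (rule admissibleD(3)[OF g])
qed

text \<open>The far field has finite mean by Campbell's formula. The mean of the whole sum may be
  infinite because of the singularity at 0.\<close>

lemma AE_shot_finite:
  assumes g: "admissible g"
  shows "AE \<omega> in M. shot UNIV g 0 (\<lambda>i. X i \<omega>) (\<lambda>i. \<Theta> i \<omega>) < \<infinity>"
proof -
  let ?q = "\<lambda>z. ennreal (indicator {z. 1 \<le> norm z} z * g z)"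
  note q = far_field_finite[OF g]
  have m: "(\<lambda>\<omega>. \<Sum>j. ?q (Y j \<omega>)) \<in> borel_measurable M"
    by (rule borel_measurable_suminf_order) (rule measurable_compose[OF measurable_receiver q(1)])
  have "(\<integral>\<^sup>+\<omega>. (\<Sum>j. ?q (Y j \<omega>)) \<partial>M) \<noteq> \<infinity>"
    unfolding nn_integral_receivers[OF q(1)] using q(2) by (simp add: ennreal_mult_eq_top_iff)
  then have "AE \<omega> in M. (\<Sum>j. ?q (Y j \<omega>)) \<noteq> \<infinity>" by (rule nn_integral_noteq_infinite[OF m])
  then show ?thesis
  proof (rule AE_mp, intro AE_I2 impI)
    fix \<omega> assume "\<omega> \<in> space M" "(\<Sum>j. ?q (Y j \<omega>)) \<noteq> \<infinity>"
    then show "shot UNIV g 0 (\<lambda>i. X i \<omega>) (\<lambda>i. \<Theta> i \<omega>) < \<infinity>"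
      using admissibleD(2)[OF g] by (intro shot_finite) (auto simp: less_top)
  qed
qed

lemma measurable_far_reduced:
  assumes q: "q \<in> borel_measurable borel"
  shows "(\<lambda>p. \<Sum>j. indicator (- {fst p}) j * (q (Y j (snd p) - X (fst p) (snd p)) :: ennreal)) \<in> borel_measurable campbell"
proof (rule borel_measurable_suminf_order, rule measurable_campbell)
  fix i j
  have "(\<lambda>\<omega>. q (Y j \<omega> - X i \<omega>)) \<in> borel_measurable M"
    by (rule measurable_compose[OF _ q]) simp
  then show "(\<lambda>\<omega>. indicator (- {fst (i, \<omega>)}) j * q (Y j (snd (i, \<omega>)) - X (fst (i, \<omega>)) (snd (i, \<omega>)))) \<in> borel_measurable M"
    by simp
qed

lemma AE_reduced_shot_finite:
  assumes g: "admissible g" and B: "B \<in> sets borel" "bounded B"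
  shows "AE p in campbell. X (fst p) (snd p) \<in> B \<longrightarrow>
    shot (- {fst p}) g (X (fst p) (snd p)) (\<lambda>i. X i (snd p)) (\<lambda>i. \<Theta> i (snd p)) < \<infinity>"
proof -
  let ?q = "\<lambda>z. ennreal (indicator {z. 1 \<le> norm z} z * g z)"
  let ?S = "\<lambda>p. \<Sum>j. indicator (- {fst p}) j * ?q (Y j (snd p) - X (fst p) (snd p))"
  note q = far_field_finite[OF g]
  have m: "(\<lambda>p. indicator B (X (fst p) (snd p)) * ?S p) \<in> borel_measurable campbell"
    using measurable_compose[OF measurable_campbell_point borel_measurable_indicator[OF B(1)]]
    by (intro borel_measurable_times_ennreal measurable_far_reduced q(1)) simp
  have "(\<integral>\<^sup>+p. indicator B (X (fst p) (snd p)) * ?S p \<partial>campbell) \<noteq> \<infinity>"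
    unfolding nn_integral_reduced[OF q(1) B(1)]
    using q(2) emeasure_bounded_finite[OF B(2)] by (simp add: ennreal_mult_eq_top_iff less_top)
  then have "AE p in campbell. indicator B (X (fst p) (snd p)) * ?S p \<noteq> \<infinity>"
    by (rule nn_integral_noteq_infinite[OF m])
  then show ?thesis
  proof (rule AE_mp, intro AE_I2 impI)
    fix p assume p: "p \<in> space campbell" "indicator B (X (fst p) (snd p)) * ?S p \<noteq> \<infinity>" "X (fst p) (snd p) \<in> B"
    have "snd p \<in> space M" using p(1) by (auto simp: space_pair_measure)
    moreover have "?S p < \<infinity>" using p(2,3) by (simp add: less_top)
    ultimately show "shot (- {fst p}) g (X (fst p) (snd p)) (\<lambda>i. X i (snd p)) (\<lambda>i. \<Theta> i (snd p)) < \<infinity>"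
      using admissibleD(2)[OF g] by (intro shot_finite) auto
  qed
qed

text \<open>The mean number of such coincidences is a multiple of the area of a point. Coincidences
  have to be excluded because for \<kappa> = 1 the gain at distance 0 is 0 through division by 0,
  and the comparison of gains fails there.\<close>

lemma AE_receivers_apart:
  assumes B: "B \<in> sets borel"
  shows "AE p in campbell. X (fst p) (snd p) \<in> B \<longrightarrow> (\<forall>j. j \<noteq> fst p \<longrightarrow> Y j (snd p) \<noteq> X (fst p) (snd p))"
proof -
  let ?q = "indicator {0} :: real^2 \<Rightarrow> ennreal"
  let ?S = "\<lambda>p. \<Sum>j. indicator (- {fst p}) j * ?q (Y j (snd p) - X (fst p) (snd p))"
  have q: "?q \<in> borel_measurable borel" by simp
  have m: "(\<lambda>p. indicator B (X (fst p) (snd p)) * ?S p) \<in> borel_measurable campbell"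
    using measurable_compose[OF measurable_campbell_point borel_measurable_indicator[OF B]]
    by (intro borel_measurable_times_ennreal measurable_far_reduced q) simp
  have "(\<integral>\<^sup>+p. indicator B (X (fst p) (snd p)) * ?S p \<partial>campbell) = 0"
    unfolding nn_integral_reduced[OF q B] by simp
  then have "AE p in campbell. indicator B (X (fst p) (snd p)) * ?S p = 0"
    by (subst (asm) nn_integral_0_iff_AE[OF m])
  then show ?thesis
  proof (rule AE_mp, intro AE_I2 impI allI)
    fix p j assume p: "indicator B (X (fst p) (snd p)) * ?S p = 0" "X (fst p) (snd p) \<in> B" "j \<noteq> fst p"
    then have "?S p = 0" by simp
    then have "indicator (- {fst p}) j * ?q (Y j (snd p) - X (fst p) (snd p)) = 0"
      by (subst (asm) suminf_eq_zero_iff) auto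
    then show "Y j (snd p) \<noteq> X (fst p) (snd p)" using p(3) by auto
  qed
qed

text \<open>A transmitter at the origin would keep its receiver on one circle around the origin
  whatever the angle, which would defeat the argument that excludes atoms.\<close>

lemma AE_transmitters_nonzero: "AE \<omega> in M. X i \<omega> \<noteq> 0"
proof -
  let ?q = "indicator {0} :: real^2 \<Rightarrow> ennreal"
  have q: "?q \<in> borel_measurable borel" by simp
  have "(\<integral>\<^sup>+p. ?q (X (fst p) (snd p)) \<partial>campbell) = 0"
    unfolding nn_integral_campbell[OF q] by simp
  moreover have "(\<integral>\<^sup>+p. ?q (X (fst p) (snd p)) \<partial>campbell) = (\<Sum>i. \<integral>\<^sup>+\<omega>. ?q (X i \<omega>) \<partial>M)"
    using measurable_compose[OF measurable_campbell_point q]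
    by (subst nn_integral_fst[symmetric]) (auto simp: nn_integral_count_space_nat)
  ultimately have "(\<integral>\<^sup>+\<omega>. ?q (X i \<omega>) \<partial>M) = 0"
    by (simp add: suminf_eq_zero_iff)
  then have "AE \<omega> in M. ?q (X i \<omega>) = 0"
    by (subst (asm) nn_integral_0_iff_AE) auto
  then show ?thesis by (rule AE_mp) (intro AE_I2 impI, auto)
qed

definition interference :: "(real^2 \<Rightarrow> real) \<Rightarrow> 'w \<Rightarrow> real" where
  "interference g \<omega> = infsum (\<lambda>j. g (Y j \<omega>)) UNIV"

lemma interference_eq_shot:
  "(\<And>z. 0 \<le> g z) \<Longrightarrow> interference g \<omega> = enn2real (shot UNIV g 0 (\<lambda>i. X i \<omega>) (\<lambda>i. \<Theta> i \<omega>))"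
  using infsum_eq_shot[of g \<omega> 0 UNIV] by (simp add: interference_def)

lemma reduced_eq_shot:
  "(\<And>z. 0 \<le> g z) \<Longrightarrow> reduced g i \<omega> = enn2real (shot (- {i}) g (X i \<omega>) (\<lambda>i. X i \<omega>) (\<lambda>i. \<Theta> i \<omega>))"
  using infsum_eq_shot[of g \<omega> "X i \<omega>" "- {i}"] by (simp add: reduced_def)

lemma measurable_interference0:
  assumes "g \<in> borel_measurable borel" "\<And>z. 0 \<le> g z"
  shows "interference g \<in> borel_measurable M"
  using measurable_interference[OF assms, of "\<lambda>_. 0" UNIV] by (simp add: interference_def[abs_def])

lemma interference_nonneg: "(\<And>z. 0 \<le> g z) \<Longrightarrow> 0 \<le> interference g \<omega>"
  unfolding interference_def by (rule infsum_nonneg) simp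

lemma laplace_receivers:
  assumes g: "admissible g" and s: "Re s \<ge> 0"
  shows "(LINT \<omega>|M. exp (- s * of_real (interference g \<omega>)))
    = exp (- of_real lam * (LINT z|lborel. 1 - exp (- s * of_real (g z))))"
proof -
  note g' = admissibleD[OF g] and t = truncate_props[OF g]
  have m: "(\<lambda>\<omega>. exp (- s * of_real (interference h \<omega>))) \<in> borel_measurable M"
    if "h \<in> borel_measurable borel" "\<And>z. 0 \<le> h z" for h
    using measurable_interference0[OF that] by measurable
  have "(\<lambda>n. LINT \<omega>|M. exp (- s * of_real (interference (truncate g n) \<omega>)))
      \<longlonglongrightarrow> (LINT \<omega>|M. exp (- s * of_real (interference g \<omega>)))"
  proof (rule integral_dominated_convergence[where w = "\<lambda>_. 1"])
    show "AE \<omega> in M. (\<lambda>n. exp (- s * of_real (interference (truncate g n) \<omega>))) \<longlonglongrightarrow> exp (- s * of_real (interference g \<omega>))"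
      using AE_shot_finite[OF g]
    proof (rule AE_mp, intro AE_I2 impI)
      fix \<omega> assume fin: "shot UNIV g 0 (\<lambda>i. X i \<omega>) (\<lambda>i. \<Theta> i \<omega>) < \<infinity>"
      show "(\<lambda>n. exp (- s * of_real (interference (truncate g n) \<omega>))) \<longlonglongrightarrow> exp (- s * of_real (interference g \<omega>))"
        unfolding interference_eq_shot[OF g'(2)] interference_eq_shot[OF t(2)]
        by (intro tendsto_exp tendsto_mult tendsto_const tendsto_of_real enn2real_shot_tendsto g fin)
    qed
    show "AE \<omega> in M. norm (exp (- s * of_real (interference (truncate g n) \<omega>))) \<le> 1" for n
      by (intro AE_I2 norm_exp_le_one s interference_nonneg t)
  qed (intro m g' t, intro m g' t, simp)
  moreover have "(\<lambda>n. LINT \<omega>|M. exp (- s * of_real (interference (truncate g n) \<omega>)))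
      \<longlonglongrightarrow> exp (- of_real lam * (LINT z|lborel. 1 - exp (- s * of_real (g z))))"
  proof -
    have "(LINT \<omega>|M. exp (- s * of_real (interference (truncate g n) \<omega>)))
        = exp (- of_real lam * (LINT z|lborel. 1 - exp (- s * of_real (truncate g n z))))" for n
      using laplace_receivers_bounded_support[OF t s, of n n] by (simp add: interference_def)
    then show ?thesis
      by (simp only:) (intro tendsto_exp tendsto_mult tendsto_const integral_truncate_tendsto g s)
  qed
  ultimately show ?thesis by (rule LIMSEQ_unique)
qed

text \<open>The right side is left as an expectation of the interference at the origin, the form in
  which characteristic functions are compared. The limit needs almost sure finiteness under the
  Campbell measure.\<close>

lemma palm_laplace:
  assumes g: "admissible g" and s: "Re s \<ge> 0" and B: "B \<in> sets borel" "bounded B"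
  shows "(LINT p|campbell. indicator B (X (fst p) (snd p)) *\<^sub>R exp (- s * of_real (reduced g (fst p) (snd p))))
    = of_real (lam * measure lborel B) * (LINT \<omega>|M. exp (- s * of_real (interference g \<omega>)))"
proof -
  note g' = admissibleD[OF g] and t = truncate_props[OF g]
  let ?F = "\<lambda>h p. indicator B (X (fst p) (snd p)) *\<^sub>R exp (- s * of_real (reduced h (fst p) (snd p)))"
  have int: "integrable campbell (?F h)" if h: "h \<in> borel_measurable borel" "\<And>z. 0 \<le> h z" for h
  proof (rule campbell_window_integral(1)[OF B])
    show "(\<lambda>\<omega>. exp (- s * of_real (reduced h i \<omega>))) \<in> borel_measurable M" for i
      using measurable_reduced[OF h, of i] by measurable
    show "norm (exp (- s * of_real (reduced h i \<omega>))) \<le> 1" for i \<omega>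
      by (intro norm_exp_le_one s reduced_nonneg h(2))
  qed
  have "(\<lambda>n. LINT p|campbell. ?F (truncate g n) p) \<longlonglongrightarrow> (LINT p|campbell. ?F g p)"
  proof (rule integral_dominated_convergence[where w = "\<lambda>p. indicator B (X (fst p) (snd p)) *\<^sub>R 1"])
    show "?F g \<in> borel_measurable campbell" by (rule borel_measurable_integrable[OF int[OF g'(1,2)]])
    show "?F (truncate g n) \<in> borel_measurable campbell" for n
      by (rule borel_measurable_integrable[OF int[OF t(1,2)]])
    show "integrable campbell (\<lambda>p. indicator B (X (fst p) (snd p)) *\<^sub>R (1::real))"
      by (rule campbell_window_integral(1)[OF B, where f = "\<lambda>_ _. 1" and b = 1]) auto
    show "AE p in campbell. (\<lambda>n. ?F (truncate g n) p) \<longlonglongrightarrow> ?F g p"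
      using AE_reduced_shot_finite[OF g B]
    proof (rule AE_mp, intro AE_I2 impI)
      fix p assume *: "X (fst p) (snd p) \<in> B \<longrightarrow>
        shot (- {fst p}) g (X (fst p) (snd p)) (\<lambda>i. X i (snd p)) (\<lambda>i. \<Theta> i (snd p)) < \<infinity>"
      show "(\<lambda>n. ?F (truncate g n) p) \<longlonglongrightarrow> ?F g p"
      proof (cases "X (fst p) (snd p) \<in> B")
        case True
        then show ?thesis
          unfolding reduced_eq_shot[OF g'(2)] reduced_eq_shot[OF t(2)] using *
          by (intro tendsto_scaleR tendsto_exp tendsto_mult tendsto_const tendsto_of_real enn2real_shot_tendsto g) simp
      qed simp
    qed
    have "norm (exp (- s * of_real (reduced (truncate g n) (fst p) (snd p)))) \<le> 1" for n p
      by (intro norm_exp_le_one s reduced_nonneg t)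
    then show "AE p in campbell. norm (?F (truncate g n) p) \<le> indicator B (X (fst p) (snd p)) *\<^sub>R 1" for n
      by (intro AE_I2) (simp add: indicator_def)
  qed
  moreover have "(\<lambda>n. LINT p|campbell. ?F (truncate g n) p)
      \<longlonglongrightarrow> of_real (lam * measure lborel B) * exp (- of_real lam * (LINT z|lborel. 1 - exp (- s * of_real (g z))))"
  proof -
    have "(LINT p|campbell. ?F (truncate g n) p)
        = of_real (lam * measure lborel B) * exp (- of_real lam * (LINT z|lborel. 1 - exp (- s * of_real (truncate g n z))))" for n
      by (rule palm_laplace_bounded_support[OF t s of_nat_0_le_iff B])
    then show ?thesis
      by (simp only:) (intro tendsto_exp tendsto_mult tendsto_const integral_truncate_tendsto g s)
  qed
  ultimately have "(LINT p|campbell. ?F g p)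
      = of_real (lam * measure lborel B) * exp (- of_real lam * (LINT z|lborel. 1 - exp (- s * of_real (g z))))"
    by (rule LIMSEQ_unique)
  then show ?thesis by (simp only: laplace_receivers[OF g s])
qed

end

section \<open>The law of the interference\<close>

lemma emeasure_angle_countable:
  assumes "countable A"
  shows "emeasure angle_measure A = 0"
proof -
  have A: "A \<in> sets borel" using assms by (rule sets.countable[rotated]) simp
  have "A \<in> null_sets lborel" using assms by (rule countable_imp_null_set_lborel)
  then have "emeasure lborel ({0..<2 * pi} \<inter> A) = 0"
    using A by (intro emeasure_eq_0[OF _ _ Int_lower2]) auto
  then show ?thesis using A by (simp add: emeasure_uniform_measure)
qed

text \<open>By the law of cosines the squared norm is affine in cosine and sine of the angle, with
  coefficients that do not both vanish.\<close>

lemma countable_norm_add_direction: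
  fixes x :: "real^2"
  assumes "x \<noteq> 0" "r > 0"
  shows "countable {t. norm (x + r *\<^sub>R direction t) = m}"
proof -
  have "x $ 1 \<noteq> 0 \<or> x $ 2 \<noteq> 0" using assms(1) by (auto simp: vec_eq_iff forall_2)
  then have c: "countable {t. x $ 1 * cos t + x $ 2 * sin t = (m\<^sup>2 - (norm x)\<^sup>2 - r\<^sup>2) / (2 * r)}"
    by (rule countable_cos_sin_eq)
  have "x $ 1 * cos t + x $ 2 * sin t = (m\<^sup>2 - (norm x)\<^sup>2 - r\<^sup>2) / (2 * r)"
    if "norm (x + r *\<^sub>R direction t) = m" for t
  proof -
    have "x \<bullet> (r *\<^sub>R direction t) = (m\<^sup>2 - (norm x)\<^sup>2 - (norm (r *\<^sub>R direction t))\<^sup>2) / 2"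
      unfolding that[symmetric] by (rule dot_norm)
    moreover have "x \<bullet> (r *\<^sub>R direction t) = r * (x $ 1 * cos t + x $ 2 * sin t)"
      by (simp add: inner_vec_def sum_2 algebra_simps)
    moreover have "(norm (r *\<^sub>R direction t))\<^sup>2 = r\<^sup>2" by simp
    ultimately have "r * (x $ 1 * cos t + x $ 2 * sin t) = (m\<^sup>2 - (norm x)\<^sup>2 - r\<^sup>2) / 2" by (simp only:)
    then show ?thesis using assms(2) by (simp add: field_simps)
  qed
  then show ?thesis by (intro countable_subset[OF _ c]) auto
qed

context bipolar begin

text \<open>The Campbell measure, restricted to the window and divided by the mean number of points
  there, transported by the interference: the law seen by a typical transmitter.\<close>

definition palm_law :: "(real^2) set \<Rightarrow> (real^2 \<Rightarrow> real) \<Rightarrow> real measure" where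
  "palm_law B g = distr (density campbell (\<lambda>p. ennreal (indicator B (X (fst p) (snd p)) / (lam * measure lborel B))))
     borel (\<lambda>p. reduced g (fst p) (snd p))"

lemma measurable_reduced_campbell:
  assumes "g \<in> borel_measurable borel" "\<And>z. 0 \<le> g z"
  shows "(\<lambda>p. reduced g (fst p) (snd p)) \<in> borel_measurable campbell"
  by (rule measurable_campbell) (simp add: measurable_reduced[OF assms])

lemma palm_law_integral:
  fixes f :: "real \<Rightarrow> 'b::{banach,second_countable_topology}"
  assumes g: "admissible g" and B: "B \<in> sets borel" and f: "f \<in> borel_measurable borel"
  shows "(LINT x|palm_law B g. f x)
    = (1 / (lam * measure lborel B)) *\<^sub>R (LINT p|campbell. indicator B (X (fst p) (snd p)) *\<^sub>R f (reduced g (fst p) (snd p)))"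
proof -
  let ?w = "\<lambda>p. indicator B (X (fst p) (snd p)) / (lam * measure lborel B) :: real"
  note red = measurable_reduced_campbell[OF admissibleD(1,2)[OF g]]
  have w: "?w \<in> borel_measurable campbell"
    using measurable_compose[OF measurable_campbell_point borel_measurable_indicator[OF B]] by measurable
  have "(LINT x|palm_law B g. f x) = (LINT p|density campbell (\<lambda>p. ennreal (?w p)). f (reduced g (fst p) (snd p)))"
    unfolding palm_law_def using red f by (intro integral_distr) auto
  also have "\<dots> = (LINT p|campbell. ?w p *\<^sub>R f (reduced g (fst p) (snd p)))"
    using measurable_compose[OF red f] w lam_pos by (intro integral_density) auto
  also have "\<dots> = (LINT p|campbell. (1 / (lam * measure lborel B)) *\<^sub>R (indicator B (X (fst p) (snd p)) *\<^sub>R f (reduced g (fst p) (snd p))))"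
    by simp
  finally show ?thesis by (simp only: integral_scaleR_right)
qed

lemma palm_law_eq:
  assumes g: "admissible g" and B: "B \<in> sets borel" "bounded B" "measure lborel B > 0"
  shows "palm_law B g = distr M borel (interference g)"
proof -
  let ?w = "\<lambda>p. ennreal (indicator B (X (fst p) (snd p)) / (lam * measure lborel B))"
  note red = measurable_reduced_campbell[OF admissibleD(1,2)[OF g]]
  note intf = measurable_interference0[OF admissibleD(1,2)[OF g]]
  have b: "lam * measure lborel B > 0" using lam_pos B(3) by simp
  have mI: "(\<lambda>p. indicator B (X (fst p) (snd p)) :: ennreal) \<in> borel_measurable campbell"
    by (rule measurable_compose[OF measurable_campbell_point borel_measurable_indicator[OF B(1)]])
  have w: "?w \<in> borel_measurable campbell"
    using measurable_compose[OF measurable_campbell_point borel_measurable_indicator[OF B(1)]] by measurable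
  have "prob_space (density campbell ?w)"
  proof (rule prob_spaceI)
    have "emeasure (density campbell ?w) (space (density campbell ?w)) = (\<integral>\<^sup>+p. ?w p \<partial>campbell)"
      using w by (simp add: emeasure_density cong: nn_integral_cong_simp)
    also have "\<dots> = (\<integral>\<^sup>+p. ennreal (1 / (lam * measure lborel B)) * indicator B (X (fst p) (snd p)) \<partial>campbell)"
      by (intro nn_integral_cong) (simp add: indicator_def)
    also have "\<dots> = ennreal (1 / (lam * measure lborel B)) * ennreal (lam * measure lborel B)"
      by (subst nn_integral_cmult[OF mI]) (simp only: nn_integral_campbell_window[OF B(1,2)])
    also have "\<dots> = 1" using lam_pos B(3) by (simp add: ennreal_mult[symmetric])
    finally show "emeasure (density campbell ?w) (space (density campbell ?w)) = 1" .
  qed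
  then interpret D: prob_space "density campbell ?w" .
  have 1: "real_distribution (palm_law B g)"
    unfolding palm_law_def using red by (intro D.real_distribution_distr) simp
  have 2: "real_distribution (distr M borel (interference g))"
    by (rule real_distribution_distr[OF intf])
  have "char (palm_law B g) t = char (distr M borel (interference g)) t" for t
  proof -
    \<comment> \<open>The Laplace transform has exponent -s x and the characteristic function i t x,
      so s is imaginary with the opposite sign; its real part is 0.\<close>
    let ?s = "- (\<i> * of_real t)"
    have e: "iexp (t * x) = exp (- ?s * of_real x)" for x by (simp add: mult.assoc)
    have "char (palm_law B g) t
        = (1 / (lam * measure lborel B)) *\<^sub>R (LINT p|campbell. indicator B (X (fst p) (snd p)) *\<^sub>R iexp (t * reduced g (fst p) (snd p)))"
      unfolding char_def by (rule palm_law_integral[OF g B(1)]) measurable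
    also have "\<dots> = (1 / (lam * measure lborel B)) *\<^sub>R (of_real (lam * measure lborel B) * (LINT \<omega>|M. exp (- ?s * of_real (interference g \<omega>))))"
      unfolding e by (subst palm_laplace[OF g _ B(1,2)]) simp_all
    also have "\<dots> = (LINT \<omega>|M. iexp (t * interference g \<omega>))"
      using lam_pos B(3) unfolding e by (simp add: scaleR_conv_of_real)
    also have "\<dots> = char (distr M borel (interference g)) t"
      unfolding char_def by (rule integral_distr[OF intf, symmetric]) measurable
    finally show ?thesis .
  qed
  then show ?thesis by (intro Levy_uniqueness 1 2 ext)
qed

text \<open>Turns a Palm probability into an ordinary one for every property that, up to a Campbell
  null set over the window, is an event about the reduced interference. The mean number of points in
  the window cancels.\<close>

lemma palm_prob_eq:
  assumes g: "admissible g" and B: "B \<in> sets borel" "bounded B" "measure lborel B > 0"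
    and E: "\<And>i. {\<omega> \<in> space M. E i \<omega>} \<in> sets M" and A: "A \<in> sets borel"
    and AE: "AE p in campbell. X (fst p) (snd p) \<in> B \<longrightarrow> (E (fst p) (snd p) \<longleftrightarrow> reduced g (fst p) (snd p) \<in> A)"
  shows "palm_prob M X B E = measure M {\<omega> \<in> space M. interference g \<omega> \<in> A}"
proof -
  note red = measurable_reduced_campbell[OF admissibleD(1,2)[OF g]]
  note intf = measurable_interference0[OF admissibleD(1,2)[OF g]]
  have b: "lam * measure lborel B > 0" using lam_pos B(3) by simp
  let ?e = "\<lambda>i \<omega>. if E i \<omega> then 1 else 0 :: real"
  have me: "?e i \<in> borel_measurable M" for i using E[of i] by measurable
  have "(LINT \<omega>|M. real (card {i. X i \<omega> \<in> B \<and> E i \<omega>})) = (LINT \<omega>|M. (\<Sum>i | X i \<omega> \<in> B. ?e i \<omega>))"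
  proof (rule Bochner_Integration.integral_cong[OF refl])
    fix \<omega> assume "\<omega> \<in> space M"
    then have fin: "finite {i. X i \<omega> \<in> B}" by (rule finite_points[OF _ B(2)])
    have "(\<Sum>i | X i \<omega> \<in> B. ?e i \<omega>) = (\<Sum>i\<in>{i\<in>{i. X i \<omega> \<in> B}. E i \<omega>}. 1)"
      by (rule sum.inter_filter[OF fin, symmetric])
    then show "real (card {i. X i \<omega> \<in> B \<and> E i \<omega>}) = (\<Sum>i | X i \<omega> \<in> B. ?e i \<omega>)" by simp
  qed
  also have "\<dots> = (LINT p|campbell. indicator B (X (fst p) (snd p)) *\<^sub>R ?e (fst p) (snd p))"
    by (rule campbell_window_integral(2)[OF B(1,2) me, where b = 1, symmetric]) simp
  also have "\<dots> = (LINT p|campbell. indicator B (X (fst p) (snd p)) *\<^sub>R indicator A (reduced g (fst p) (snd p)))"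
  proof (rule integral_cong_AE)
    show "(\<lambda>p. indicator B (X (fst p) (snd p)) *\<^sub>R ?e (fst p) (snd p)) \<in> borel_measurable campbell"
      by (rule borel_measurable_integrable[OF campbell_window_integral(1)[OF B(1,2) me, where b = 1]]) simp
    show "(\<lambda>p. indicator B (X (fst p) (snd p)) *\<^sub>R indicator A (reduced g (fst p) (snd p)) :: real) \<in> borel_measurable campbell"
      using measurable_compose[OF measurable_campbell_point borel_measurable_indicator[OF B(1)]]
        measurable_compose[OF red borel_measurable_indicator[OF A]] by measurable
    show "AE p in campbell. indicator B (X (fst p) (snd p)) *\<^sub>R ?e (fst p) (snd p)
        = indicator B (X (fst p) (snd p)) *\<^sub>R (indicator A (reduced g (fst p) (snd p)) :: real)"
      using AE by (rule AE_mp) (intro AE_I2 impI, auto simp: indicator_def)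
  qed
  also have "\<dots> = lam * measure lborel B * (LINT x|palm_law B g. indicator A x)"
    using A b by (subst palm_law_integral[OF g B(1)]) auto
  also have "(LINT x|palm_law B g. indicator A x) = (LINT \<omega>|M. indicator A (interference g \<omega>) :: real)"
    unfolding palm_law_eq[OF g B] using A by (intro integral_distr intf) auto
  also have "\<dots> = (LINT \<omega>|M. indicator {\<omega> \<in> space M. interference g \<omega> \<in> A} \<omega>)"
    by (intro Bochner_Integration.integral_cong) (auto simp: indicator_def)
  also have "\<dots> = measure M {\<omega> \<in> space M. interference g \<omega> \<in> A}"
  proof -
    have "{\<omega> \<in> space M. interference g \<omega> \<in> A} \<in> sets M" using intf A by measurable
    then show ?thesis by simp
  qed
  finally have num: "(LINT \<omega>|M. real (card {i. X i \<omega> \<in> B \<and> E i \<omega>}))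
      = lam * measure lborel B * measure M {\<omega> \<in> space M. interference g \<omega> \<in> A}" .
  have "(LINT \<omega>|M. real (card {i. X i \<omega> \<in> B})) = lam * measure lborel B"
    using expectation_count(2)[OF B(1,2)] by (simp add: point_count_def)
  then show ?thesis using lam_pos B(3) num by (simp add: palm_prob_def)
qed

section \<open>Atoms of the interference\<close>

text \<open>With the positions and all other angles fixed, the total \<open>c\<close> prescribes the
  gain of receiver \<open>i\<close>. If this receiver is in \<open>S\<close>, injectivity puts it on
  one circle around the origin, which only countably many angles do, and an angle with uniform law
  avoids these almost surely.\<close>

lemma AE_no_atom_at_receiver:
  assumes g: "admissible g" and S: "S \<in> sets borel"
    and inj: "\<And>z z'. z \<in> S \<Longrightarrow> z' \<in> S \<Longrightarrow> g z = g z' \<Longrightarrow> norm z = norm z'"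
  shows "AE \<omega> in M. interference g \<omega> = c \<longrightarrow> Y i \<omega> \<notin> S"
proof -
  note g' = admissibleD[OF g]
  let ?R = "\<lambda>x t. enn2real (shot (- {i}) g 0 x t)"
  let ?y = "\<lambda>x t. x i + r *\<^sub>R direction (t i)"
  \<comment> \<open>The exceptional event in terms of positions and angles, with the contribution of
    receiver \<open>i\<close> split off from the rest.\<close>
  define Q where "Q = {z \<in> space (seqs \<Otimes>\<^sub>M seqs). ?y (fst z) (snd z) \<in> S \<and> g (?y (fst z) (snd z)) + ?R (fst z) (snd z) = c}"
  have my: "(\<lambda>z. ?y (fst z) (snd z)) \<in> borel_measurable (seqs \<Otimes>\<^sub>M seqs)"
    by (intro borel_measurable_add borel_measurable_scaleR borel_measurable_const
        measurable_compose[OF measurable_fst measurable_seq_component]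
        measurable_compose[OF measurable_compose[OF measurable_snd measurable_seq_component] measurable_direction])
  have mR: "(\<lambda>z. ?R (fst z) (snd z)) \<in> borel_measurable (seqs \<Otimes>\<^sub>M seqs)"
    using measurable_shot[OF g'(1), of "\<lambda>_. 0" "- {i}"] by measurable
  have Q: "Q \<in> sets (seqs \<Otimes>\<^sub>M seqs)"
    unfolding Q_def using my mR S measurable_compose[OF my g'(1)] by measurable
  have inner: "(\<integral>\<^sup>+\<omega>'. indicator Q (x, \<lambda>j. \<Theta> j \<omega>') \<partial>M) = 0" if x: "x i \<noteq> 0" for x
  proof -
    let ?Z = "\<lambda>\<omega>'. ?R x (\<lambda>j. \<Theta> j \<omega>')"
    \<comment> \<open>Measurability is needed over the other indices alone, because that is the
      space on which the independence of angle \<open>i\<close> from the rest is stated.\<close>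
    have mh: "(\<lambda>t. ?R x t) \<in> borel_measurable (PiM (- {i}) (\<lambda>_. borel))"
    proof -
      have "(\<lambda>t. ennreal (indicator (- {i}) j * g (x j + r *\<^sub>R direction (t j) - 0))) \<in> borel_measurable (PiM (- {i}) (\<lambda>_. borel))" for j
      proof (cases "j = i")
        case False
        then have "(\<lambda>t. t j) \<in> borel_measurable (PiM (- {i}) (\<lambda>_. borel :: real measure))"
          by (intro measurable_component_singleton) simp
        from measurable_compose[OF this measurable_direction]
        have "(\<lambda>t. x j + r *\<^sub>R direction (t j) - 0) \<in> borel_measurable (PiM (- {i}) (\<lambda>_. borel))" by measurable
        from measurable_compose[OF this g'(1)] show ?thesis by measurable
      qed simp
      then have "(\<lambda>t. shot (- {i}) g 0 x t) \<in> borel_measurable (PiM (- {i}) (\<lambda>_. borel))"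
        unfolding shot_def by (rule borel_measurable_suminf_order)
      then show ?thesis by measurable
    qed
    \<comment> \<open>The remaining sum does not look at angle \<open>i\<close>, so restricting the
      sequence leaves it unchanged.\<close>
    have rc: "?R x (restrict (\<lambda>j. \<Theta> j \<omega>') (- {i})) = ?Z \<omega>'" for \<omega>'
      unfolding shot_def by (intro arg_cong[where f = enn2real] suminf_cong) (simp add: indicator_def)
    have "indep_var (PiM {i} (\<lambda>_. borel)) (\<lambda>\<omega>'. restrict (\<lambda>j. \<Theta> j \<omega>') {i})
        (PiM (- {i}) (\<lambda>_. borel)) (\<lambda>\<omega>'. restrict (\<lambda>j. \<Theta> j \<omega>') (- {i}))"
      by (rule indep_var_restrict[OF indep_angles]) auto
    from indep_var_compose[OF this measurable_component_singleton[of i] mh]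
    have ind: "indep_var borel (\<Theta> i) borel ?Z"
      by (simp add: comp_def rc)
    then have mZ: "?Z \<in> borel_measurable M" and
      joint: "distr M borel (\<Theta> i) \<Otimes>\<^sub>M distr M borel ?Z = distr M (borel \<Otimes>\<^sub>M borel) (\<lambda>\<omega>'. (\<Theta> i \<omega>', ?Z \<omega>'))"
      unfolding indep_var_distribution_eq by auto
    interpret DZ: prob_space "distr M borel ?Z" by (rule prob_space_distr[OF mZ])
    interpret DP: pair_sigma_finite angle_measure "distr M borel ?Z"
      by (intro pair_sigma_finite.intro angle.sigma_finite_measure_axioms DZ.sigma_finite_measure_axioms)
    define W where "W = {z :: real \<times> real. x i + r *\<^sub>R direction (fst z) \<in> S \<and> g (x i + r *\<^sub>R direction (fst z)) + snd z = c}"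
    have md: "(\<lambda>z :: real \<times> real. x i + r *\<^sub>R direction (fst z)) \<in> borel_measurable (borel \<Otimes>\<^sub>M borel)"
      by (intro borel_measurable_add borel_measurable_scaleR borel_measurable_const
          measurable_compose[OF measurable_fst measurable_direction])
    have "{z \<in> space (borel \<Otimes>\<^sub>M borel). x i + r *\<^sub>R direction (fst z) \<in> S \<and> g (x i + r *\<^sub>R direction (fst z)) + snd z = c} \<in> sets (borel \<Otimes>\<^sub>M borel)"
      using md S measurable_compose[OF md g'(1)] by measurable
    then have W: "W \<in> sets (borel \<Otimes>\<^sub>M borel)" by (simp add: W_def space_pair_measure)
    have "(\<integral>\<^sup>+\<omega>'. indicator Q (x, \<lambda>j. \<Theta> j \<omega>') \<partial>M) = (\<integral>\<^sup>+\<omega>'. indicator W (\<Theta> i \<omega>', ?Z \<omega>') \<partial>M)"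
      by (intro nn_integral_cong) (auto simp: indicator_def Q_def W_def space_pair_measure space_PiM)
    also have "\<dots> = (\<integral>\<^sup>+z. indicator W z \<partial>distr M (borel \<Otimes>\<^sub>M borel) (\<lambda>\<omega>'. (\<Theta> i \<omega>', ?Z \<omega>')))"
      using mZ W by (intro nn_integral_distr[symmetric]) auto
    also have "\<dots> = (\<integral>\<^sup>+z. indicator W z \<partial>(angle_measure \<Otimes>\<^sub>M distr M borel ?Z))"
      by (simp only: joint[symmetric] distr_angle)
    also have "\<dots> = (\<integral>\<^sup>+\<rho>. (\<integral>\<^sup>+t. indicator W (t, \<rho>) \<partial>angle_measure) \<partial>distr M borel ?Z)"
      using W by (intro DP.nn_integral_snd[symmetric]) (simp cong: measurable_cong_sets)
    also have "\<dots> = (\<integral>\<^sup>+\<rho>. 0 \<partial>distr M borel ?Z)"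
    proof (rule nn_integral_cong)
      fix \<rho>
      \<comment> \<open>All angles of a section give the same gain as any one of them, hence the
        same norm.\<close>
      let ?T = "{t. (t, \<rho>) \<in> W}"
      have "countable ?T"
      proof (cases "?T = {}")
        case False
        then obtain t0 where t0: "t0 \<in> ?T" by blast
        have "?T \<subseteq> {t. norm (x i + r *\<^sub>R direction t) = norm (x i + r *\<^sub>R direction t0)}"
        proof
          fix t assume "t \<in> ?T"
          with t0 show "t \<in> {t. norm (x i + r *\<^sub>R direction t) = norm (x i + r *\<^sub>R direction t0)}"
            by (auto simp: W_def intro!: inj)
        qed
        then show ?thesis by (rule countable_subset) (rule countable_norm_add_direction[OF x r_pos])
      qed simp
      then have "?T \<in> sets borel" "emeasure angle_measure ?T = 0"
        by (auto intro: sets.countable emeasure_angle_countable)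
      moreover have "(\<integral>\<^sup>+t. indicator W (t, \<rho>) \<partial>angle_measure) = (\<integral>\<^sup>+t. indicator ?T t \<partial>angle_measure)"
        by (intro nn_integral_cong) (simp add: indicator_def)
      ultimately show "(\<integral>\<^sup>+t. indicator W (t, \<rho>) \<partial>angle_measure) = 0" by simp
    qed
    finally show ?thesis by simp
  qed
  have "(\<integral>\<^sup>+\<omega>. indicator Q (\<lambda>j. X j \<omega>, \<lambda>j. \<Theta> j \<omega>) \<partial>M) = (\<integral>\<^sup>+\<omega>. (\<integral>\<^sup>+\<omega>'. indicator Q (\<lambda>j. X j \<omega>, \<lambda>j. \<Theta> j \<omega>') \<partial>M) \<partial>M)"
    using Q by (intro nn_integral_decouple) simp
  also have "\<dots> = (\<integral>\<^sup>+\<omega>. 0 \<partial>M)"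
    by (rule nn_integral_cong_AE) (rule AE_mp[OF AE_transmitters_nonzero[of i]], intro AE_I2 impI, rule inner)
  finally have "(\<integral>\<^sup>+\<omega>. indicator Q (\<lambda>j. X j \<omega>, \<lambda>j. \<Theta> j \<omega>) \<partial>M) = 0" by simp
  moreover have "(\<lambda>\<omega>. indicator Q (\<lambda>j. X j \<omega>, \<lambda>j. \<Theta> j \<omega>) :: ennreal) \<in> borel_measurable M"
    by (rule measurable_compose[OF measurable_joint borel_measurable_indicator[OF Q]])
  ultimately have "AE \<omega> in M. indicator Q (\<lambda>j. X j \<omega>, \<lambda>j. \<Theta> j \<omega>) = (0::ennreal)"
    by (subst (asm) nn_integral_0_iff_AE)
  then show ?thesis
    using AE_shot_finite[OF g]
  proof eventually_elim
    case (elim \<omega>)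
    let ?x = "\<lambda>j. X j \<omega>" and ?t = "\<lambda>j. \<Theta> j \<omega>"
    have "shot UNIV g 0 ?x ?t = (\<Sum>j. ennreal (indicator {i} j * g (Y j \<omega> - 0)) + ennreal (indicator (- {i}) j * g (Y j \<omega> - 0)))"
      unfolding shot_def receiver_eq[symmetric] by (intro suminf_cong) (auto simp: indicator_def)
    also have "\<dots> = (\<Sum>j. ennreal (indicator {i} j * g (Y j \<omega> - 0))) + shot (- {i}) g 0 ?x ?t"
      unfolding shot_def receiver_eq[symmetric] by (rule suminf_add[symmetric]) auto
    also have "(\<Sum>j. ennreal (indicator {i} j * g (Y j \<omega> - 0))) = ennreal (g (Y i \<omega>))"
      by (subst suminf_finite[of "{i}"]) auto
    finally have sp: "shot UNIV g 0 ?x ?t = ennreal (g (Y i \<omega>)) + shot (- {i}) g 0 ?x ?t" .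
    \<comment> \<open>Finiteness of the rest makes \<open>enn2real\<close> additive on the two
      parts.\<close>
    then have "shot (- {i}) g 0 ?x ?t < \<infinity>" using elim(2) by simp
    then have "interference g \<omega> = g (Y i \<omega>) + ?R ?x ?t"
      unfolding interference_eq_shot[OF g'(2)] sp using g'(2) by (subst enn2real_plus) auto
    then show ?case
      using elim(1) by (auto simp: Q_def indicator_def space_pair_measure space_PiM receiver_eq split: if_splits)
  qed
qed

text \<open>If \<open>S\<close> is empty of receivers, so is its part in each ball, and the number
  of receivers there has expectation of its negative exponential equal to
  \<open>exp (- lam * ((1 - exp (- 1)) * ?m n))\<close>. Were the void probability positive, these
  areas would stay bounded. The constant \<open>1 - exp (- 1)\<close> comes from evaluating the
  Laplace transform at 1.\<close>

lemma prob_no_receiver_in: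
  assumes S: "S \<in> sets borel" "emeasure lborel S = \<infinity>"
  shows "measure M {\<omega> \<in> space M. \<forall>j. Y j \<omega> \<notin> S} = 0"
proof (rule ccontr)
  let ?N = "{\<omega> \<in> space M. \<forall>j. Y j \<omega> \<notin> S}"
  let ?m = "\<lambda>n::nat. measure lborel (S \<inter> ball 0 (real n))"
  have N: "?N \<in> sets M" using S by measurable
  assume "measure M ?N \<noteq> 0"
  then have pos: "measure M ?N > 0" by (simp add: zero_less_measure_iff)
  have bound: "measure M ?N \<le> exp (- lam * ((1 - exp (- 1)) * ?m n))" for n
  proof -
    let ?S = "S \<inter> ball 0 (real n)"
    let ?g = "indicator ?S :: real^2 \<Rightarrow> real"
    have Sn: "?S \<in> sets borel" "bounded ?S" using S by (auto intro: bounded_subset[OF bounded_ball])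
    have g: "?g \<in> borel_measurable borel" "\<And>z. 0 \<le> ?g z" "\<And>z. real n < norm z \<Longrightarrow> ?g z = 0"
      using Sn by (auto simp: indicator_def)
    have adm: "admissible ?g"
    proof -
      have "(\<integral>\<^sup>+z. ennreal (indicator {z. 1 \<le> norm z} z * ?g z) \<partial>lborel) \<le> (\<integral>\<^sup>+z. indicator ?S z \<partial>lborel)"
        by (intro nn_integral_mono) (auto simp: indicator_def)
      also have "\<dots> < \<infinity>" using Sn emeasure_bounded_finite[OF Sn(2)] by simp
      finally show ?thesis using g by (simp add: admissible_def)
    qed
    have "complex_of_real (LINT \<omega>|M. exp (- interference ?g \<omega>)) = (LINT \<omega>|M. exp (- 1 * of_real (interference ?g \<omega>)))"
      by (simp add: integral_complex_of_real[symmetric] exp_of_real[symmetric] del: exp_of_real)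
    also have "\<dots> = exp (- of_real lam * (LINT z|lborel. 1 - exp (- 1 * of_real (?g z))))"
      by (rule laplace_receivers[OF adm]) simp
    also have "(LINT z|lborel. 1 - exp (- 1 * complex_of_real (?g z))) = (LINT z|lborel. ?g z *\<^sub>R of_real (1 - exp (- 1)))"
      by (intro Bochner_Integration.integral_cong refl) (simp add: indicator_def exp_of_real[symmetric])
    also have "\<dots> = of_real ((1 - exp (- 1)) * ?m n)"
      using Sn emeasure_bounded_finite[OF Sn(2)] by (simp add: scaleR_conv_of_real mult.commute)
    also have "exp (- of_real lam * complex_of_real ((1 - exp (- 1)) * ?m n)) = of_real (exp (- lam * ((1 - exp (- 1)) * ?m n)))"
      by (simp add: exp_of_real[symmetric])
    finally have E: "(LINT \<omega>|M. exp (- interference ?g \<omega>)) = exp (- lam * ((1 - exp (- 1)) * ?m n))"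
      by (simp only: of_real_eq_iff)
    have "measure M ?N = (LINT \<omega>|M. indicator ?N \<omega>)" using N by simp
    also have "\<dots> \<le> (LINT \<omega>|M. exp (- interference ?g \<omega>))"
    proof (rule integral_mono)
      show "integrable M (\<lambda>\<omega>. indicator ?N \<omega> :: real)" using N by (simp add: less_top[symmetric])
      show "integrable M (\<lambda>\<omega>. exp (- interference ?g \<omega>))"
        using measurable_interference0[OF g(1,2)] interference_nonneg[OF g(2)]
        by (intro integrable_const_bound[where B = 1] AE_I2) (simp, measurable)
      fix \<omega> assume "\<omega> \<in> space M"
      show "indicator ?N \<omega> \<le> exp (- interference ?g \<omega>)"
      proof (cases "\<omega> \<in> ?N")
        case True
        then have "interference ?g \<omega> = 0"
          unfolding interference_def by (intro infsum_0) (simp add: indicator_def)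
        then show ?thesis by simp
      qed simp
    qed
    finally show ?thesis by (simp only: E)
  qed
  \<comment> \<open>The bound on the area obtained by taking logarithms of a positive void
    probability.\<close>
  define C where "C = - ln (measure M ?N) / (lam * (1 - exp (- 1)))"
  have k: "lam * (1 - exp (- 1)) > 0" using lam_pos by simp
  have mC: "?m n \<le> C" for n
  proof -
    have "ln (measure M ?N) \<le> - lam * ((1 - exp (- 1)) * ?m n)"
      using ln_mono[OF bound[of n] pos] by simp
    then have "?m n * (lam * (1 - exp (- 1))) \<le> - ln (measure M ?N)" by (simp add: algebra_simps)
    then show ?thesis unfolding C_def using k by (simp only: pos_le_divide_eq)
  qed
  have "(SUP n. emeasure lborel (S \<inter> ball 0 (real n))) = emeasure lborel (\<Union>n. S \<inter> ball 0 (real n))"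
    using S by (intro SUP_emeasure_incseq) (auto simp: incseq_def)
  also have "(\<Union>n. S \<inter> ball 0 (real n)) = S" by (auto intro: reals_Archimedean2)
  finally have "emeasure lborel S = (SUP n. emeasure lborel (S \<inter> ball 0 (real n)))" by simp
  also have "\<dots> \<le> ennreal C"
  proof (rule SUP_least)
    fix n
    have "bounded (S \<inter> ball 0 (real n))" by (rule bounded_subset[OF bounded_ball]) auto
    then show "emeasure lborel (S \<inter> ball 0 (real n)) \<le> ennreal C"
      using mC[of n] by (simp add: emeasure_bounded_eq ennreal_leI)
  qed
  finally show False using S(2) by (simp add: top_unique)
qed

text \<open>Attaining the value \<open>c\<close> forces all receivers out of \<open>S\<close>,
  almost surely, and then the sum is 0. So \<open>c\<close> can only be 0, and if \<open>S\<close>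
  has infinite area even this has probability 0.\<close>

lemma prob_interference_eq:
  assumes g: "admissible g" and S: "S \<in> sets borel" and off: "\<And>z. z \<notin> S \<Longrightarrow> g z = 0"
    and pos: "\<And>z. z \<in> S \<Longrightarrow> g z > 0"
    and inj: "\<And>z z'. z \<in> S \<Longrightarrow> z' \<in> S \<Longrightarrow> g z = g z' \<Longrightarrow> norm z = norm z'"
    and c: "c \<noteq> 0 \<or> emeasure lborel S = \<infinity>"
  shows "measure M {\<omega> \<in> space M. interference g \<omega> = c} = 0"
proof -
  let ?E = "{\<omega> \<in> space M. interference g \<omega> = c}"
  have E: "?E \<in> sets M" using measurable_interference0[OF admissibleD(1,2)[OF g]] by measurable
  have "AE \<omega> in M. \<forall>i. interference g \<omega> = c \<longrightarrow> Y i \<omega> \<notin> S"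
    unfolding AE_all_countable by (intro allI AE_no_atom_at_receiver[OF g S inj])
  then have no: "AE \<omega> in M. interference g \<omega> = c \<longrightarrow> (\<forall>i. Y i \<omega> \<notin> S)"
    by (rule AE_mp) (intro AE_I2 impI allI, simp)
  show ?thesis
  proof (cases "c = 0")
    case False
    have "AE \<omega> in M. \<omega> \<notin> ?E"
      using no
    proof (rule AE_mp, intro AE_I2 impI notI)
      fix \<omega> assume *: "interference g \<omega> = c \<longrightarrow> (\<forall>i. Y i \<omega> \<notin> S)" "\<omega> \<in> ?E"
      then have "interference g \<omega> = 0" unfolding interference_def by (intro infsum_0) (auto simp: off)
      with *(2) False show False by simp
    qed
    then show ?thesis by (simp only: prob_eq_0[OF E])
  next
    case True
    let ?N = "{\<omega> \<in> space M. \<forall>j. Y j \<omega> \<notin> S}"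
    have N: "?N \<in> sets M" using S by measurable
    have "AE \<omega> in M. \<omega> \<in> ?E \<longrightarrow> \<omega> \<in> ?N"
      using no by (rule AE_mp) (intro AE_I2 impI, auto)
    then have "measure M ?E \<le> measure M ?N" by (rule finite_measure_mono_AE[OF _ N])
    also have "\<dots> = 0" using c True by (intro prob_no_receiver_in S) simp
    finally show ?thesis by (simp add: measure_le_0_iff)
  qed
qed

end

section \<open>The scheduling policy\<close>

text \<open>The gap \<open>d\<close> below all denominators at \<open>u\<close> bounds the
  increments of the terms by a multiple of the terms at \<open>u\<close>, which are summable. This
  gives a Lipschitz constant for the whole sum and hence continuity up to the end point.\<close>

lemma inverse_sum_lipschitz:
  fixes e :: "nat \<Rightarrow> real"
  assumes d: "d > 0" "\<And>j. j \<in> N \<Longrightarrow> d \<le> e j - u"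
    and sm: "(\<lambda>j. 1 / (e j - u)) summable_on N"
  shows "\<And>\<eta>. \<eta> \<le> u \<Longrightarrow> (\<lambda>j. 1 / (e j - \<eta>)) summable_on N"
    and "\<And>\<eta> \<zeta>. \<eta> \<le> \<zeta> \<Longrightarrow> \<zeta> \<le> u \<Longrightarrow> infsum (\<lambda>j. 1 / (e j - \<eta>)) N \<le> infsum (\<lambda>j. 1 / (e j - \<zeta>)) N"
    and "continuous_on {..u} (\<lambda>\<eta>. infsum (\<lambda>j. 1 / (e j - \<eta>)) N)"
proof -
  let ?t = "\<lambda>\<eta>. infsum (\<lambda>j. 1 / (e j - \<eta>)) N"
  have pos: "0 < e j - \<eta>" if "j \<in> N" "\<eta> \<le> u" for j \<eta> using d(2)[OF that(1)] d(1) that(2) by linarith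
  show s: "(\<lambda>j. 1 / (e j - \<eta>)) summable_on N" if \<eta>: "\<eta> \<le> u" for \<eta>
  proof (rule summable_on_comparison_test[OF sm])
    fix j assume j: "j \<in> N"
    show "1 / (e j - \<eta>) \<le> 1 / (e j - u)"
      using pos[OF j \<eta>] pos[OF j, of u] \<eta> by (intro divide_left_mono) auto
    show "0 \<le> 1 / (e j - \<eta>)" using pos[OF j \<eta>] by simp
  qed
  show mono: "?t \<eta> \<le> ?t \<zeta>" if "\<eta> \<le> \<zeta>" "\<zeta> \<le> u" for \<eta> \<zeta>
  proof (rule infsum_mono)
    show "(\<lambda>j. 1 / (e j - \<eta>)) summable_on N" "(\<lambda>j. 1 / (e j - \<zeta>)) summable_on N" using that by (auto intro: s)
    fix j assume j: "j \<in> N"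
    show "1 / (e j - \<eta>) \<le> 1 / (e j - \<zeta>)"
      using pos[OF j, of \<zeta>] pos[OF j, of \<eta>] that by (intro divide_left_mono) auto
  qed
  have lip: "?t \<zeta> - ?t \<eta> \<le> ?t u / d * (\<zeta> - \<eta>)" if le: "\<eta> \<le> \<zeta>" "\<zeta> \<le> u" for \<eta> \<zeta>
  proof -
    have "?t \<zeta> \<le> infsum (\<lambda>j. 1 / (e j - \<eta>) + (\<zeta> - \<eta>) / d * (1 / (e j - u))) N"
    proof (rule infsum_mono)
      show "(\<lambda>j. 1 / (e j - \<zeta>)) summable_on N" by (rule s[OF le(2)])
      show "(\<lambda>j. 1 / (e j - \<eta>) + (\<zeta> - \<eta>) / d * (1 / (e j - u))) summable_on N"
        using le by (intro summable_on_add s summable_on_cmult_right[OF sm]) simp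
      fix j assume j: "j \<in> N"
      have p: "0 < e j - \<zeta>" "0 < e j - \<eta>" "0 < e j - u" using pos[OF j] le by auto
      have "1 / (e j - \<zeta>) - 1 / (e j - \<eta>) = (\<zeta> - \<eta>) / ((e j - \<zeta>) * (e j - \<eta>))"
        using p by (simp add: field_simps)
      also have "\<dots> \<le> (\<zeta> - \<eta>) / (d * (e j - u))"
        using p d d(2)[OF j] le by (intro divide_left_mono mult_mono) auto
      finally show "1 / (e j - \<zeta>) \<le> 1 / (e j - \<eta>) + (\<zeta> - \<eta>) / d * (1 / (e j - u))" by simp
    qed
    also have "\<dots> = ?t \<eta> + infsum (\<lambda>j. (\<zeta> - \<eta>) / d * (1 / (e j - u))) N"
      using le by (intro infsum_add s summable_on_cmult_right[OF sm]) simp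
    also have "infsum (\<lambda>j. (\<zeta> - \<eta>) / d * (1 / (e j - u))) N = (\<zeta> - \<eta>) / d * ?t u"
      by (rule infsum_cmult_right[OF sm])
    finally show ?thesis by (simp add: mult.commute)
  qed
  have tu: "?t u \<ge> 0" using pos by (intro infsum_nonneg) (simp add: less_imp_le)
  have "(?t u / d)-lipschitz_on {..u} ?t"
  proof (rule lipschitz_onI)
    show "0 \<le> ?t u / d" using tu d(1) by simp
    fix \<eta> \<zeta> assume *: "\<eta> \<in> {..u}" "\<zeta> \<in> {..u}"
    show "dist (?t \<eta>) (?t \<zeta>) \<le> ?t u / d * dist \<eta> \<zeta>"
    proof (cases "\<eta> \<le> \<zeta>")
      case True
      then show ?thesis using lip[of \<eta> \<zeta>] mono[of \<eta> \<zeta>] * by (simp add: dist_real_def)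
    next
      case False
      then show ?thesis using lip[of \<zeta> \<eta>] mono[of \<zeta> \<eta>] * by (simp add: dist_real_def)
    qed
  qed
  then show "continuous_on {..u} ?t" by (rule lipschitz_on_continuous_on)
qed

text \<open>Between 0 and 1 the function \<open>F\<close> decreases strictly, since 1/\<eta> does
  and every other term is nonincreasing. Two cases need care: a divergent sum, which counts as 0,
  and indices with \<open>D j = 0\<close>, whose terms blow up at \<eta> = 1 but count as 0
  there.\<close>

lemma schedule_root:
  fixes D :: "nat \<Rightarrow> real"
  assumes D: "\<And>j. j \<in> N \<Longrightarrow> 0 \<le> D j" and fin: "\<And>c. finite {j \<in> N. D j \<le> c}" and V: "V \<ge> 0"
  defines "F \<equiv> \<lambda>\<eta>. 1 / \<eta> - infsum (\<lambda>j. 1 / (1 + D j - \<eta>)) N - V"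
  assumes G: "infsum (\<lambda>j. 1 / D j) N + V > 1"
  obtains \<eta> where "0 < \<eta>" "\<eta> < 1" "F \<eta> = 0" "\<And>\<zeta> \<xi>. 0 < \<zeta> \<Longrightarrow> \<zeta> < \<xi> \<Longrightarrow> \<xi> < 1 \<Longrightarrow> F \<xi> < F \<zeta>" "F 1 < 0"
proof (cases "(\<lambda>j. 1 / D j) summable_on N")
  case False
  \<comment> \<open>Finitely many \<open>D j\<close> are at most 1, and for the others the terms are
    comparable with 1 / D j within a factor 2. So all the sums diverge together, \<open>F\<close> is
    1/\<eta> - V, and the root is 1/V.\<close>
  have nonsum: "infsum (\<lambda>j. 1 / (1 + D j - \<eta>)) N = 0" if \<eta>: "0 < \<eta>" "\<eta> < 1" for \<eta>
  proof (rule infsum_not_exists, rule notI)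
    assume sm: "(\<lambda>j. 1 / (1 + D j - \<eta>)) summable_on N"
    have "(\<lambda>j. 1 / D j) summable_on {j \<in> N. 1 < D j}"
    proof (rule summable_on_comparison_test)
      show "(\<lambda>j. 2 * (1 / (1 + D j - \<eta>))) summable_on {j \<in> N. 1 < D j}"
        by (intro summable_on_cmult_right summable_on_subset_banach[OF sm]) auto
      fix j assume "j \<in> {j \<in> N. 1 < D j}"
      then show "1 / D j \<le> 2 * (1 / (1 + D j - \<eta>))" "0 \<le> 1 / D j" using \<eta> by (auto simp: field_simps)
    qed
    moreover have "(\<lambda>j. 1 / D j) summable_on {j \<in> N. D j \<le> 1}" by (rule summable_on_finite[OF fin])
    ultimately have "(\<lambda>j. 1 / D j) summable_on ({j \<in> N. 1 < D j} \<union> {j \<in> N. D j \<le> 1})"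
      by (rule summable_on_Un_disjoint) auto
    moreover have "{j \<in> N. 1 < D j} \<union> {j \<in> N. D j \<le> 1} = N" by auto
    ultimately show False using False by simp
  qed
  have V1: "V > 1" using G False by (simp add: infsum_not_exists)
  show ?thesis
  proof (rule that[of "1 / V"])
    show "F (1 / V) = 0" using V1 by (simp add: F_def nonsum)
    show "F \<xi> < F \<zeta>" if "0 < \<zeta>" "\<zeta> < \<xi>" "\<xi> < 1" for \<zeta> \<xi>
      using that by (simp add: F_def nonsum frac_less2)
    show "F 1 < 0" using G by (simp add: F_def)
  qed (use V1 in auto)
next
  case True
  \<comment> \<open>The indices with \<open>D j = 0\<close> are split off; together they contribute
    m / (1 - \<eta>), while the rest is continuous up to \<eta> = 1.\<close>
  let ?P = "{j \<in> N. 0 < D j}" and ?Z = "{j \<in> N. D j = 0}"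
  define t where "t \<eta> = infsum (\<lambda>j. 1 / (1 + D j - \<eta>)) ?P" for \<eta>
  define m where "m = real (card ?Z)"
  have finZ: "finite ?Z" by (rule finite_subset[OF _ fin[of 0]]) auto
  \<comment> \<open>Only finitely many of the positive \<open>D j\<close> are at most 1, so their
    minimum, cut off at 1, is a positive lower bound.\<close>
  obtain d where d: "d > 0" "\<And>j. j \<in> ?P \<Longrightarrow> d \<le> D j"
  proof -
    let ?A = "insert 1 (D ` {j \<in> ?P. D j \<le> 1})"
    have fA: "finite ?A" by (intro finite.insertI finite_imageI finite_subset[OF _ fin[of 1]]) auto
    have "Min ?A \<in> ?A" by (rule Min_in[OF fA]) simp
    then have "Min ?A > 0" by auto
    moreover have "Min ?A \<le> D j" if "j \<in> ?P" for j
    proof (cases "D j \<le> 1")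
      case True
      then show ?thesis using that by (intro Min_le[OF fA]) auto
    next
      case False
      have "Min ?A \<le> 1" by (intro Min_le[OF fA]) auto
      with False show ?thesis by linarith
    qed
    ultimately show ?thesis by (rule that)
  qed
  have smP: "(\<lambda>j. 1 / (1 + D j - 1)) summable_on ?P"
    using summable_on_subset_banach[OF True, of ?P] by auto
  have dP: "d \<le> 1 + D j - 1" if "j \<in> ?P" for j using d(2)[OF that] by simp
  note L = inverse_sum_lipschitz[where e = "\<lambda>j. 1 + D j", OF d(1) dP smP]
  have NPZ: "N = ?P \<union> ?Z" using D by force
  have F: "F \<eta> = 1 / \<eta> - t \<eta> - m / (1 - \<eta>) - V" if "\<eta> \<le> 1" for \<eta>
  proof -
    have "infsum (\<lambda>j. 1 / (1 + D j - \<eta>)) (?P \<union> ?Z) = t \<eta> + infsum (\<lambda>j. 1 / (1 + D j - \<eta>)) ?Z"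
      unfolding t_def by (rule infsum_Un_disjoint[OF L(1)[OF _ that] summable_on_finite[OF finZ]]) auto
    also have "infsum (\<lambda>j. 1 / (1 + D j - \<eta>)) ?Z = m / (1 - \<eta>)"
      using finZ by (simp add: m_def)
    finally show ?thesis using NPZ by (simp add: F_def)
  qed
  have F1: "F 1 < 0" using G by (simp add: F_def)
  have tmono: "t \<eta> \<le> t \<zeta>" if "\<eta> \<le> \<zeta>" "\<zeta> \<le> 1" for \<eta> \<zeta> unfolding t_def by (rule L(2)[OF _ that])
  have tcont: "continuous_on {..1} t" unfolding t_def[abs_def] by (rule L(3))
  have m0: "m \<ge> 0" by (simp add: m_def)
  have strict: "F \<xi> < F \<zeta>" if "0 < \<zeta>" "\<zeta> < \<xi>" "\<xi> < 1" for \<zeta> \<xi>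
  proof -
    have "1 / \<xi> < 1 / \<zeta>" using that by (intro frac_less2) auto
    moreover have "m / (1 - \<zeta>) \<le> m / (1 - \<xi>)" using that m0 by (intro divide_left_mono) auto
    moreover have "t \<zeta> \<le> t \<xi>" using that by (intro tmono) auto
    ultimately show ?thesis using that by (simp add: F)
  qed
  \<comment> \<open>\<open>F\<close> without the singular term: it is continuous at 1 and negative
    there because m / 0 is 0. Thus it is negative shortly before 1, and \<open>F\<close> lies below
    it.\<close>
  let ?H = "\<lambda>\<eta>. 1 / \<eta> - t \<eta> - V"
  have "continuous_on {1/2..1} ?H"
    by (intro continuous_intros continuous_on_subset[OF tcont]) auto
  then have "(?H \<longlongrightarrow> ?H 1) (at 1 within {1/2..1})"
    unfolding continuous_on by (rule bspec) simp
  then have "(?H \<longlongrightarrow> ?H 1) (at_left 1)"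
    using at_within_Icc_at_left[of "1/2" "1::real"] by simp
  moreover have "?H 1 < 0" using F1 F[of 1] by simp
  ultimately have "eventually (\<lambda>\<eta>. ?H \<eta> < 0) (at_left 1)" by (rule order_tendstoD)
  then obtain b0 where b0: "b0 < 1" "\<And>y. b0 < y \<Longrightarrow> y < 1 \<Longrightarrow> ?H y < 0"
    using eventually_at_left[of 0 "1::real"] by auto
  define b where "b = (max b0 (1/2) + 1) / 2"
  have b: "0 < b" "b < 1" "b0 < b" using b0(1) by (auto simp: b_def max_def field_simps)
  have "m / (1 - b) \<ge> 0" using m0 b by simp
  then have Fb: "F b < 0" using b0(2)[OF b(3,2)] b by (simp add: F)
  \<comment> \<open>Chosen so that \<open>F\<close> is at least 2 at a = 1/c: the bound c \<ge> 2
    puts \<open>a\<close> at or below 1/2, where the subtracted terms are at most t (1/2), 2 m and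
    V.\<close>
  define c where "c = t (1/2) + 2 * m + V + 2"
  have "t (1/2) \<ge> 0" unfolding t_def by (rule infsum_nonneg) auto
  then have c: "c \<ge> 2" using m0 V by (simp add: c_def)
  define a where "a = 1 / c"
  have a: "0 < a" "a \<le> 1 / 2" "1 / a = c" using c by (auto simp: a_def field_simps)
  have "m / (1 - a) \<le> m / (1/2)" using a m0 by (intro divide_left_mono) auto
  moreover have "t a \<le> t (1/2)" using a by (intro tmono) auto
  ultimately have Fa: "F a > 0" using a by (simp add: F c_def)
  have ab: "a \<le> b"
  proof (rule ccontr)
    assume "\<not> a \<le> b"
    then have "F a < F b" using a b by (intro strict) auto
    with Fa Fb show False by linarith
  qed
  have "continuous_on {a..b} (\<lambda>\<eta>. 1 / \<eta> - t \<eta> - m / (1 - \<eta>) - V)"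
    using a b by (intro continuous_intros continuous_on_subset[OF tcont]) auto
  moreover have "(\<lambda>\<eta>. 1 / \<eta> - t \<eta> - m / (1 - \<eta>) - V) \<eta> = F \<eta>" if "\<eta> \<in> {a..b}" for \<eta> using that b by (simp add: F)
  ultimately have "continuous_on {a..b} F" by (rule continuous_on_eq)
  then obtain \<eta> where \<eta>: "a \<le> \<eta>" "\<eta> \<le> b" "F \<eta> = 0"
    using IVT2'[of F b 0 a] Fa Fb ab by auto
  show ?thesis
    by (rule that[of \<eta>]) (use \<eta> a b strict F1 in auto)
qed

text \<open>Strict monotonicity makes the root unique and turns "the root exceeds \<kappa>" into
  positivity of the function at \<kappa>.\<close>

lemma access_prob_iff:
  fixes y :: "nat \<Rightarrow> real^2" and lam \<alpha> T r \<kappa> :: real and S :: "(real^2) set" and J :: "nat set"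
  defines "D \<equiv> \<lambda>j. path_ratio \<alpha> T r (y j)" and "N \<equiv> {j \<in> J. y j \<in> S}"
    and "V \<equiv> LINT z:(- S)|lborel. lam / (1 + path_ratio \<alpha> T r z)"
  assumes params: "lam > 0" "T > 0" "r > 0" and fin: "\<And>c. finite {j \<in> J. path_ratio \<alpha> T r (y j) \<le> c}"
  shows "0 < \<kappa> \<Longrightarrow> \<kappa> < 1 \<Longrightarrow> access_prob lam \<alpha> T r S J y > \<kappa> \<longleftrightarrow>
      infsum (\<lambda>j. 1 / D j) N + V \<le> 1 \<or> 1 / \<kappa> - infsum (\<lambda>j. 1 / (1 + D j - \<kappa>)) N - V > 0"
    and "access_prob lam \<alpha> T r S J y = 1 \<longleftrightarrow> infsum (\<lambda>j. 1 / D j) N + V \<le> 1"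
proof -
  let ?N = N and ?V = V
  let ?F = "\<lambda>\<eta>. 1 / \<eta> - infsum (\<lambda>j. 1 / (1 + D j - \<eta>)) ?N - ?V"
  let ?a = "access_prob lam \<alpha> T r S J y"
  have D: "D j \<ge> 0" for j using params by (simp add: D_def path_ratio_def)
  have finN: "finite {j \<in> ?N. D j \<le> c}" for c
    by (rule finite_subset[OF _ fin[of c]]) (auto simp: N_def D_def)
  have V: "?V \<ge> 0"
    unfolding V_def set_lebesgue_integral_def
    using params by (intro Bochner_Integration.integral_nonneg) (auto simp: path_ratio_def indicator_def intro!: divide_nonneg_nonneg add_nonneg_nonneg)
  have pm: "path_ratio \<alpha> T r (0 - z) = path_ratio \<alpha> T r z" for z by (simp add: path_ratio_def)
  have acc: "?a = (if infsum (\<lambda>j. 1 / D j) ?N + ?V > 1 then THE \<eta>. 0 < \<eta> \<and> \<eta> \<le> 1 \<and> ?F \<eta> = 0 else 1)"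
    unfolding access_prob_def Let_def pm D_def N_def V_def by (rule refl)
  have 1: "?a = 1" if "infsum (\<lambda>j. 1 / D j) ?N + ?V \<le> 1" using that by (simp add: acc)
  have 2: "?a < 1 \<and> (\<forall>\<kappa>. 0 < \<kappa> \<and> \<kappa> < 1 \<longrightarrow> (\<kappa> < ?a \<longleftrightarrow> 0 < ?F \<kappa>))" if G: "infsum (\<lambda>j. 1 / D j) ?N + ?V > 1"
  proof -
    obtain \<eta> where \<eta>: "0 < \<eta>" "\<eta> < 1" "?F \<eta> = 0" and
      strict: "\<And>\<zeta> \<xi>. 0 < \<zeta> \<Longrightarrow> \<zeta> < \<xi> \<Longrightarrow> \<xi> < 1 \<Longrightarrow> ?F \<xi> < ?F \<zeta>" and F1: "?F 1 < 0"
      by (rule schedule_root[OF D finN V G]) (rule that)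
    have "(THE \<eta>. 0 < \<eta> \<and> \<eta> \<le> 1 \<and> ?F \<eta> = 0) = \<eta>"
    proof (rule the_equality)
      show "0 < \<eta> \<and> \<eta> \<le> 1 \<and> ?F \<eta> = 0" using \<eta> by simp
      fix \<zeta> assume \<zeta>: "0 < \<zeta> \<and> \<zeta> \<le> 1 \<and> ?F \<zeta> = 0"
      \<comment> \<open>The policy admits 1 as a solution, but the function is negative there, so
        uniqueness is only at stake below 1.\<close>
      then have "\<zeta> \<noteq> 1" using F1 by auto
      then have "\<zeta> < 1" using \<zeta> by simp
      then show "\<zeta> = \<eta>"
        using strict[of \<zeta> \<eta>] strict[of \<eta> \<zeta>] \<zeta> \<eta> by (cases \<zeta> \<eta> rule: linorder_cases) auto
    qed
    then have a: "?a = \<eta>" using G by (simp only: acc if_True)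
    have "\<kappa> < \<eta> \<longleftrightarrow> 0 < ?F \<kappa>" if "0 < \<kappa>" "\<kappa> < 1" for \<kappa>
      using strict[of \<kappa> \<eta>] strict[of \<eta> \<kappa>] that \<eta> by (cases \<kappa> \<eta> rule: linorder_cases) auto
    then show ?thesis using a \<eta> by simp
  qed
  show "?a > \<kappa> \<longleftrightarrow> infsum (\<lambda>j. 1 / D j) ?N + ?V \<le> 1 \<or> ?F \<kappa> > 0" if \<kappa>: "0 < \<kappa>" "\<kappa> < 1"
  proof (cases "infsum (\<lambda>j. 1 / D j) ?N + ?V \<le> 1")
    case True
    then show ?thesis using 1 \<kappa> by simp
  next
    case False
    then show ?thesis using 2 \<kappa> by simp
  qed
  show "?a = 1 \<longleftrightarrow> infsum (\<lambda>j. 1 / D j) ?N + ?V \<le> 1"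
  proof (cases "infsum (\<lambda>j. 1 / D j) ?N + ?V \<le> 1")
    case True
    then show ?thesis using 1 by simp
  next
    case False
    then show ?thesis using 2 by simp
  qed
qed

section \<open>The distribution of the access probability\<close>

text \<open>A summand of \<U> as a function of the position of the receiver. For \<kappa> = 1 its
  value at the origin is 0, through division by 0.\<close>

definition gain :: "real \<Rightarrow> real \<Rightarrow> real \<Rightarrow> real \<Rightarrow> (real^2) set \<Rightarrow> real^2 \<Rightarrow> real" where
  "gain \<alpha> T r \<kappa> S z = \<kappa> * indicator S z / (path_ratio \<alpha> T r z + 1 - \<kappa>)"

lemma path_ratio_nonneg: "T > 0 \<Longrightarrow> r > 0 \<Longrightarrow> 0 \<le> path_ratio \<alpha> T r z"
  by (simp add: path_ratio_def)

lemma path_ratio_pos: "T > 0 \<Longrightarrow> r > 0 \<Longrightarrow> z \<noteq> 0 \<Longrightarrow> 0 < path_ratio \<alpha> T r z"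
  by (simp add: path_ratio_def)

lemma path_ratio_inj:
  assumes "T > 0" "r > 0" "\<alpha> > 2" "path_ratio \<alpha> T r z = path_ratio \<alpha> T r z'"
  shows "norm z = norm z'"
proof -
  have "norm z powr \<alpha> = norm z' powr \<alpha>" using assms by (simp add: path_ratio_def)
  then have "(norm z powr \<alpha>) powr (1 / \<alpha>) = (norm z' powr \<alpha>) powr (1 / \<alpha>)" by simp
  then show ?thesis using assms by (simp add: powr_powr)
qed

lemma path_ratio_le_imp:
  assumes "T > 0" "r > 0" "\<alpha> > 2" "path_ratio \<alpha> T r z \<le> c"
  shows "norm z \<le> (max c 0 * (T * r powr \<alpha>)) powr (1 / \<alpha>)"
proof -
  have "path_ratio \<alpha> T r z \<le> max c 0" using assms(4) by simp
  then have "norm z powr \<alpha> \<le> max c 0 * (T * r powr \<alpha>)"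
    using assms by (simp add: path_ratio_def divide_le_eq)
  then have "(norm z powr \<alpha>) powr (1 / \<alpha>) \<le> (max c 0 * (T * r powr \<alpha>)) powr (1 / \<alpha>)"
    using assms by (intro powr_mono2) auto
  then show ?thesis using assms by (simp add: powr_powr)
qed

lemma measurable_path_ratio: "path_ratio \<alpha> T r \<in> borel_measurable borel"
  unfolding path_ratio_def[abs_def] by measurable

lemma gain_nonneg: "T > 0 \<Longrightarrow> r > 0 \<Longrightarrow> 0 \<le> \<kappa> \<Longrightarrow> \<kappa> \<le> 1 \<Longrightarrow> 0 \<le> gain \<alpha> T r \<kappa> S z"
  using path_ratio_nonneg[of T r \<alpha> z] by (simp add: gain_def)

text \<open>As \<kappa> \<le> 1, the gain is at most the reciprocal of the path ratio, a multiple of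
  \<open>norm z powr - \<alpha>\<close>, which is integrable outside the unit disc.\<close>

lemma admissible_gain:
  assumes "T > 0" "r > 0" "\<alpha> > 2" "0 \<le> \<kappa>" "\<kappa> \<le> 1" "S \<in> sets borel"
  shows "admissible (gain \<alpha> T r \<kappa> S)"
proof -
  let ?g = "gain \<alpha> T r \<kappa> S"
  have m: "?g \<in> borel_measurable borel"
    unfolding gain_def[abs_def] using measurable_path_ratio assms by measurable
  have le: "indicator {z. 1 \<le> norm z} z * ?g z \<le> T * r powr \<alpha> * (indicator {z. 1 \<le> norm z} z * norm z powr - \<alpha>)" for z
  proof (cases "1 \<le> norm z")
    case True
    then have p: "path_ratio \<alpha> T r z > 0" using assms by (intro path_ratio_pos) auto
    have "?g z \<le> 1 / path_ratio \<alpha> T r z"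
      unfolding gain_def using p assms by (intro frac_le) (auto simp: indicator_def)
    also have "\<dots> = T * r powr \<alpha> * norm z powr - \<alpha>"
      by (simp add: path_ratio_def powr_minus field_simps)
    finally show ?thesis using True by simp
  qed simp
  have mp: "(\<lambda>z::real^2. ennreal (indicator {z. 1 \<le> norm z} z * norm z powr - \<alpha>)) \<in> borel_measurable lborel"
  proof -
    have "{z::real^2. 1 \<le> norm z} \<in> sets borel" by measurable
    then show ?thesis by measurable
  qed
  have "(\<integral>\<^sup>+z. ennreal (indicator {z. 1 \<le> norm z} z * ?g z) \<partial>lborel)
      \<le> (\<integral>\<^sup>+z. ennreal (T * r powr \<alpha>) * ennreal (indicator {z. 1 \<le> norm z} z * norm z powr - \<alpha>) \<partial>(lborel :: (real^2) measure))"
  proof (rule nn_integral_mono)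
    fix z :: "real^2"
    have "ennreal (indicator {z. 1 \<le> norm z} z * ?g z)
        \<le> ennreal (T * r powr \<alpha> * (indicator {z. 1 \<le> norm z} z * norm z powr - \<alpha>))"
      by (rule ennreal_leI[OF le])
    also have "\<dots> = ennreal (T * r powr \<alpha>) * ennreal (indicator {z. 1 \<le> norm z} z * norm z powr - \<alpha>)"
      using assms by (intro ennreal_mult) auto
    finally show "ennreal (indicator {z. 1 \<le> norm z} z * ?g z)
        \<le> ennreal (T * r powr \<alpha>) * ennreal (indicator {z. 1 \<le> norm z} z * norm z powr - \<alpha>)" .
  qed
  also have "\<dots> = ennreal (T * r powr \<alpha>) * (\<integral>\<^sup>+z. ennreal (indicator {z. 1 \<le> norm z} z * norm z powr - \<alpha>) \<partial>(lborel :: (real^2) measure))"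
    by (rule nn_integral_cmult[OF mp])
  also have "\<dots> < \<infinity>"
    using nn_integral_norm_powr_outside_ball[OF assms(3)] by (simp add: ennreal_mult_less_top)
  finally show ?thesis using m gain_nonneg[OF assms(1,2,4,5)] by (simp add: admissible_def)
qed

lemma \<V>_eq:
  "\<V> lam \<alpha> T r \<kappa> S = \<kappa> * (LINT z:(- S)|lborel. lam / (1 + path_ratio \<alpha> T r z))"
proof -
  have "\<V> lam \<alpha> T r \<kappa> S = (LINT z:(- S)|lborel. \<kappa> * (lam / (1 + path_ratio \<alpha> T r z)))"
    unfolding \<V>_def by (simp add: mult.commute)
  then show ?thesis by (simp only: set_integral_mult_right)
qed

context bipolar begin

lemma \<U>_eq: "\<U> \<alpha> T r Y \<kappa> S = interference (gain \<alpha> T r \<kappa> S)"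
  by (simp add: \<U>_def[abs_def] interference_def[abs_def] gain_def)

lemma laplace_\<U>:
  assumes "T > 0" "\<alpha> > 2" "0 < \<kappa>" "\<kappa> \<le> 1" "S \<in> sets borel" "Re s \<ge> 0"
  shows "laplace_transform M (\<U> \<alpha> T r Y \<kappa> S) s = exp (- of_real lam *
    (LINT z:S|lborel. 1 - exp (- (s * of_real (\<kappa> * T * r powr \<alpha>) / of_real (norm z powr \<alpha> + (1 - \<kappa>) * T * r powr \<alpha>)))))"
proof -
  have "s * of_real (gain \<alpha> T r \<kappa> S z)
      = s * of_real (\<kappa> * T * r powr \<alpha>) / of_real (norm z powr \<alpha> + (1 - \<kappa>) * T * r powr \<alpha>)" if "z \<in> S" for z
  proof -
    have "path_ratio \<alpha> T r z + 1 - \<kappa> = (norm z powr \<alpha> + (1 - \<kappa>) * T * r powr \<alpha>) / (T * r powr \<alpha>)"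
      using assms r_pos by (simp add: path_ratio_def field_simps)
    then have "gain \<alpha> T r \<kappa> S z = \<kappa> * T * r powr \<alpha> / (norm z powr \<alpha> + (1 - \<kappa>) * T * r powr \<alpha>)"
      using that by (simp add: gain_def mult.assoc)
    then show ?thesis by (simp only: of_real_divide times_divide_eq_right)
  qed
  then have "(LINT z|lborel. 1 - exp (- s * of_real (gain \<alpha> T r \<kappa> S z)))
      = (LINT z:S|lborel. 1 - exp (- (s * of_real (\<kappa> * T * r powr \<alpha>) / of_real (norm z powr \<alpha> + (1 - \<kappa>) * T * r powr \<alpha>))))"
    unfolding set_lebesgue_integral_def
    by (intro Bochner_Integration.integral_cong refl) (auto simp: indicator_def gain_def)
  then show ?thesis
    unfolding laplace_transform_def \<U>_eq
    by (subst laplace_receivers[OF admissible_gain]) (use assms r_pos in simp_all)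
qed

text \<open>For \<kappa> = 1 the origin is removed from \<open>S\<close>, because the gain is 0
  there instead of positive; a point has area 0, so infinite area is kept.\<close>

lemma gain_no_atom:
  assumes "T > 0" "\<alpha> > 2" "0 < \<kappa>" "\<kappa> \<le> 1" "S \<in> sets borel" and c: "c \<noteq> 0 \<or> emeasure lborel S = \<infinity>"
  shows "measure M {\<omega> \<in> space M. interference (gain \<alpha> T r \<kappa> S) \<omega> = c} = 0"
proof -
  define S' where "S' = (if \<kappa> = 1 then S - {0} else S)"
  have S': "S' \<in> sets borel" using assms by (simp add: S'_def)
  have den: "path_ratio \<alpha> T r z + 1 - \<kappa> > 0" if "z \<in> S'" for z
  proof (cases "\<kappa> = 1")
    case True
    then have "z \<noteq> 0" using that by (simp add: S'_def)
    then show ?thesis using path_ratio_pos[of T r z \<alpha>] assms r_pos True by simp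
  next
    case False
    then show ?thesis using path_ratio_nonneg[of T r \<alpha> z] assms r_pos by simp
  qed
  have sub: "S' \<subseteq> S" by (auto simp: S'_def)
  show ?thesis
  proof (rule prob_interference_eq[OF _ S'])
    show "admissible (gain \<alpha> T r \<kappa> S)" using assms r_pos by (intro admissible_gain) auto
    show "gain \<alpha> T r \<kappa> S z = 0" if "z \<notin> S'" for z
      using that assms by (auto simp: S'_def gain_def path_ratio_def split: if_splits)
    show "gain \<alpha> T r \<kappa> S z > 0" if "z \<in> S'" for z
      using den[OF that] that sub assms by (auto simp: gain_def)
    show "norm z = norm z'" if "z \<in> S'" "z' \<in> S'" "gain \<alpha> T r \<kappa> S z = gain \<alpha> T r \<kappa> S z'" for z z'
    proof -
      have "\<kappa> / (path_ratio \<alpha> T r z + 1 - \<kappa>) = \<kappa> / (path_ratio \<alpha> T r z' + 1 - \<kappa>)"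
      proof -
        have "z \<in> S" "z' \<in> S" using that sub by auto
        then show ?thesis using that(3) by (simp add: gain_def)
      qed
      then have "path_ratio \<alpha> T r z = path_ratio \<alpha> T r z'"
        using den[OF that(1)] den[OF that(2)] assms(3) by (simp add: frac_eq_eq)
      then show ?thesis using assms r_pos by (intro path_ratio_inj[of T r \<alpha>])
    qed
    show "c \<noteq> 0 \<or> emeasure lborel S' = \<infinity>"
    proof (cases "c = 0")
      case True
      then have inf: "emeasure lborel S = \<infinity>" using c by simp
      have "emeasure lborel (S - {0}) = emeasure lborel S"
        using assms by (intro emeasure_Diff_null_set) auto
      then show ?thesis using inf by (simp add: S'_def)
    qed simp
  qed
qed

text \<open>The first alternative is the case of access probability 1. In the other case the
  defining equation is multiplied by \<kappa>, which turns its sum into the reduced interference for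
  \<kappa>.\<close>

lemma access_prob_at_iff:
  fixes \<alpha> T \<kappa> :: real and S :: "(real^2) set"
  assumes params: "T > 0" "\<alpha> > 2" and \<omega>: "\<omega> \<in> space M"
  defines "V \<equiv> LINT z:(- S)|lborel. lam / (1 + path_ratio \<alpha> T r z)"
  shows "0 < \<kappa> \<Longrightarrow> \<kappa> < 1 \<Longrightarrow> access_prob_at lam \<alpha> T r S X \<Theta> i \<omega> > \<kappa> \<longleftrightarrow>
      reduced (gain \<alpha> T r 1 S) i \<omega> \<le> 1 - V \<or> reduced (gain \<alpha> T r \<kappa> S) i \<omega> < 1 - \<kappa> * V"
    and "access_prob_at lam \<alpha> T r S X \<Theta> i \<omega> = 1 \<longleftrightarrow> reduced (gain \<alpha> T r 1 S) i \<omega> \<le> 1 - V"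
proof -
  let ?y = "\<lambda>j. Y j \<omega> - X i \<omega>"
  let ?N = "{j \<in> - {i}. ?y j \<in> S}"
  have fin: "finite {j \<in> - {i}. path_ratio \<alpha> T r (?y j) \<le> c}" for c
  proof (rule finite_subset)
    let ?R = "(max c 0 * (T * r powr \<alpha>)) powr (1 / \<alpha>)"
    show "{j \<in> - {i}. path_ratio \<alpha> T r (?y j) \<le> c} \<subseteq> {j. X j \<omega> \<in> cball (X i \<omega>) (?R + r)}"
    proof (rule subsetI)
      fix j assume "j \<in> {j \<in> - {i}. path_ratio \<alpha> T r (?y j) \<le> c}"
      then have "path_ratio \<alpha> T r (?y j) \<le> c" by simp
      then have "norm (?y j) \<le> ?R" using params r_pos by (intro path_ratio_le_imp) auto
      moreover have "norm (X j \<omega> - X i \<omega>) \<le> norm (?y j) + norm (r *\<^sub>R direction (\<Theta> j \<omega>))"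
        using norm_triangle_ineq4[of "?y j" "r *\<^sub>R direction (\<Theta> j \<omega>)"] by (simp add: receiver_eq algebra_simps)
      ultimately show "j \<in> {j. X j \<omega> \<in> cball (X i \<omega>) (?R + r)}"
        using r_pos by (simp add: dist_norm norm_minus_commute)
    qed
    show "finite {j. X j \<omega> \<in> cball (X i \<omega>) (?R + r)}" by (rule finite_points[OF \<omega>]) simp
  qed
  have red1: "infsum (\<lambda>j. 1 / path_ratio \<alpha> T r (?y j)) ?N = reduced (gain \<alpha> T r 1 S) i \<omega>"
    unfolding reduced_def by (rule infsum_cong_neutral) (auto simp: gain_def indicator_def)
  have red: "\<kappa> * infsum (\<lambda>j. 1 / (1 + path_ratio \<alpha> T r (?y j) - \<kappa>)) ?N = reduced (gain \<alpha> T r \<kappa> S) i \<omega>" for \<kappa>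
  proof -
    have "\<kappa> * infsum (\<lambda>j. 1 / (1 + path_ratio \<alpha> T r (?y j) - \<kappa>)) ?N
        = infsum (\<lambda>j. \<kappa> * (1 / (1 + path_ratio \<alpha> T r (?y j) - \<kappa>))) ?N"
      by (rule infsum_cmult_right'[symmetric])
    also have "\<dots> = reduced (gain \<alpha> T r \<kappa> S) i \<omega>"
      unfolding reduced_def by (rule infsum_cong_neutral) (auto simp: gain_def indicator_def add.commute)
    finally show ?thesis .
  qed
  have one: "access_prob_at lam \<alpha> T r S X \<Theta> i \<omega> = 1 \<longleftrightarrow> reduced (gain \<alpha> T r 1 S) i \<omega> + V \<le> 1"
    unfolding access_prob_at_def V_def red1[symmetric]
    by (rule access_prob_iff(2)[OF lam_pos params(1) r_pos fin])
  have greater: "access_prob_at lam \<alpha> T r S X \<Theta> i \<omega> > \<kappa> \<longleftrightarrow> reduced (gain \<alpha> T r 1 S) i \<omega> + V \<le> 1 \<or>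
      1 / \<kappa> - infsum (\<lambda>j. 1 / (1 + path_ratio \<alpha> T r (?y j) - \<kappa>)) ?N - V > 0" if "0 < \<kappa>" "\<kappa> < 1"
    unfolding access_prob_at_def V_def red1[symmetric]
    by (rule access_prob_iff(1)[OF lam_pos params(1) r_pos fin that])
  show "access_prob_at lam \<alpha> T r S X \<Theta> i \<omega> = 1 \<longleftrightarrow> reduced (gain \<alpha> T r 1 S) i \<omega> \<le> 1 - V"
    using one by (simp add: le_diff_eq)
  show "access_prob_at lam \<alpha> T r S X \<Theta> i \<omega> > \<kappa> \<longleftrightarrow>
      reduced (gain \<alpha> T r 1 S) i \<omega> \<le> 1 - V \<or> reduced (gain \<alpha> T r \<kappa> S) i \<omega> < 1 - \<kappa> * V" if \<kappa>: "0 < \<kappa>" "\<kappa> < 1"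
  proof -
    let ?s = "infsum (\<lambda>j. 1 / (1 + path_ratio \<alpha> T r (?y j) - \<kappa>)) ?N"
    have "1 / \<kappa> - ?s - V > 0 \<longleftrightarrow> \<kappa> * (1 / \<kappa> - ?s - V) > 0" using \<kappa> by (simp add: zero_less_mult_iff)
    also have "\<kappa> * (1 / \<kappa> - ?s - V) = 1 - reduced (gain \<alpha> T r \<kappa> S) i \<omega> - \<kappa> * V"
      using \<kappa> by (simp add: red[symmetric] algebra_simps)
    finally show ?thesis using greater[OF \<kappa>] by (auto simp: le_diff_eq)
  qed
qed

text \<open>Away from the origin the gain for \<kappa> is at most \<kappa> times the gain for 1. The
  sum on the right must be finite, as otherwise its real value would be 0 and the inequality could
  fail.\<close>

lemma AE_reduced_gain_le:
  assumes params: "T > 0" "\<alpha> > 2" and S: "S \<in> sets borel" and B: "B \<in> sets borel" "bounded B"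
    and \<kappa>: "0 < \<kappa>" "\<kappa> \<le> 1"
  shows "AE p in campbell. X (fst p) (snd p) \<in> B \<longrightarrow>
    reduced (gain \<alpha> T r \<kappa> S) (fst p) (snd p) \<le> \<kappa> * reduced (gain \<alpha> T r 1 S) (fst p) (snd p)"
proof -
  let ?g = "gain \<alpha> T r \<kappa> S" and ?h = "gain \<alpha> T r 1 S"
  have g: "admissible ?g" and h: "admissible ?h"
    using params \<kappa> S r_pos by (auto intro: admissible_gain)
  show ?thesis
    using AE_receivers_apart[OF B(1)] AE_reduced_shot_finite[OF h B]
  proof eventually_elim
    case (elim p)
    show ?case
    proof
      assume XB: "X (fst p) (snd p) \<in> B"
      let ?a = "X (fst p) (snd p)" and ?x = "\<lambda>i. X i (snd p)" and ?t = "\<lambda>i. \<Theta> i (snd p)"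
      have apart: "Y j (snd p) \<noteq> ?a" if "j \<noteq> fst p" for j using elim(1) XB that by blast
      have fin: "shot (- {fst p}) ?h ?a ?x ?t < \<infinity>" using elim(2) XB by blast
      have le: "?g z \<le> \<kappa> * ?h z" if "z \<noteq> 0" for z
      proof -
        have p: "path_ratio \<alpha> T r z > 0" using params r_pos that by (intro path_ratio_pos)
        have "\<kappa> / (path_ratio \<alpha> T r z + 1 - \<kappa>) \<le> \<kappa> / path_ratio \<alpha> T r z"
          using p \<kappa> by (intro divide_left_mono) auto
        then show ?thesis by (simp add: gain_def indicator_def)
      qed
      have "shot (- {fst p}) ?g ?a ?x ?t \<le> (\<Sum>j. ennreal \<kappa> * ennreal (indicator (- {fst p}) j * ?h (?x j + r *\<^sub>R direction (?t j) - ?a)))"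
        unfolding shot_def
      proof (intro suminf_le summableI)
        fix j
        show "ennreal (indicator (- {fst p}) j * ?g (?x j + r *\<^sub>R direction (?t j) - ?a))
            \<le> ennreal \<kappa> * ennreal (indicator (- {fst p}) j * ?h (?x j + r *\<^sub>R direction (?t j) - ?a))"
        proof (cases "j = fst p")
          case False
          then have "?x j + r *\<^sub>R direction (?t j) - ?a \<noteq> 0" using apart[OF False] by (simp add: receiver_eq)
          from le[OF this] show ?thesis
            using False \<kappa> admissibleD(2)[OF h] by (simp add: ennreal_mult[symmetric] ennreal_leI)
        qed simp
      qed
      also have "\<dots> = ennreal \<kappa> * shot (- {fst p}) ?h ?a ?x ?t"
        unfolding shot_def by (rule ennreal_suminf_cmult)
      finally have "enn2real (shot (- {fst p}) ?g ?a ?x ?t) \<le> enn2real (ennreal \<kappa> * shot (- {fst p}) ?h ?a ?x ?t)"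
        using fin by (intro enn2real_mono) (auto simp: ennreal_mult_less_top)
      then show "reduced ?g (fst p) (snd p) \<le> \<kappa> * reduced ?h (fst p) (snd p)"
        using \<kappa> by (simp add: reduced_eq_shot[OF admissibleD(2)[OF g]] reduced_eq_shot[OF admissibleD(2)[OF h]] enn2real_mult)
    qed
  qed
qed

text \<open>Up to null sets the access probability exceeds \<kappa> exactly when the reduced
  interference for \<kappa> is below its threshold. This requires no condition on the area of
  \<open>S\<close>, because the inequality is strict on both sides.\<close>

lemma palm_prob_access_greater:
  assumes params: "T > 0" "\<alpha> > 2" and S: "S \<in> sets borel"
    and B: "B \<in> sets borel" "bounded B" "measure lborel B > 0" and \<kappa>: "0 < \<kappa>" "\<kappa> < 1"
  shows "palm_prob M X B (\<lambda>i \<omega>. access_prob_at lam \<alpha> T r S X \<Theta> i \<omega> > \<kappa>)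
    = measure M {\<omega> \<in> space M. interference (gain \<alpha> T r \<kappa> S) \<omega> < 1 - \<V> lam \<alpha> T r \<kappa> S}"
proof -
  let ?V = "LINT z:(- S)|lborel. lam / (1 + path_ratio \<alpha> T r z)"
  let ?g = "gain \<alpha> T r \<kappa> S" and ?h = "gain \<alpha> T r 1 S"
  have g: "admissible ?g" and h: "admissible ?h"
    using params \<kappa> S r_pos by (auto intro: admissible_gain)
  note iff = access_prob_at_iff(1)[OF params, where \<kappa> = \<kappa> and S = S]
  have E: "{\<omega> \<in> space M. access_prob_at lam \<alpha> T r S X \<Theta> i \<omega> > \<kappa>} \<in> sets M" for i
  proof -
    have "{\<omega> \<in> space M. access_prob_at lam \<alpha> T r S X \<Theta> i \<omega> > \<kappa>}
        = {\<omega> \<in> space M. reduced ?h i \<omega> \<le> 1 - ?V \<or> reduced ?g i \<omega> < 1 - \<kappa> * ?V}"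
      using iff \<kappa> by auto
    also have "\<dots> \<in> sets M"
      using measurable_reduced[OF admissibleD(1,2)[OF g], of i] measurable_reduced[OF admissibleD(1,2)[OF h], of i]
      by measurable
    finally show ?thesis .
  qed
  have "AE p in campbell. X (fst p) (snd p) \<in> B \<longrightarrow>
      (access_prob_at lam \<alpha> T r S X \<Theta> (fst p) (snd p) > \<kappa> \<longleftrightarrow> reduced ?g (fst p) (snd p) \<in> {..<1 - \<kappa> * ?V})"
    using AE_reduced_gain_le[OF params S B(1,2) \<kappa>(1) less_imp_le[OF \<kappa>(2)]] AE_space
  proof (eventually_elim)
    case (elim p)
    show ?case
    proof
      assume "X (fst p) (snd p) \<in> B"
      then have le: "reduced ?g (fst p) (snd p) \<le> \<kappa> * reduced ?h (fst p) (snd p)" using elim(1) \<kappa> by simp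
      \<comment> \<open>The case of access probability 1 is absorbed: the left side is at most
        \<kappa> - \<kappa> V, and \<kappa> < 1.\<close>
      have "reduced ?g (fst p) (snd p) < 1 - \<kappa> * ?V" if "reduced ?h (fst p) (snd p) \<le> 1 - ?V"
      proof -
        have "\<kappa> * reduced ?h (fst p) (snd p) \<le> \<kappa> * (1 - ?V)" using that \<kappa> by (intro mult_left_mono) auto
        then show ?thesis using le \<kappa> by (simp add: algebra_simps)
      qed
      moreover have "snd p \<in> space M" using elim(2) by (auto simp: space_pair_measure)
      ultimately show "access_prob_at lam \<alpha> T r S X \<Theta> (fst p) (snd p) > \<kappa> \<longleftrightarrow> reduced ?g (fst p) (snd p) \<in> {..<1 - \<kappa> * ?V}"
        using iff[of "snd p" "fst p"] \<kappa> by auto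
    qed
  qed
  from palm_prob_eq[OF g B E _ this] show ?thesis by (simp add: \<V>_eq)
qed

text \<open>The policy yields a weak inequality and the claim a strict one. They differ by the event
  that the interference equals its threshold, which is null unless the threshold is 0 and
  \<open>S\<close> has finite area.\<close>

lemma palm_prob_access_one:
  assumes params: "T > 0" "\<alpha> > 2" and S: "S \<in> sets borel"
    and B: "B \<in> sets borel" "bounded B" "measure lborel B > 0"
    and atom: "emeasure lborel S = \<infinity> \<or> \<V> lam \<alpha> T r 1 S \<noteq> 1"
  shows "palm_prob M X B (\<lambda>i \<omega>. access_prob_at lam \<alpha> T r S X \<Theta> i \<omega> = 1)
    = measure M {\<omega> \<in> space M. interference (gain \<alpha> T r 1 S) \<omega> < 1 - \<V> lam \<alpha> T r 1 S}"
proof -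
  let ?V = "LINT z:(- S)|lborel. lam / (1 + path_ratio \<alpha> T r z)"
  let ?h = "gain \<alpha> T r 1 S"
  have V: "\<V> lam \<alpha> T r 1 S = ?V" by (simp add: \<V>_eq)
  have h: "admissible ?h" using params S r_pos by (auto intro: admissible_gain)
  note intf = measurable_interference0[OF admissibleD(1,2)[OF h]]
  note iff = access_prob_at_iff(2)[OF params, where S = S]
  have E: "{\<omega> \<in> space M. access_prob_at lam \<alpha> T r S X \<Theta> i \<omega> = 1} \<in> sets M" for i
  proof -
    have "{\<omega> \<in> space M. access_prob_at lam \<alpha> T r S X \<Theta> i \<omega> = 1} = {\<omega> \<in> space M. reduced ?h i \<omega> \<le> 1 - ?V}"
      using iff by auto
    also have "\<dots> \<in> sets M" using measurable_reduced[OF admissibleD(1,2)[OF h], of i] by measurable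
    finally show ?thesis .
  qed
  have "AE p in campbell. X (fst p) (snd p) \<in> B \<longrightarrow>
      (access_prob_at lam \<alpha> T r S X \<Theta> (fst p) (snd p) = 1 \<longleftrightarrow> reduced ?h (fst p) (snd p) \<in> {..1 - ?V})"
    by (intro AE_I2 impI, subst iff) (auto simp: space_pair_measure)
  from palm_prob_eq[OF h B E _ this]
  have "palm_prob M X B (\<lambda>i \<omega>. access_prob_at lam \<alpha> T r S X \<Theta> i \<omega> = 1)
      = measure M {\<omega> \<in> space M. interference ?h \<omega> \<le> 1 - ?V}" by simp
  also have "\<dots> = measure M {\<omega> \<in> space M. interference ?h \<omega> < 1 - ?V}"
  proof (rule finite_measure_eq_AE)
    have "measure M {\<omega> \<in> space M. interference ?h \<omega> = 1 - ?V} = 0"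
      using params S atom by (intro gain_no_atom) (auto simp: V)
    then have "AE \<omega> in M. \<omega> \<notin> {\<omega> \<in> space M. interference ?h \<omega> = 1 - ?V}"
      by (subst prob_eq_0[symmetric]) (rule borel_measurable_eq[OF intf borel_measurable_const])
    then show "AE \<omega> in M. (\<omega> \<in> {\<omega> \<in> space M. interference ?h \<omega> \<le> 1 - ?V}) = (\<omega> \<in> {\<omega> \<in> space M. interference ?h \<omega> < 1 - ?V})"
      by (rule AE_mp) (intro AE_I2 impI, auto)
  qed (use intf in measurable)
  finally show ?thesis by (simp only: V)
qed

text \<open>Levy's formula is applied to the interval between 0 and \<open>c\<close>. For c > 0 its
  mass is the probability sought, as the interference is nonnegative and has no atom at either end.
  For c < 0 the interval carries no mass and the probability is 0. For c = 0 the integrand vanishes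
  identically, so freedom from atoms is asked only for other \<open>c\<close>.\<close>

lemma inversion_interference:
  assumes g: "admissible g" and atoms: "c \<noteq> 0 \<Longrightarrow> measure M {\<omega> \<in> space M. interference g \<omega> = 0} = 0"
    "c \<noteq> 0 \<Longrightarrow> measure M {\<omega> \<in> space M. interference g \<omega> = c} = 0"
  shows "has_inversion_integral
    (\<lambda>w. laplace_transform M (interference g) (\<i> * of_real w) * ((exp (\<i> * of_real w * of_real c) - 1) / (\<i> * of_real w)))
    (of_real (measure M {\<omega> \<in> space M. interference g \<omega> < c}))"
proof -
  let ?U = "interference g"
  let ?\<mu> = "distr M borel ?U"
  note intf[measurable] = measurable_interference0[OF admissibleD(1,2)[OF g]]
  have U0: "?U \<omega> \<ge> 0" for \<omega> by (rule interference_nonneg[OF admissibleD(2)[OF g]])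
  interpret \<mu>: real_distribution ?\<mu> by (rule real_distribution_distr[OF intf])
  define f where "f w = laplace_transform M ?U (\<i> * of_real w) * ((exp (\<i> * of_real w * of_real c) - 1) / (\<i> * of_real w))" for w :: real
  have chr: "laplace_transform M ?U (\<i> * of_real (- t)) = char ?\<mu> t" for t :: real
  proof -
    have "char ?\<mu> t = (LINT \<omega>|M. iexp (t * ?U \<omega>))"
      unfolding char_def by (rule integral_distr[OF intf]) measurable
    then show ?thesis by (simp add: laplace_transform_def mult.assoc)
  qed
  \<comment> \<open>The substitution w = -t turns the Laplace transform on the imaginary axis into
    the characteristic function, and the sign of the denominator exchanges the two terms of the
    numerator; the symmetric integral is unchanged.\<close>
  have fm: "f (- t) = (iexp (- (t * 0)) - iexp (- (t * c))) / (\<i> * t) * char ?\<mu> t" for t :: real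
  proof -
    have "(exp (\<i> * of_real (- t) * of_real c) - 1) / (\<i> * of_real (- t)) = (iexp (- (t * 0)) - iexp (- (t * c))) / (\<i> * of_real t)"
      by (simp add: minus_divide_left[symmetric] mult.assoc) (simp add: minus_divide_left)
    then show ?thesis unfolding f_def chr by (simp only: mult.commute)
  qed
  have reflect: "(CLBINT w=-R..R. f w) = (CLBINT t=-R..R. (iexp (- (t * 0)) - iexp (- (t * c))) / (\<i> * t) * char ?\<mu> t)" for R :: real
    unfolding fm[symmetric] by (subst interval_integral_reflect) simp
  have meas: "measure ?\<mu> A = measure M {\<omega> \<in> space M. ?U \<omega> \<in> A}" if "A \<in> sets borel" for A
    using that by (subst measure_distr) (auto intro!: arg_cong[where f = "measure M"])
  have "((\<lambda>R::real. 1 / (2 * pi) * (CLBINT w=-R..R. f w)) \<longlongrightarrow> of_real (measure M {\<omega> \<in> space M. ?U \<omega> < c})) at_top"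
  proof (cases c "0::real" rule: linorder_cases)
    case greater
    have "((\<lambda>R::real. 1 / (2 * pi) * (CLBINT w=-R..R. f w)) \<longlongrightarrow> of_real (measure ?\<mu> {0<..c})) at_top"
      unfolding reflect using greater atoms
      by (intro \<mu>.Levy_Inversion_at_top) (simp_all add: meas)
    also have "measure ?\<mu> {0<..c} = measure M {\<omega> \<in> space M. ?U \<omega> \<in> {0<..c}}" by (rule meas) simp
    also have "\<dots> = measure M {\<omega> \<in> space M. ?U \<omega> < c}"
    proof (rule finite_measure_eq_AE)
      have "AE \<omega> in M. \<omega> \<notin> {\<omega> \<in> space M. ?U \<omega> = 0}"
        proof (subst prob_eq_0[symmetric])
        show "{\<omega> \<in> space M. ?U \<omega> = 0} \<in> sets M" using intf by (rule borel_measurable_eq[OF _ borel_measurable_const])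
        show "measure M {\<omega> \<in> space M. ?U \<omega> = 0} = 0" using atoms(1) greater by simp
      qed
      moreover have "AE \<omega> in M. \<omega> \<notin> {\<omega> \<in> space M. ?U \<omega> = c}"
        proof (subst prob_eq_0[symmetric])
        show "{\<omega> \<in> space M. ?U \<omega> = c} \<in> sets M" using intf by (rule borel_measurable_eq[OF _ borel_measurable_const])
        show "measure M {\<omega> \<in> space M. ?U \<omega> = c} = 0" using atoms(2) greater by simp
      qed
      ultimately show "AE \<omega> in M. (\<omega> \<in> {\<omega> \<in> space M. ?U \<omega> \<in> {0<..c}}) = (\<omega> \<in> {\<omega> \<in> space M. ?U \<omega> < c})"
      proof eventually_elim
        case (elim \<omega>)
        then show ?case using U0[of \<omega>] by auto
      qed
    qed measurable
    finally show ?thesis .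
  next
    case equal
    have "{\<omega> \<in> space M. ?U \<omega> < c} = {}" using U0 equal by (auto simp: not_less)
    then have "measure M {\<omega> \<in> space M. ?U \<omega> < c} = 0" by (simp only: measure_empty)
    then show ?thesis using equal by (simp add: f_def)
  next
    case less
    \<comment> \<open>Levy's formula needs the end points in increasing order, so for c < 0 they are
      exchanged, at the price of a sign.\<close>
    have "((\<lambda>R::real. 1 / (2 * pi) * (CLBINT t=-R..R. (iexp (- (t * c)) - iexp (- (t * 0))) / (\<i> * t) * char ?\<mu> t))
        \<longlongrightarrow> of_real (measure ?\<mu> {c<..0})) at_top"
      using less atoms by (intro \<mu>.Levy_Inversion_at_top) (simp_all add: meas)
    moreover have "measure ?\<mu> {c<..0} = 0"
    proof -
      have "{\<omega> \<in> space M. ?U \<omega> \<in> {c<..0}} = {\<omega> \<in> space M. ?U \<omega> = 0}"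
        using less U0 by (auto intro: antisym)
      then show ?thesis using atoms(1) less by (simp add: meas)
    qed
    moreover have "(CLBINT t=-R..R. (iexp (- (t * c)) - iexp (- (t * 0))) / (\<i> * t) * char ?\<mu> t) = - (CLBINT w=-R..R. f w)" for R :: real
    proof -
      have "(\<lambda>t::real. (iexp (- (t * c)) - iexp (- (t * 0))) / (\<i> * t) * char ?\<mu> t)
          = (\<lambda>t. - ((iexp (- (t * 0)) - iexp (- (t * c))) / (\<i> * t) * char ?\<mu> t))"
        by (rule ext) (simp only: mult_minus_left[symmetric] minus_divide_left minus_diff_eq)
      then show ?thesis unfolding reflect by (simp only: interval_lebesgue_integral_uminus)
    qed
    ultimately have "((\<lambda>R::real. - (1 / (2 * pi) * (CLBINT w=-R..R. f w))) \<longlongrightarrow> 0) at_top" by simp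
    from tendsto_minus[OF this] have "((\<lambda>R::real. 1 / (2 * pi) * (CLBINT w=-R..R. f w)) \<longlongrightarrow> 0) at_top" by simp
    moreover have "{\<omega> \<in> space M. ?U \<omega> < c} = {}" using U0 less by (auto simp: not_less intro: order_trans[of _ 0])
    then have "measure M {\<omega> \<in> space M. ?U \<omega> < c} = 0" by (simp only: measure_empty)
    ultimately show ?thesis by simp
  qed
  then show ?thesis unfolding has_inversion_integral_def f_def .
qed

end

theorem theorem2:
  fixes M :: "'w measure"
    and X :: "nat \<Rightarrow> 'w \<Rightarrow> real^2"
    and \<Theta> :: "nat \<Rightarrow> 'w \<Rightarrow> real"
    and lam \<alpha> T r :: real
    and S B :: "(real^2) set"
  assumes network: "bipolar_network M lam X \<Theta>"
    and params: "lam > 0" "\<alpha> > 2" "T > 0" "r > 0"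
    and S: "S \<in> sets borel"
    and B: "B \<in> sets borel" "bounded B" "measure lborel B > 0"
  shows
    "(\<forall>\<kappa>. 0 < \<kappa> \<and> \<kappa> < 1 \<and> (emeasure lborel S = \<infinity> \<or> \<V> lam \<alpha> T r \<kappa> S = 1) \<longrightarrow>
        has_inversion_integral
          (\<lambda>w. laplace_transform M (\<U> \<alpha> T r (receiver r X \<Theta>) \<kappa> S) (\<i> * of_real w) *
               ((exp (\<i> * of_real w * of_real (1 - \<V> lam \<alpha> T r \<kappa> S)) - 1) / (\<i> * of_real w)))
          (of_real (palm_prob M X B (\<lambda>i \<omega>. access_prob_at lam \<alpha> T r S X \<Theta> i \<omega> > \<kappa>)))) \<and>
     (emeasure lborel S = \<infinity> \<or> \<V> lam \<alpha> T r 1 S \<noteq> 1 \<longrightarrow>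
        palm_prob M X B (\<lambda>i \<omega>. access_prob_at lam \<alpha> T r S X \<Theta> i \<omega> = 1) =
          measure M {\<omega> \<in> space M.
            \<U> \<alpha> T r (receiver r X \<Theta>) 1 S \<omega> < 1 - \<V> lam \<alpha> T r 1 S}) \<and>
     (\<forall>\<kappa> s. 0 < \<kappa> \<and> \<kappa> \<le> 1 \<and> Re s \<ge> 0 \<longrightarrow>
        laplace_transform M (\<U> \<alpha> T r (receiver r X \<Theta>) \<kappa> S) s =
          exp (- of_real lam *
            (LINT z:S|lborel.
               1 - exp (- (s * of_real (\<kappa> * T * r powr \<alpha>) /
                     of_real (norm z powr \<alpha> + (1 - \<kappa>) * T * r powr \<alpha>))))))"
proof -
  interpret bipolar M X lam \<Theta> r
    using network params unfolding bipolar_network_def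
    by (intro bipolar.intro poisson_process.intro poisson_process_axioms.intro bipolar_axioms.intro)
      (auto simp: bipolar_network_def)
  have inversion: "has_inversion_integral
      (\<lambda>w. laplace_transform M (\<U> \<alpha> T r Y \<kappa> S) (\<i> * of_real w) *
        ((exp (\<i> * of_real w * of_real (1 - \<V> lam \<alpha> T r \<kappa> S)) - 1) / (\<i> * of_real w)))
      (of_real (palm_prob M X B (\<lambda>i \<omega>. access_prob_at lam \<alpha> T r S X \<Theta> i \<omega> > \<kappa>)))"
    if \<kappa>: "0 < \<kappa>" "\<kappa> < 1" and S': "emeasure lborel S = \<infinity> \<or> \<V> lam \<alpha> T r \<kappa> S = 1" for \<kappa>
    unfolding palm_prob_access_greater[OF params(3,2) S B \<kappa>] \<U>_eq
  proof (rule inversion_interference)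
    show "admissible (gain \<alpha> T r \<kappa> S)" using params S \<kappa> by (intro admissible_gain) auto
    \<comment> \<open>A nonzero threshold leaves only the first alternative of the side condition,
      so the interference has no atoms at all.\<close>
    assume "1 - \<V> lam \<alpha> T r \<kappa> S \<noteq> 0"
    then have "emeasure lborel S = \<infinity>" using S' by simp
    then show "measure M {\<omega> \<in> space M. interference (gain \<alpha> T r \<kappa> S) \<omega> = 0} = 0"
      "measure M {\<omega> \<in> space M. interference (gain \<alpha> T r \<kappa> S) \<omega> = 1 - \<V> lam \<alpha> T r \<kappa> S} = 0"
      using params S \<kappa> by (auto intro!: gain_no_atom)
  qed
  show ?thesis
    using inversion palm_prob_access_one[OF params(3,2) S B] laplace_\<U>[OF params(3,2) _ _ S]
    unfolding \<U>_eq by (intro conjI allI impI) auto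
qed

end
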